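(* Let $(\mathfrak g,\diamond)$ be a Novikov algebra over $\mathbb K$. For $n\ge1$ let $$\mathfrak C^n_{\mathrm{Nov}}(\mathfrak g)=\bigoplus_{(k_{n-1},\dots,k_0)\in K_n}\mathrm{Hom}(\wedge^{k_{n-1}}\mathfrak g\otimes\cdots\otimes\wedge^{k_0}\mathfrak g,\mathfrak g),$$ and define $d^n_{\mathrm{Nov}}:\mathfrak C^n_{\mathrm{Nov}}(\mathfrak g)\to\mathfrak C^{n+1}_{\mathrm{Nov}}(\mathfrak g)$ by $$d^n_{\mathrm{Nov}}=\Phi_{n+1}\circ\delta^n\circ\Phi_n^{-1}=(\Phi_{n+1}\Psi_{n+1})\circ d^n_{\mathrm{CE}}\circ(\Phi_n\Psi_n)^{-1}.$$ Then $(\mathfrak C^\bullet_{\mathrm{Nov}}(\mathfrak g)=\bigoplus_{n\ge1}\mathfrak C^n_{\mathrm{Nov}}(\mathfrak g),d_{\mathrm{Nov}})$ is a cochain complex, i.e. $d^{n+1}_{\mathrm{Nov}}\circ d^n_{\mathrm{Nov}}=0$ for all $n\ge1$.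
   Context: $\mathbb K$ is a field of characteristic $0$; all vector spaces are over $\mathbb K$. A (left) Novikov algebra is a vector space $\mathfrak g$ with a bilinear operation $\diamond$ satisfying $(x\diamond y)\diamond z-x\diamond(y\diamond z)=(y\diamond x)\diamond z-y\diamond(x\diamond z)$ and $(x\diamond y)\diamond z=(x\diamond z)\diamond y$. Write $\omega(x\otimes y)=x\diamond y$. Conventions: for an $n$-linear map $f$ and $\sigma\in S_n$, $f^\sigma(x_1,\dots,x_n)=f(x_{\sigma^{-1}(1)},\dots,x_{\sigma^{-1}(n)})$; $(-1)^\sigma$ is the sign. $\mathrm{Sh}^{-1}(i,j)$ ($i+j=m$) is the set of $\sigma\in S_m$ with $\sigma^{-1}(1)<\dots<\sigma^{-1}(i)$ and $\sigma^{-1}(i+1)<\dots<\sigma^{-1}(m)$. $\mathrm{End}_{\mathfrak g}$ is the endomorphism operad, $\mathrm{End}_{\mathfrak g}(n)=\mathrm{Hom}(\mathfrak g^{\otimes n},\mathfrak g)$. Operad $rNov$: let $ComDer$ be the operad generated by a unary $D$ and a symmetric binary $\mu$ with $\mu\circ(\mu,\mathrm{id})=\mu\circ(\mathrm{id},\mu)$ and $D\circ\mu=\mu\circ(D,\mathrm{id})+\mu\circ(\mathrm{id},D)$; $\mu_n$ denotes the $n$-fold product. The operad $rNov$ of right Novikov algebras is identified with the suboperad of $ComDer$ such that $rNov(n)$ has basis $\mu_n\circ(D^{p_1},\dots,D^{p_n})$, $(p_1,\dots,p_n)\in P_n$, where $P_n=\{(p_1,\dots,p_n)\in\mathbb N^n\mid\sum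 p_i=n-1\}$ and $\mathbb N=\{0,1,2,\dots\}$; $\big(\mu_n\circ(D^{p_1},\dots,D^{p_n})\big)^\sigma=\mu_n\circ(D^{p_{\sigma(1)}},\dots,D^{p_{\sigma(n)}})$. Chevalley–Eilenberg complex: $\mathcal O=rNov\otimes_{\mathrm H}\mathrm{End}_{\mathfrak g}$ is the Hadamard product ($\mathcal O(n)=rNov(n)\otimes\mathrm{End}_{\mathfrak g}(n)$, diagonal action, componentwise composition). Put $\alpha(\nu)=\mu\circ(D,\mathrm{id})\otimes\omega-\mu\circ(\mathrm{id},D)\otimes\omega^{(1\,2)}\in\mathcal O(2)$, $\mathrm{CE}^n(\mathcal O)=\{F\in\mathcal O(n)\mid F^\sigma=(-1)^\sigma F\ \forall\sigma\in S_n\}$, and $$d^n_{\mathrm{CE}}(F)=\sum_{\sigma\in\mathrm{Sh}^{-1}(1,n)}(-1)^\sigma\big(\alpha(\nu)\circ(\mathrm{id},F)\big)^\sigma-\sum_{\sigma\in\mathrm{Sh}^{-1}(2,n-1)}(-1)^\sigma\big(F\circ(\alpha(\nu),\mathrm{id},\dots,\mathrm{id})\big)^\sigma .$$ (The element $\alpha(\nu)$ is the image of the generator $\nu$ under an operad morphism $\alpha:Lie\to\mathcal O$, and $(\mathrm{CE}^\bullet(\mathcal O),d_{\mathrm{CE}})$ is a cochain complex.) Intermediate complex: $\mathscr C^n(\mathfrak g)$ is the space of families $\{f^{(p_1,\dots,p_n)}\}_{(p_1,\dots,p_n)\in P_n}$ with $f^{(p_1,\dots,p_n)}\in\mathrm{End}_{\mathfrak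 g}(n)$ and $(f^{(p_1,\dots,p_n)})^\sigma=(-1)^\sigma f^{(p_{\sigma(1)},\dots,p_{\sigma(n)})}$ for all $\sigma\in S_n$. $\Psi_n:\mathrm{CE}^n(\mathcal O)\to\mathscr C^n(\mathfrak g)$ is the linear isomorphism sending $\sum_{P_n}\mu_n\circ(D^{p_1},\dots,D^{p_n})\otimes f^{(p_1,\dots,p_n)}$ to $\{f^{(p_1,\dots,p_n)}\}_{P_n}$, and $\delta^n=\Psi_{n+1}\circ d^n_{\mathrm{CE}}\circ\Psi_n^{-1}$. Index sets: $P_n^{\mathrm{ord}}=\{(p_1,\dots,p_n)\in P_n\mid p_1\ge\dots\ge p_n\}$, $K_n=\{(k_{n-1},\dots,k_0)\in\mathbb N^n\mid\sum_ik_i=n,\ \sum_i ik_i=n-1\}$. The bijection $\phi_n:P_n^{\mathrm{ord}}\to K_n$ sends $(p_1,\dots,p_n)$ to $(k_{n-1},\dots,k_0)$ with $k_j=|\{i\mid p_i=j\}|$. $\Phi_n:\mathscr C^n(\mathfrak g)\to\mathfrak C^n_{\mathrm{Nov}}(\mathfrak g)$ is the linear isomorphism restricting a family to $P_n^{\mathrm{ord}}$, the component $f^{(p_1,\dots,p_n)}$ being placed in the summand indexed by $\phi_n(p_1,\dots,p_n)$. *)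

theory Defs
  imports
    Complex_Main
    "HOL-Library.Function_Algebras"
    "HOL-Combinatorics.Permutations"
begin

section \<open>Novikov algebras\<close>

locale novikov_algebra = vector_space scale
  for scale :: "'k::field_char_0 \<Rightarrow> 'g::ab_group_add \<Rightarrow> 'g" +
  fixes nov :: "'g \<Rightarrow> 'g \<Rightarrow> 'g" (infixl "\<diamondop>" 70)
  assumes linear_left: "Vector_Spaces.linear scale scale (\<lambda>x. x \<diamondop> y)"
    and linear_right: "Vector_Spaces.linear scale scale (\<lambda>y. x \<diamondop> y)"
    and left_symmetric:
      "(x \<diamondop> y) \<diamondop> z - x \<diamondop> (y \<diamondop> z) = (y \<diamondop> x) \<diamondop> z - y \<diamondop> (x \<diamondop> z)"
    and right_commutative: "(x \<diamondop> y) \<diamondop> z = (x \<diamondop> z) \<diamondop> y"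


section \<open>Operads and the Chevalley--Eilenberg complex\<close>

text \<open>
  Inputs are numbered from \<open>0\<close>, so \<open>S\<^sub>n\<close> is the set of all \<open>\<sigma>\<close> with \<open>\<sigma> permutes {..<n}\<close>.
  Arities are not recoverable from elements (zero lies in every arity), so the composite
  \<open>F \<circ> (G\<^sub>1, \<dots>, G\<^sub>m)\<close> takes the list of pairs (arity of \<open>G\<^sub>i\<close>, \<open>G\<^sub>i\<close>).
\<close>

record ('k, 'a) operad =
  arity_space :: "nat \<Rightarrow> 'a set"
  smult :: "'k \<Rightarrow> 'a \<Rightarrow> 'a"
  act :: "(nat \<Rightarrow> nat) \<Rightarrow> 'a \<Rightarrow> 'a"
  ident :: 'a
  compose :: "'a \<Rightarrow> (nat \<times> 'a) list \<Rightarrow> 'a"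

definition Sh_inv :: "nat \<Rightarrow> nat \<Rightarrow> (nat \<Rightarrow> nat) set" where
  "Sh_inv i j = {\<sigma>. \<sigma> permutes {..<i + j} \<and>
     strict_mono_on {..<i} (inv \<sigma>) \<and> strict_mono_on {i..<i + j} (inv \<sigma>)}"

definition CE :: "('k::field_char_0, 'a::ab_group_add) operad \<Rightarrow> nat \<Rightarrow> 'a set" where
  "CE Op n = {F \<in> arity_space Op n.
     \<forall>\<sigma>. \<sigma> permutes {..<n} \<longrightarrow> act Op \<sigma> F = smult Op (of_int (sign \<sigma>)) F}"

text \<open>The differential determined by \<open>\<nu>\<close>, the image of the Lie bracket in arity two.\<close>

definition d_CE :: "('k::field_char_0, 'a::ab_group_add) operad \<Rightarrow> 'a \<Rightarrow> nat \<Rightarrow> 'a \<Rightarrow> 'a" where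
  "d_CE Op \<nu> n F =
     (\<Sum>\<sigma> \<in> Sh_inv 1 n. smult Op (of_int (sign \<sigma>))
        (act Op \<sigma> (compose Op \<nu> [(1, ident Op), (n, F)]))) -
     (\<Sum>\<sigma> \<in> Sh_inv 2 (n - 1). smult Op (of_int (sign \<sigma>))
        (act Op \<sigma> (compose Op F ((2, \<nu>) # replicate (n - 1) (1, ident Op)))))"

text \<open>
  On \<open>n\<close>-linear maps \<open>perm_act \<sigma> f\<close> is \<open>f\<^sup>\<sigma>\<close>, because \<open>permute_list \<tau> xs\<close> has the entry
  \<open>xs ! \<tau> i\<close> at place \<open>i\<close>. On coefficient functions of exponent lists it sends the basis
  element with exponents \<open>p\<close> to the one with exponents \<open>permute_list \<sigma> p\<close>.
\<close>

definition perm_act :: "(nat \<Rightarrow> nat) \<Rightarrow> ('x list \<Rightarrow> 'y) \<Rightarrow> 'x list \<Rightarrow> 'y" where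
  "perm_act \<sigma> f = (\<lambda>xs. f (permute_list (inv \<sigma>) xs))"


section \<open>The endomorphism operad\<close>

text \<open>An \<open>n\<close>-linear map is a function on lists which is zero on lists of length other than \<open>n\<close>.\<close>

definition multilinear_maps ::
    "('k::field \<Rightarrow> 'g::ab_group_add \<Rightarrow> 'g) \<Rightarrow> nat \<Rightarrow> ('g list \<Rightarrow> 'g) set" where
  "multilinear_maps scale n = {f.
     (\<forall>xs. length xs \<noteq> n \<longrightarrow> f xs = 0) \<and>
     (\<forall>xs i. length xs = n \<longrightarrow> i < n \<longrightarrow>
        Vector_Spaces.linear scale scale (\<lambda>x. f (xs[i := x])))}"

fun apply_blocks :: "(nat \<times> ('g list \<Rightarrow> 'g)) list \<Rightarrow> 'g list \<Rightarrow> 'g list" where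
  "apply_blocks [] xs = []"
| "apply_blocks ((n, g) # gs) xs = g (take n xs) # apply_blocks gs (drop n xs)"

definition EndOp ::
    "('k::field \<Rightarrow> 'g::ab_group_add \<Rightarrow> 'g) \<Rightarrow> ('k, 'g list \<Rightarrow> 'g) operad" where
  "EndOp scale = \<lparr>
     arity_space = multilinear_maps scale,
     smult = (\<lambda>c f xs. scale c (f xs)),
     act = perm_act,
     ident = (\<lambda>xs. if length xs = 1 then hd xs else 0),
     compose = (\<lambda>f gs xs.
       if length xs = sum_list (map fst gs) then f (apply_blocks gs xs) else 0)\<rparr>"


section \<open>The operads ComDer and rNov\<close>

text \<open>
  By the Leibniz rule every composite of \<open>D\<close> and \<open>\<mu>\<close> is a linear combination of the
  elements \<open>\<mu>\<^sub>n \<circ> (D\<^sup>p\<^sup>1, \<dots>, D\<^sup>p\<^sup>n)\<close>, which form a basis of \<open>ComDer(n)\<close>. An element of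
  \<open>ComDer(n)\<close> is represented by its coefficients in this basis: a finitely supported function
  of the exponent list, where \<open>single p\<close> is the basis element with exponents \<open>p\<close>.
  The relations of the presentation fix the composition, since they say that \<open>D\<close> is a
  derivation of the product, and the product of basis elements concatenates exponents.
  The relations, and the fact that \<open>single p\<close> is the named composite of generators,
  are proved below.
\<close>

definition supp :: "('x \<Rightarrow> 'a::zero) \<Rightarrow> 'x set" where
  "supp r = {x. r x \<noteq> 0}"

definition single :: "'x \<Rightarrow> 'x \<Rightarrow> 'k::field" where
  "single x = (\<lambda>y. if y = x then 1 else 0)"

definition cd_mul :: "(nat list \<Rightarrow> 'k::field) \<Rightarrow> (nat list \<Rightarrow> 'k) \<Rightarrow> nat list \<Rightarrow> 'k" where
  "cd_mul r s = (\<lambda>q. \<Sum>p \<in> supp r. \<Sum>p' \<in> supp s. r p * s p' * single (p @ p') q)"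

definition cd_der :: "(nat list \<Rightarrow> 'k::field) \<Rightarrow> nat list \<Rightarrow> 'k" where
  "cd_der r = (\<lambda>q. \<Sum>p \<in> supp r. \<Sum>i < length p. r p * single (p[i := Suc (p ! i)]) q)"

definition ComDer :: "('k::field, nat list \<Rightarrow> 'k) operad" where
  "ComDer = \<lparr>
     arity_space = (\<lambda>n. {r. finite (supp r) \<and> (\<forall>p \<in> supp r. length p = n \<and> 1 \<le> n)}),
     smult = (\<lambda>c r p. c * r p),
     act = perm_act,
     ident = single [0],
     compose = (\<lambda>r ss q. \<Sum>p \<in> supp r.
       r p * foldr cd_mul (map2 (\<lambda>a s. (cd_der ^^ a) s) p (map snd ss)) (single []) q)\<rparr>"

definition cd_D :: "nat list \<Rightarrow> 'k::field" where
  "cd_D = single [1]"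

definition cd_mu :: "nat list \<Rightarrow> 'k::field" where
  "cd_mu = single [0, 0]"

primrec cd_D_power :: "nat \<Rightarrow> nat list \<Rightarrow> 'k::field" where
  "cd_D_power 0 = ident ComDer"
| "cd_D_power (Suc a) = compose ComDer cd_D [(1, cd_D_power a)]"

text \<open>The index is one less than the arity: \<open>cd_mu_power m\<close> is \<open>\<mu>\<^sub>m\<^sub>+\<^sub>1\<close>.\<close>

primrec cd_mu_power :: "nat \<Rightarrow> nat list \<Rightarrow> 'k::field" where
  "cd_mu_power 0 = ident ComDer"
| "cd_mu_power (Suc m) = compose ComDer cd_mu [(Suc m, cd_mu_power m), (1, ident ComDer)]"

definition cd_monomial :: "nat list \<Rightarrow> nat list \<Rightarrow> 'k::field" where
  "cd_monomial p = compose ComDer (cd_mu_power (length p - 1)) (map (\<lambda>a. (1, cd_D_power a)) p)"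

definition P_set :: "nat \<Rightarrow> nat list set" where
  "P_set n = {p. length p = n \<and> sum_list p + 1 = n}"

definition rNov :: "('k::field, nat list \<Rightarrow> 'k) operad" where
  "rNov = ComDer\<lparr>arity_space := (\<lambda>n. module.span (smult ComDer) (cd_monomial ` P_set n))\<rparr>"


subsection \<open>The presentation\<close>

lemma supp_single [simp]: "supp (single p :: _ \<Rightarrow> 'k::field) = {p}"
  by (auto simp: supp_def single_def)

lemma single_self [simp]: "single p p = 1"
  by (simp add: single_def)

lemma cd_mul_single: "cd_mul (single p) (single q) = single (p @ q)"
  by (rule ext) (simp add: cd_mul_def)

lemma cd_der_single: "cd_der (single p) = (\<lambda>q. \<Sum>i < length p. single (p[i := Suc (p ! i)]) q)"
  by (rule ext) (simp add: cd_der_def)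

lemma cd_der_single1: "cd_der (single [a]) = single [Suc a]"
  by (simp add: cd_der_single)

lemma cd_der_single2:
  "cd_der (single [a, b]) = (\<lambda>q. single [Suc a, b] q + single [a, Suc b] q)"
  by (simp add: cd_der_single numeral_2_eq_2)

lemma compose_single: "compose ComDer (single p) ss =
    foldr cd_mul (map2 (\<lambda>a s. (cd_der ^^ a) s) p (map snd ss)) (single [])"
  by (rule ext) (simp add: ComDer_def)

lemma ident_ComDer: "ident ComDer = single [0]"
  by (simp add: ComDer_def)

lemma cd_mul_single_Nil: "finite (supp r) \<Longrightarrow> cd_mul r (single []) = r"
  by (rule ext) (auto simp: cd_mul_def single_def if_distrib[of "\<lambda>x. _ * x"] sum.delta' supp_def
    cong: if_cong)

lemma finite_supp_cd_der:
  assumes "finite (supp r)"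
  shows "finite (supp (cd_der r))"
proof (rule finite_subset)
  show "supp (cd_der r) \<subseteq> (\<Union>p \<in> supp r. (\<lambda>i. p[i := Suc (p ! i)]) ` {..<length p})"
  proof
    fix q assume "q \<in> supp (cd_der r)"
    then have "(\<Sum>p \<in> supp r. \<Sum>i < length p. r p * single (p[i := Suc (p ! i)]) q) \<noteq> 0"
      by (simp add: supp_def cd_der_def)
    then obtain p i where "p \<in> supp r" "i < length p" "single (p[i := Suc (p ! i)]) q \<noteq> (0 :: 'a)"
      by (metis (no_types, lifting) lessThan_iff mult_zero_right sum.neutral)
    then show "q \<in> (\<Union>p \<in> supp r. (\<lambda>i. p[i := Suc (p ! i)]) ` {..<length p})"
      by (auto simp: single_def split: if_splits)
  qed
qed (use assms in simp)

lemma compose_cd_D: "finite (supp r) \<Longrightarrow> compose ComDer cd_D [(n, r)] = cd_der r"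
  by (simp add: cd_D_def compose_single cd_mul_single_Nil finite_supp_cd_der)

lemma compose_cd_mu: "finite (supp s) \<Longrightarrow> compose ComDer cd_mu [(m, r), (n, s)] = cd_mul r s"
  by (simp add: cd_mu_def compose_single cd_mul_single_Nil)

lemma perm_act_single:
  assumes "\<sigma> permutes {..<length p}"
  shows "perm_act \<sigma> (single p) = single (permute_list \<sigma> p)"
proof
  fix q
  have inv: "inv \<sigma> permutes {..<length p}" using assms by (rule permutes_inv)
  have "permute_list (inv \<sigma>) q = p \<longleftrightarrow> q = permute_list \<sigma> p"
  proof
    assume p: "permute_list (inv \<sigma>) q = p"
    then have "length q = length p" by auto
    with assms inv p show "q = permute_list \<sigma> p"
      by (metis permute_list_compose permute_list_id permutes_inv_o(2))
  next
    assume "q = permute_list \<sigma> p"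
    with assms inv show "permute_list (inv \<sigma>) q = p"
      by (metis permute_list_compose permute_list_id permutes_inv_o(1))
  qed
  then show "perm_act \<sigma> (single p) q = single (permute_list \<sigma> p) q"
    by (simp add: perm_act_def single_def)
qed

lemma cd_mu_symmetric:
  assumes "\<sigma> permutes {..<2}"
  shows "act ComDer \<sigma> cd_mu = (cd_mu :: _ \<Rightarrow> 'k::field)"
proof
  fix q :: "nat list"
  have inv: "inv \<sigma> permutes {..<2}" using assms by (rule permutes_inv)
  have iff: "xs = [0, 0] \<longleftrightarrow> length xs = 2 \<and> set xs \<subseteq> {0}" for xs :: "nat list"
    by (auto simp: length_Suc_conv numeral_2_eq_2)
  have "permute_list (inv \<sigma>) q = [0, 0] \<longleftrightarrow> q = [0, 0]"
    using inv by (simp add: iff, cases "length q = 2", simp_all)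
  then show "act ComDer \<sigma> cd_mu q = (cd_mu q :: 'k)"
    by (simp add: ComDer_def perm_act_def cd_mu_def single_def)
qed

lemma cd_mu_associative:
  "compose ComDer cd_mu [(2, cd_mu), (1, ident ComDer)] =
   compose ComDer cd_mu [(1, ident ComDer), (2, cd_mu)]"
  by (simp add: cd_mu_def compose_single ident_ComDer cd_mul_single)

lemma cd_D_derivation:
  "compose ComDer cd_D [(2, cd_mu)] =
   compose ComDer cd_mu [(1, cd_D), (1, ident ComDer)] +
   compose ComDer cd_mu [(1, ident ComDer), (1, cd_D :: _ \<Rightarrow> 'k::field)]"
proof -
  have "finite (supp (cd_der (single [0, 0]) :: _ \<Rightarrow> 'k))"
    by (rule finite_subset[of _ "{[1, 0], [0, 1]}"])
       (auto simp: supp_def cd_der_single2, auto simp: single_def split: if_splits)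
  then show ?thesis
    by (simp add: cd_mu_def cd_D_def compose_single ident_ComDer cd_mul_single cd_mul_single_Nil)
       (simp add: cd_der_single2 plus_fun_def)
qed

lemma cd_D_power_eq: "cd_D_power a = single [a]"
  by (induction a)
     (simp_all add: ident_ComDer cd_D_def compose_single cd_der_single1 cd_mul_single)

lemma cd_mu_power_eq: "cd_mu_power m = single (replicate (Suc m) 0)"
  by (induction m)
     (simp_all add: ident_ComDer cd_mu_def compose_single cd_mul_single
       replicate_append_same)

lemma foldr_cd_mul_single:
  "foldr cd_mul (map (\<lambda>a. single [a]) p) (single []) = single p"
  by (induction p) (simp_all add: cd_mul_single)

lemma cd_monomial_eq:
  assumes "p \<noteq> []"
  shows "cd_monomial p = single p"
proof -
  have eq: "map2 (\<lambda>a s. (cd_der ^^ a) s) (replicate (length p) 0) (map (\<lambda>a. single [a]) p) =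
      map (\<lambda>a. single [a]) p"
    by (rule nth_equalityI) simp_all
  have "Suc (length p - 1) = length p"
    using assms by (cases p) simp_all
  then have "cd_monomial p = foldr cd_mul (map2 (\<lambda>a s. (cd_der ^^ a) s) (replicate (length p) 0)
      (map (\<lambda>a. single [a]) p)) (single [])"
    by (simp add: cd_monomial_def cd_mu_power_eq cd_D_power_eq compose_single comp_def
        del: replicate_Suc)
  then show ?thesis
    by (simp only: eq foldr_cd_mul_single)
qed


section \<open>The Hadamard product\<close>

text \<open>
  The elements of \<open>A(n)\<close> are finitely supported scalar functions on a set \<open>X\<close>. The pure tensor
  \<open>r \<otimes> f\<close> is the function \<open>x \<mapsto> r(x) f\<close>; this identifies \<open>A(n) \<otimes> B(n)\<close> with the span of these
  functions, an element \<open>F\<close> being \<open>\<Sum>x. single x \<otimes> F x\<close>. Action and composition are the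
  componentwise ones on pure tensors, extended linearly in each argument.
\<close>

definition tensor ::
    "('k \<Rightarrow> 'b \<Rightarrow> 'b) \<Rightarrow> ('x \<Rightarrow> 'k) \<Rightarrow> 'b \<Rightarrow> 'x \<Rightarrow> 'b" where
  "tensor scale r f = (\<lambda>x. scale (r x) f)"

definition Hadamard ::
    "('k::field, 'x \<Rightarrow> 'k) operad \<Rightarrow> ('k, 'b::ab_group_add) operad \<Rightarrow> ('k, 'x \<Rightarrow> 'b) operad" where
  "Hadamard A B = \<lparr>
     arity_space = (\<lambda>n. module.span (\<lambda>c F x. smult B c (F x))
       {tensor (smult B) r f | r f. r \<in> arity_space A n \<and> f \<in> arity_space B n}),
     smult = (\<lambda>c F x. smult B c (F x)),
     act = (\<lambda>\<sigma> F. \<Sum>x \<in> supp F. tensor (smult B) (act A \<sigma> (single x)) (act B \<sigma> (F x))),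
     ident = tensor (smult B) (ident A) (ident B),
     compose = (\<lambda>F Gs. \<Sum>x \<in> supp F. \<Sum>ys \<in> listset (map (supp \<circ> snd) Gs).
       tensor (smult B)
         (compose A (single x) (map2 (\<lambda>(m, G) y. (m, single y)) Gs ys))
         (compose B (F x) (map2 (\<lambda>(m, G) y. (m, G y)) Gs ys)))\<rparr>"


section \<open>The Novikov cochain complex\<close>

definition novOp :: "('k::field_char_0 \<Rightarrow> 'g::ab_group_add \<Rightarrow> 'g) \<Rightarrow>
    ('k, nat list \<Rightarrow> 'g list \<Rightarrow> 'g) operad" where
  "novOp scale = Hadamard rNov (EndOp scale)"

definition omega :: "('g \<Rightarrow> 'g \<Rightarrow> 'g::zero) \<Rightarrow> 'g list \<Rightarrow> 'g" where
  "omega nov xs = (if length xs = 2 then nov (xs ! 0) (xs ! 1) else 0)"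

definition alpha_nu :: "('k::field_char_0 \<Rightarrow> 'g::ab_group_add \<Rightarrow> 'g) \<Rightarrow> ('g \<Rightarrow> 'g \<Rightarrow> 'g) \<Rightarrow>
    nat list \<Rightarrow> 'g list \<Rightarrow> 'g" where
  "alpha_nu scale nov =
     tensor (smult (EndOp scale))
       (compose ComDer cd_mu [(1, cd_D), (1, ident ComDer)]) (omega nov) -
     tensor (smult (EndOp scale))
       (compose ComDer cd_mu [(1, ident ComDer), (1, cd_D)])
       (act (EndOp scale) (transpose 0 1) (omega nov))"

definition fam_scale :: "('k \<Rightarrow> 'g \<Rightarrow> 'g) \<Rightarrow> 'k \<Rightarrow> ('i \<Rightarrow> 'x \<Rightarrow> 'g) \<Rightarrow> 'i \<Rightarrow> 'x \<Rightarrow> 'g" where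
  "fam_scale scale c f = (\<lambda>p xs. scale c (f p xs))"

text \<open>The intermediate complex; a family over an index set is zero at all other indices.\<close>

definition C_fam :: "('k::field_char_0 \<Rightarrow> 'g::ab_group_add \<Rightarrow> 'g) \<Rightarrow> nat \<Rightarrow>
    (nat list \<Rightarrow> 'g list \<Rightarrow> 'g) set" where
  "C_fam scale n = {f.
     (\<forall>p. p \<notin> P_set n \<longrightarrow> f p = 0) \<and>
     (\<forall>p \<in> P_set n. f p \<in> arity_space (EndOp scale) n) \<and>
     (\<forall>p \<in> P_set n. \<forall>\<sigma>. \<sigma> permutes {..<n} \<longrightarrow>
        act (EndOp scale) \<sigma> (f p) =
        smult (EndOp scale) (of_int (sign \<sigma>)) (f (permute_list \<sigma> p)))}"

definition Psi :: "('k::field_char_0 \<Rightarrow> 'g::ab_group_add \<Rightarrow> 'g) \<Rightarrow> nat \<Rightarrow>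
    (nat list \<Rightarrow> 'g list \<Rightarrow> 'g) \<Rightarrow> nat list \<Rightarrow> 'g list \<Rightarrow> 'g" where
  "Psi scale n = the_inv_into (C_fam scale n)
     (\<lambda>f. \<Sum>p \<in> P_set n. tensor (smult (EndOp scale)) (cd_monomial p) (f p))"

definition delta :: "('k::field_char_0 \<Rightarrow> 'g::ab_group_add \<Rightarrow> 'g) \<Rightarrow> ('g \<Rightarrow> 'g \<Rightarrow> 'g) \<Rightarrow> nat \<Rightarrow>
    (nat list \<Rightarrow> 'g list \<Rightarrow> 'g) \<Rightarrow> nat list \<Rightarrow> 'g list \<Rightarrow> 'g" where
  "delta scale nov n = Psi scale (n + 1) \<circ> d_CE (novOp scale) (alpha_nu scale nov) n \<circ>
     the_inv_into (CE (novOp scale) n) (Psi scale n)"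

definition P_ord :: "nat \<Rightarrow> nat list set" where
  "P_ord n = {p \<in> P_set n. sorted_wrt (\<ge>) p}"

text \<open>The list \<open>k\<close> is \<open>(k\<^sub>n\<^sub>-\<^sub>1, \<dots>, k\<^sub>0)\<close>, hence \<open>k\<^sub>i\<close> is \<open>k ! (n - 1 - i)\<close>.\<close>

definition K_set :: "nat \<Rightarrow> nat list set" where
  "K_set n = {k. length k = n \<and> (\<Sum>i<n. k ! (n - 1 - i)) = n \<and>
     (\<Sum>i<n. i * k ! (n - 1 - i)) + 1 = n}"

definition phi :: "nat \<Rightarrow> nat list \<Rightarrow> nat list" where
  "phi n p = map (\<lambda>j. card {i. i < n \<and> p ! i = j}) (rev [0..<n])"

text \<open>
  For \<open>k = [a\<^sub>1, \<dots>, a\<^sub>m]\<close> the linear maps from the tensor product of the exterior powers of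
  exponents \<open>a\<^sub>1, \<dots>, a\<^sub>m\<close> are the multilinear maps in \<open>a\<^sub>1 + \<dots> + a\<^sub>m\<close> arguments, divided into
  consecutive blocks of these sizes, that vanish if two arguments in one block coincide.
\<close>

definition Hom_wedge :: "('k::field_char_0 \<Rightarrow> 'g::ab_group_add \<Rightarrow> 'g) \<Rightarrow> nat list \<Rightarrow>
    ('g list \<Rightarrow> 'g) set" where
  "Hom_wedge scale k = {f \<in> multilinear_maps scale (sum_list k).
     \<forall>xs b i j. length xs = sum_list k \<longrightarrow> b < length k \<longrightarrow>
       sum_list (take b k) \<le> i \<longrightarrow> i < j \<longrightarrow> j < sum_list (take (Suc b) k) \<longrightarrow>
       xs ! i = xs ! j \<longrightarrow> f xs = 0}"

definition C_Nov :: "('k::field_char_0 \<Rightarrow> 'g::ab_group_add \<Rightarrow> 'g) \<Rightarrow> nat \<Rightarrow>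
    (nat list \<Rightarrow> 'g list \<Rightarrow> 'g) set" where
  "C_Nov scale n = {c. (\<forall>k. k \<notin> K_set n \<longrightarrow> c k = 0) \<and> (\<forall>k \<in> K_set n. c k \<in> Hom_wedge scale k)}"

definition Phi :: "nat \<Rightarrow> (nat list \<Rightarrow> 'g list \<Rightarrow> 'g) \<Rightarrow> nat list \<Rightarrow> 'g list \<Rightarrow> 'g::zero" where
  "Phi n f = (\<lambda>k. if k \<in> K_set n then f (the_inv_into (P_ord n) (phi n) k) else 0)"

definition d_Nov :: "('k::field_char_0 \<Rightarrow> 'g::ab_group_add \<Rightarrow> 'g) \<Rightarrow> ('g \<Rightarrow> 'g \<Rightarrow> 'g) \<Rightarrow> nat \<Rightarrow>
    (nat list \<Rightarrow> 'g list \<Rightarrow> 'g) \<Rightarrow> nat list \<Rightarrow> 'g list \<Rightarrow> 'g" where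
  "d_Nov scale nov n =
     Phi (n + 1) \<circ> delta scale nov n \<circ> the_inv_into (C_fam scale n) (Phi n)"


section \<open>Cochain complexes in degrees at least one\<close>

definition linear_between :: "('k \<Rightarrow> 'a \<Rightarrow> 'a) \<Rightarrow> 'a::ab_group_add set \<Rightarrow> 'a set \<Rightarrow> ('a \<Rightarrow> 'a) \<Rightarrow> bool" where
  "linear_between scale V W f \<longleftrightarrow>
     f ` V \<subseteq> W \<and>
     (\<forall>u \<in> V. \<forall>v \<in> V. f (u + v) = f u + f v) \<and>
     (\<forall>c. \<forall>v \<in> V. f (scale c v) = scale c (f v))"

definition cochain_complex ::
    "('k::field \<Rightarrow> 'a::ab_group_add \<Rightarrow> 'a) \<Rightarrow> (nat \<Rightarrow> 'a set) \<Rightarrow> (nat \<Rightarrow> 'a \<Rightarrow> 'a) \<Rightarrow> bool" where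
  "cochain_complex scale C d \<longleftrightarrow>
     (\<forall>n \<ge> 1. module.subspace scale (C n)) \<and>
     (\<forall>n \<ge> 1. linear_between scale (C n) (C (n + 1)) (d n)) \<and>
     (\<forall>n \<ge> 1. \<forall>x \<in> C n. d (n + 1) (d n x) = 0)"

end

theory Submission
  imports Defs
begin

text \<open>
  Tensoring with the power series ring turns a Novikov algebra into a Lie ring: \<open>\<gg>[[t]]\<close> is again
  Novikov, \<open>d/dt\<close> is a derivation of it, and \<open>[X, Y] = X' \<diamondop> Y - Y' \<diamondop> X\<close> satisfies the Jacobi
  identity. A cochain \<open>F = \<Sum>\<^sub>p \<mu> \<circ> (D\<^sup>p\<^sup>1, \<dots>, D\<^sup>p\<^sup>n) \<otimes> f\<^sub>p\<close> acts on it as the multilinear map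
  \<open>(X\<^sub>1, \<dots>, X\<^sub>n) \<mapsto> \<Sum>\<^sub>p f\<^sub>p (X\<^sub>1\<^sup>(\<^sup>p\<^sup>1\<^sup>), \<dots>, X\<^sub>n\<^sup>(\<^sup>p\<^sup>n\<^sup>))\<close>, which commutes with \<open>d/dt\<close> and hence is
  determined by its constant term; that constant term determines \<open>F\<close>, as one sees on monomials.
  Under this faithful representation the operadic differential becomes the classical one with
  adjoint coefficients, whose square vanishes by Cartan's formula.
\<close>


section \<open>The Chevalley--Eilenberg differential of a Lie ring\<close>

text \<open>The constant term alone does not suffice for the comparison. One summand of
  \<open>\<nu>\<close> carries \<open>D\<close> on its second input, so after composing with F the
  constant term of [X, F(...)] involves the coefficient of F(...) at t. Each cochain is therefore
  extended to the series-valued map \<open>hat\<close> that commutes with \<open>shift\<close>. The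
  Lie ring differential preserves such maps because \<open>shift\<close> is a derivation of the
  bracket, and only this allows the comparison to be iterated. Additivity and homogeneity of the
  differential are read off through the same faithful evaluation, since operadic composition is
  given by sums over supports, which change with F. On the index side \<open>Psi\<close> is the
  identity in the chosen encoding, while \<open>Phi\<close> really discards components. As
  \<open>d_Nov\<close> contains its inverse, a whole family has to be rebuilt from its members at
  descending exponent lists. This works because alternation inside the blocks makes the choice of a
  sorting permutation immaterial. Characteristic 0 enters when a sign rule is turned into vanishing
  on repeated arguments.\<close>

definition slot_sum :: "('a \<Rightarrow> 'a) \<Rightarrow> ('a list \<Rightarrow> 'b::ab_group_add) \<Rightarrow> 'a list \<Rightarrow> 'b" where
  "slot_sum \<theta> c xs = (\<Sum>i<length xs. c (xs[i := \<theta> (xs ! i)]))"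

lemma slot_sum_Nil [simp]: "slot_sum \<theta> c [] = 0"
  by (simp add: slot_sum_def)

lemma slot_sum_Cons [simp]:
  "slot_sum \<theta> c (x # xs) = c (\<theta> x # xs) + slot_sum \<theta> (\<lambda>ys. c (x # ys)) xs"
  by (simp add: slot_sum_def sum.lessThan_Suc_shift del: sum.lessThan_Suc)

lemma slot_sum_add: "slot_sum \<theta> (\<lambda>ys. c ys + c' ys) xs = slot_sum \<theta> c xs + slot_sum \<theta> c' xs"
  by (simp add: slot_sum_def sum.distrib)

lemma slot_sum_diff: "slot_sum \<theta> (\<lambda>ys. c ys - c' ys) xs = slot_sum \<theta> c xs - slot_sum \<theta> c' xs"
  by (simp add: slot_sum_def sum_subtractf)

lemma slot_sum_uminus: "slot_sum \<theta> (\<lambda>ys. - c ys) xs = - slot_sum \<theta> c xs"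
  by (simp add: slot_sum_def sum_negf)

lemma additive_slot_sum:
  assumes "additive g"
  shows "g (slot_sum \<theta> c xs) = slot_sum \<theta> (\<lambda>ys. g (c ys)) xs"
  by (simp add: slot_sum_def additive.sum[OF assms])

text \<open>No arity is attached: a cochain is a function on lists of all lengths. Fixing its first
  argument thus yields an object of the same kind, and proofs can run by induction on the argument
  list.\<close>

definition multi_additive :: "('a::ab_group_add list \<Rightarrow> 'b::ab_group_add) \<Rightarrow> bool" where
  "multi_additive c \<longleftrightarrow>
     (\<forall>us x y vs. c (us @ (x + y) # vs) = c (us @ x # vs) + c (us @ y # vs))"

text \<open>Adjacent swaps are the form that survives induction on the prefix \<open>us\<close>;
  arbitrary permutations are recovered in \<open>skew_permute\<close>.\<close>

definition skew :: "('a list \<Rightarrow> 'b::ab_group_add) \<Rightarrow> bool" where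
  "skew c \<longleftrightarrow> (\<forall>us x y vs. c (us @ x # y # vs) = - c (us @ y # x # vs))"

lemma skewI: "(\<And>us x y vs. c (us @ x # y # vs) = - c (us @ y # x # vs)) \<Longrightarrow> skew c"
  unfolding skew_def by blast

lemma skewD: "skew c \<Longrightarrow> c (us @ x # y # vs) = - c (us @ y # x # vs)"
  unfolding skew_def by blast

lemma multi_additive_Cons: "multi_additive c \<Longrightarrow> multi_additive (\<lambda>ys. c (x # ys))"
  unfolding multi_additive_def by (metis append_Cons)

lemma multi_additive_hd: "multi_additive c \<Longrightarrow> c ((x + y) # vs) = c (x # vs) + c (y # vs)"
  unfolding multi_additive_def by (metis append_Nil)

lemma skew_Cons: "skew c \<Longrightarrow> skew (\<lambda>ys. c (x # ys))"
  unfolding skew_def by (metis append_Cons)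

lemma skew_hd: "skew c \<Longrightarrow> c (x # y # vs) = - c (y # x # vs)"
  unfolding skew_def by (metis append_Nil)

text \<open>Under a swap of neighbours the summand with \<theta> on x and the one with \<theta> on y
  trade places up to sign, and each other summand only changes its sign.\<close>

lemma skew_slot_sum:
  assumes "skew c"
  shows "skew (slot_sum \<theta> c)"
proof -
  have "slot_sum \<theta> c (us @ x # y # vs) = - slot_sum \<theta> c (us @ y # x # vs)"
    if "skew c" for us x y vs and c :: "'a list \<Rightarrow> 'b"
    using that
  proof (induction us arbitrary: c)
    case Nil
    have "slot_sum \<theta> (\<lambda>ys. c (x # y # ys)) vs = - slot_sum \<theta> (\<lambda>ys. c (y # x # ys)) vs"
      by (simp add: skew_hd[OF Nil, of x y] slot_sum_uminus)
    then show ?case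
      using skew_hd[OF Nil, of "\<theta> x" y vs] skew_hd[OF Nil, of x "\<theta> y" vs] by simp
  next
    case (Cons u us)
    from Cons.prems have "c (\<theta> u # us @ x # y # vs) = - c (\<theta> u # us @ y # x # vs)"
      unfolding skew_def by (metis append_Cons)
    with Cons.IH[OF skew_Cons[OF Cons.prems]] show ?case by simp
  qed
  with assms show ?thesis by (blast intro: skewI)
qed

lemma multi_additive_slot_sum:
  assumes "multi_additive c" "additive \<theta>"
  shows "multi_additive (slot_sum \<theta> c)"
proof -
  have "slot_sum \<theta> c (us @ (x + y) # vs) = slot_sum \<theta> c (us @ x # vs) + slot_sum \<theta> c (us @ y # vs)"
    if "multi_additive c" for us x y vs and c :: "'a list \<Rightarrow> 'b"
    using that
  proof (induction us arbitrary: c)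
    case Nil
    then show ?case
      by (simp add: additive.add[OF assms(2)] multi_additive_hd slot_sum_add)
  next
    case (Cons u us)
    from Cons.prems have "c (\<theta> u # us @ (x + y) # vs) = c (\<theta> u # us @ x # vs) + c (\<theta> u # us @ y # vs)"
      unfolding multi_additive_def by (metis append_Cons)
    with Cons.IH[OF multi_additive_Cons[OF Cons.prems]] show ?case by simp
  qed
  with assms show ?thesis by (simp add: multi_additive_def)
qed

text \<open>Terms where \<theta> and \<eta> hit different slots cancel. The minus sign arises
  because \<open>slot_sum\<close> acts by precomposition and so reverses the order of the two
  maps.\<close>

lemma slot_sum_commutator:
  assumes "multi_additive c" "additive \<theta>" "additive \<eta>"
  shows "slot_sum \<theta> (slot_sum \<eta> c) xs - slot_sum \<eta> (slot_sum \<theta> c) xs =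
    - slot_sum (\<lambda>x. \<theta> (\<eta> x) - \<eta> (\<theta> x)) c xs"
  using assms(1)
proof (induction xs arbitrary: c)
  case Nil
  then show ?case by simp
next
  case (Cons x xs)
  have "c ((\<theta> (\<eta> x) - \<eta> (\<theta> x)) # xs) + c (\<eta> (\<theta> x) # xs) = c (\<theta> (\<eta> x) # xs)"
    using multi_additive_hd[OF Cons.prems, of "\<theta> (\<eta> x) - \<eta> (\<theta> x)" "\<eta> (\<theta> x)" xs] by simp
  with Cons.IH[OF multi_additive_Cons[OF Cons.prems, of x]] show ?case
    by (simp add: slot_sum_add algebra_simps)
qed

section \<open>Lie derivatives and Cartan calculus\<close>

definition lie_der :: "('a::ab_group_add \<Rightarrow> 'a) \<Rightarrow> ('a list \<Rightarrow> 'a) \<Rightarrow> 'a list \<Rightarrow> 'a" where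
  "lie_der \<theta> c xs = \<theta> (c xs) - slot_sum \<theta> c xs"

lemma lie_der_Cons: "lie_der \<theta> c (x # xs) = lie_der \<theta> (\<lambda>ys. c (x # ys)) xs - c (\<theta> x # xs)"
  by (simp add: lie_der_def)

lemma lie_der_diff:
  "additive \<theta> \<Longrightarrow> lie_der \<theta> (\<lambda>ys. c ys - c' ys) xs = lie_der \<theta> c xs - lie_der \<theta> c' xs"
  by (simp add: lie_der_def slot_sum_diff additive.diff)

lemma lie_der_uminus:
  "additive \<theta> \<Longrightarrow> lie_der \<theta> (\<lambda>ys. - c ys) xs = - lie_der \<theta> c xs"
  by (simp add: lie_der_def slot_sum_uminus additive.minus)

text \<open>The Lie derivative is a representation of additive endomorphisms: the mixed terms
  cancel, and the sign in \<open>slot_sum_commutator\<close> is absorbed by the minus in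
  \<open>lie_der\<close>.\<close>

lemma lie_der_commutator:
  assumes "multi_additive c" "additive \<theta>" "additive \<eta>"
  shows "lie_der \<theta> (lie_der \<eta> c) xs - lie_der \<eta> (lie_der \<theta> c) xs =
    lie_der (\<lambda>x. \<theta> (\<eta> x) - \<eta> (\<theta> x)) c xs"
proof -
  have eq: "lie_der \<theta> (lie_der \<eta> c) xs = \<theta> (\<eta> (c xs)) - slot_sum \<eta> (\<lambda>ys. \<theta> (c ys)) xs
      - slot_sum \<theta> (\<lambda>ys. \<eta> (c ys)) xs + slot_sum \<theta> (slot_sum \<eta> c) xs"
    if "additive \<theta>" for \<theta> \<eta> :: "'a \<Rightarrow> 'a"
    using that
    by (simp add: lie_der_def[abs_def] slot_sum_diff additive.diff additive_slot_sum)
  show ?thesis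
    using slot_sum_commutator[OF assms, of xs] assms
    by (simp add: eq lie_der_def[of "\<lambda>x. \<theta> (\<eta> x) - \<eta> (\<theta> x)"] algebra_simps)
qed

text \<open>The Jacobi identity is written as the statement that \<open>br x\<close> is a derivation
  of the bracket, the form in which \<open>lie_der_lie_d\<close> uses it. Scalars are kept out;
  compatibility with them is shown in \<open>lie_d_ser_scale\<close>.\<close>

locale lie_ring =
  fixes br :: "'a::ab_group_add \<Rightarrow> 'a \<Rightarrow> 'a"
  assumes br_add_left: "br (x + y) z = br x z + br y z"
    and br_add_right: "br x (y + z) = br x y + br x z"
    and br_skew: "br x y = - br y x"
    and jacobi: "br x (br y z) = br (br x y) z + br y (br x z)"
begin

lemma additive_br: "additive (br x)"
  by standard (rule br_add_right)

text \<open>The recursion is Cartan's formula for the contraction by the first argument.\<close>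

fun lie_d :: "('a list \<Rightarrow> 'a) \<Rightarrow> 'a list \<Rightarrow> 'a" where
  "lie_d c [] = 0"
| "lie_d c (x # xs) = lie_der (br x) c xs - lie_d (\<lambda>ys. c (x # ys)) xs"

lemma lie_d_diff: "lie_d (\<lambda>ys. c ys - c' ys) xs = lie_d c xs - lie_d c' xs"
  by (induction xs arbitrary: c c') (simp_all add: lie_der_diff additive_br)

lemma lie_d_uminus: "lie_d (\<lambda>ys. - c ys) xs = - lie_d c xs"
  by (induction xs arbitrary: c) (simp_all add: lie_der_uminus additive_br)

lemma lie_d_zero: "lie_d (\<lambda>ys. 0) xs = 0"
  using lie_d_diff[of "\<lambda>_. 0" "\<lambda>_. 0" xs] by simp

text \<open>Contraction by x and the Lie derivative along \<theta> commute up to contraction by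
  \<theta> x (\<open>lie_der_Cons\<close>). Unfolding the recursion of \<open>lie_d\<close> at x,
  this correction is matched by the commutator of the Lie derivatives along \<theta> and
  \<open>br x\<close>; the rest is the induction hypothesis for the contracted cochain.\<close>

lemma lie_der_lie_d:
  assumes "multi_additive c" "additive \<theta>" "\<And>x y. \<theta> (br x y) = br (\<theta> x) y + br x (\<theta> y)"
  shows "lie_der \<theta> (lie_d c) xs = lie_d (lie_der \<theta> c) xs"
  using assms(1)
proof (induction xs arbitrary: c)
  case Nil
  then show ?case by (simp add: lie_der_def additive.zero[OF assms(2)])
next
  case (Cons x xs)
  \<comment> \<open>The derivation property says that the commutator of \<theta> with
    \<open>br x\<close> is \<open>br (\<theta> x)\<close>.\<close>
  have eq: "(\<lambda>z. \<theta> (br x z) - br x (\<theta> z)) = br (\<theta> x)"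
    by (simp add: assms(3))
  have "lie_der \<theta> (lie_d c) (x # xs) =
      lie_der \<theta> (lie_der (br x) c) xs - lie_der \<theta> (lie_d (\<lambda>ys. c (x # ys))) xs
      - lie_d c (\<theta> x # xs)"
    by (simp add: lie_der_Cons lie_der_diff assms(2))
  also have "\<dots> = lie_der (br x) (lie_der \<theta> c) xs
      - (lie_d (lie_der \<theta> (\<lambda>ys. c (x # ys))) xs - lie_d (\<lambda>ys. c (\<theta> x # ys)) xs)"
    using lie_der_commutator[OF Cons.prems assms(2) additive_br, of x xs]
      Cons.IH[OF multi_additive_Cons[OF Cons.prems], of x]
    by (simp add: eq algebra_simps)
  also have "\<dots> = lie_d (lie_der \<theta> c) (x # xs)"
    by (simp add: lie_der_Cons lie_d_diff)
  finally show ?case .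
qed

text \<open>Write i for contraction by x and L for the Lie derivative along \<open>br x\<close>.
  Then i d d = L d - d i d = d L - d (L - d i) = d d i, which vanishes by induction. The middle
  equality is \<open>lie_der_lie_d\<close> for the derivation \<open>br x\<close>.\<close>

lemma lie_d_lie_d:
  assumes "multi_additive c"
  shows "lie_d (lie_d c) xs = 0"
  using assms
proof (induction xs arbitrary: c)
  case Nil
  then show ?case by simp
next
  case (Cons x xs)
  have "br x (br y z) = br (br x y) z + br y (br x z)" for y z
    by (rule jacobi)
  then have "lie_der (br x) (lie_d c) xs = lie_d (lie_der (br x) c) xs"
    using lie_der_lie_d[OF Cons.prems additive_br[of x]] by blast
  with Cons.IH[OF multi_additive_Cons[OF Cons.prems], of x] show ?case
    by (simp add: lie_d_diff)
qed

lemma skew_lie_der: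
  assumes "skew c" "additive \<theta>"
  shows "skew (lie_der \<theta> c)"
proof (rule skewI)
  fix us x y vs
  have "c (us @ x # y # vs) = - c (us @ y # x # vs)"
    using assms(1) by (rule skewD)
  moreover have "slot_sum \<theta> c (us @ x # y # vs) = - slot_sum \<theta> c (us @ y # x # vs)"
    using skew_slot_sum[OF assms(1)] by (rule skewD)
  ultimately show "lie_der \<theta> c (us @ x # y # vs) = - lie_der \<theta> c (us @ y # x # vs)"
    by (simp add: lie_der_def additive.minus[OF assms(2)])
qed

text \<open>Unfolding the recursion twice at x, y gives a difference of two Lie derivatives that are
  exchanged by the swap, the term with \<open>br x y\<close> in front, and the differential of c
  contracted by x and y. Each part is antisymmetric; a longer prefix is handled by
  contraction.\<close>

lemma skew_lie_d:
  assumes "skew c" "multi_additive c"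
  shows "skew (lie_d c)"
proof -
  have "lie_d c (us @ x # y # vs) = - lie_d c (us @ y # x # vs)"
    if "skew c" "multi_additive c" for us x y vs and c
    using that
  proof (induction us arbitrary: c)
    case Nil
    have "lie_d (\<lambda>ys. c (x # y # ys)) vs = - lie_d (\<lambda>ys. c (y # x # ys)) vs"
      by (simp add: skew_hd[OF Nil(1), of x y] lie_d_uminus)
    \<comment> \<open>Skewness of the bracket reaches the value of c through additivity in the first
      slot, which also makes c vanish at 0.\<close>
    moreover have "c (br x y # vs) + c (br y x # vs) = c (0 # vs)"
      using multi_additive_hd[OF Nil(2), of "br x y" "br y x" vs] br_skew[of x y] by simp
    moreover have "c (0 # vs) = 0"
      using multi_additive_hd[OF Nil(2), of 0 0 vs] by simp
    ultimately show ?case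
      by (simp add: lie_der_Cons algebra_simps add_eq_0_iff2)
  next
    case (Cons u us)
    have "lie_der (br u) c (us @ x # y # vs) = - lie_der (br u) c (us @ y # x # vs)"
      using skew_lie_der[OF Cons.prems(1) additive_br] by (rule skewD)
    with Cons.IH[OF skew_Cons multi_additive_Cons, OF Cons.prems] show ?case by simp
  qed
  with assms show ?thesis by (blast intro: skewI)
qed

end


section \<open>The Lie ring of power series over a Novikov algebra\<close>

definition shift :: "(nat \<Rightarrow> 'g) \<Rightarrow> nat \<Rightarrow> 'g" where
  "shift X = (\<lambda>m. X (Suc m))"

lemma shift_apply: "shift X m = X (Suc m)"
  by (simp add: shift_def)

lemma shift_add: "shift (X + Y) = shift X + shift Y"
  by (simp add: fun_eq_iff shift_apply)

lemma additive_shift: "additive (shift :: (nat \<Rightarrow> 'g::ab_group_add) \<Rightarrow> _)"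
  by standard (rule shift_add)

context novikov_algebra
begin

lemma linear_self_iff: "Vector_Spaces.linear scale scale f \<longleftrightarrow>
    (\<forall>x y. f (x + y) = f x + f y) \<and> (\<forall>c x. f (scale c x) = scale c (f x))"
  by (simp add: Vector_Spaces.linear_def module_hom_iff vector_space_axioms module_axioms)

lemma nov_add_left: "(x + y) \<diamondop> z = x \<diamondop> z + y \<diamondop> z"
  using linear_left by (auto simp: linear_self_iff)

lemma nov_add_right: "x \<diamondop> (y + z) = x \<diamondop> y + x \<diamondop> z"
  using linear_right by (auto simp: linear_self_iff)

lemma nov_scale_left: "scale c x \<diamondop> z = scale c (x \<diamondop> z)"
  using linear_left by (auto simp: linear_self_iff)

lemma nov_scale_right: "x \<diamondop> scale c z = scale c (x \<diamondop> z)"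
  using linear_right by (auto simp: linear_self_iff)

text \<open>
  The sequence \<open>X\<close> stands for the power series \<open>\<Sum>\<^sub>i X\<^sub>i t\<^sup>i / i!\<close>, so \<open>shift\<close> is \<open>d/dt\<close> and the
  product is determined by its constant term and the Leibniz rule.
\<close>

fun hurwitz :: "(nat \<Rightarrow> 'g) \<Rightarrow> (nat \<Rightarrow> 'g) \<Rightarrow> nat \<Rightarrow> 'g" where
  "hurwitz X Y 0 = X 0 \<diamondop> Y 0"
| "hurwitz X Y (Suc m) = hurwitz (shift X) Y m + hurwitz X (shift Y) m"

lemma shift_hurwitz: "shift (hurwitz X Y) = hurwitz (shift X) Y + hurwitz X (shift Y)"
  by (simp add: fun_eq_iff shift_apply)

lemma hurwitz_add_left: "hurwitz (X + Y) Z = hurwitz X Z + hurwitz Y Z"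
proof
  fix m show "hurwitz (X + Y) Z m = (hurwitz X Z + hurwitz Y Z) m"
    by (induction m arbitrary: X Y Z) (simp_all add: nov_add_left shift_add)
qed

lemma hurwitz_add_right: "hurwitz X (Y + Z) = hurwitz X Y + hurwitz X Z"
proof
  fix m show "hurwitz X (Y + Z) m = (hurwitz X Y + hurwitz X Z) m"
    by (induction m arbitrary: X Y Z) (simp_all add: nov_add_right shift_add)
qed

lemma hurwitz_diff_left: "hurwitz (X - Y) Z = hurwitz X Z - hurwitz Y Z"
  by (metis add_diff_cancel diff_add_cancel hurwitz_add_left)

lemma hurwitz_diff_right: "hurwitz X (Y - Z) = hurwitz X Y - hurwitz X Z"
  by (metis add_diff_cancel diff_add_cancel hurwitz_add_right)

definition ser_scale :: "'k \<Rightarrow> (nat \<Rightarrow> 'g) \<Rightarrow> nat \<Rightarrow> 'g" where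
  "ser_scale a X = (\<lambda>m. scale a (X m))"

lemma shift_ser_scale: "shift (ser_scale a X) = ser_scale a (shift X)"
  by (simp add: fun_eq_iff ser_scale_def shift_apply)

lemma hurwitz_scale_left: "hurwitz (ser_scale a X) Y = ser_scale a (hurwitz X Y)"
proof
  fix m show "hurwitz (ser_scale a X) Y m = ser_scale a (hurwitz X Y) m"
    by (induction m arbitrary: X Y)
      (simp_all add: nov_scale_left shift_ser_scale, simp_all add: ser_scale_def nov_scale_left scale_right_distrib)
qed

lemma hurwitz_scale_right: "hurwitz X (ser_scale a Y) = ser_scale a (hurwitz X Y)"
proof
  fix m show "hurwitz X (ser_scale a Y) m = ser_scale a (hurwitz X Y) m"
    by (induction m arbitrary: X Y)
      (simp_all add: nov_scale_right shift_ser_scale, simp_all add: ser_scale_def nov_scale_right scale_right_distrib)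
qed

text \<open>Both sides obey the Leibniz rule for \<open>shift\<close> in all three arguments, so
  coefficient m + 1 is a sum of coefficients m at once-shifted arguments. Any multilinear identity
  thus spreads from the constant terms, where it holds in the given algebra.\<close>

lemma hurwitz_right_commutative: "hurwitz (hurwitz X Y) Z = hurwitz (hurwitz X Z) Y"
proof
  fix m show "hurwitz (hurwitz X Y) Z m = hurwitz (hurwitz X Z) Y m"
    by (induction m arbitrary: X Y Z)
      (simp_all add: right_commutative shift_hurwitz hurwitz_add_left add_ac)
qed

lemma hurwitz_left_symmetric:
  "hurwitz (hurwitz X Y) Z - hurwitz X (hurwitz Y Z) =
   hurwitz (hurwitz Y X) Z - hurwitz Y (hurwitz X Z)"
proof
  fix m
  show "(hurwitz (hurwitz X Y) Z - hurwitz X (hurwitz Y Z)) m =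
    (hurwitz (hurwitz Y X) Z - hurwitz Y (hurwitz X Z)) m"
  proof (induction m arbitrary: X Y Z)
    case 0
    then show ?case by (simp add: left_symmetric)
  next
    case (Suc m)
    \<comment> \<open>The three induction hypotheses, with one of X, Y, Z shifted in each, are added
      up.\<close>
    show ?case
      using arg_cong2[where f = "(+)", OF Suc[of "shift X" Y Z]
          arg_cong2[where f = "(+)", OF Suc[of X "shift Y" Z] Suc[of X Y "shift Z"]]]
      by (simp add: shift_hurwitz hurwitz_add_left hurwitz_add_right)
        (simp add: algebra_simps)
  qed
qed

text \<open>The Balinskii-Novikov bracket; its coefficients are the values of \<open>\<nu>\<close>
  and of its derivatives, see \<open>sum_alpha_nu_coeffs_at\<close>.\<close>

definition nov_br :: "(nat \<Rightarrow> 'g) \<Rightarrow> (nat \<Rightarrow> 'g) \<Rightarrow> nat \<Rightarrow> 'g" where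
  "nov_br X Y = hurwitz (shift X) Y - hurwitz (shift Y) X"

lemma shift_diff: "shift (X - Y) = shift X - shift (Y :: nat \<Rightarrow> 'g)"
  by (simp add: fun_eq_iff shift_apply)

text \<open>This is the hypothesis of \<open>lie_der_lie_d\<close> for \<theta> =
  \<open>shift\<close>; through it the differential preserves maps that commute with d/dt.\<close>

lemma shift_nov_br: "shift (nov_br X Y) = nov_br (shift X) Y + nov_br X (shift Y)"
  by (simp add: nov_br_def shift_diff shift_hurwitz algebra_simps)

text \<open>After expansion every term contains either one second derivative or two first
  derivatives. The former cancel in pairs by right commutativity, the latter by three instances of
  \<open>ls\<close>.\<close>

lemma nov_br_jacobi: "nov_br X (nov_br Y Z) = nov_br (nov_br X Y) Z + nov_br Y (nov_br X Z)"
proof -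
  \<comment> \<open>Left symmetry in which (A B) C and (B A) C are rewritten as (A C) B and (B C) A:
    the expression A (B C) + (B C) A is symmetric in A and B.\<close>
  have ls: "hurwitz A (hurwitz B C) + hurwitz (hurwitz B C) A =
      hurwitz B (hurwitz A C) + hurwitz (hurwitz A C) B" for A B C
    using hurwitz_left_symmetric[of A B C]
    by (simp add: hurwitz_right_commutative[of A B C] hurwitz_right_commutative[of B A C] algebra_simps)
  have "hurwitz (shift X) (hurwitz (shift Y) Z) + hurwitz (hurwitz (shift Y) Z) (shift X)
      + (hurwitz (shift Z) (hurwitz (shift X) Y) + hurwitz (hurwitz (shift X) Y) (shift Z))
      + (hurwitz (shift Y) (hurwitz (shift Z) X) + hurwitz (hurwitz (shift Z) X) (shift Y)) =
      hurwitz (shift Y) (hurwitz (shift X) Z) + hurwitz (hurwitz (shift X) Z) (shift Y)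
      + (hurwitz (shift X) (hurwitz (shift Z) Y) + hurwitz (hurwitz (shift Z) Y) (shift X))
      + (hurwitz (shift Z) (hurwitz (shift Y) X) + hurwitz (hurwitz (shift Y) X) (shift Z))"
    by (simp only: ls[of "shift X" "shift Y" Z] ls[of "shift Z" "shift X" Y]
      ls[of "shift Y" "shift Z" X])
  then show ?thesis
    by (simp add: nov_br_def shift_diff shift_hurwitz hurwitz_diff_left hurwitz_diff_right
        hurwitz_add_left hurwitz_add_right hurwitz_right_commutative[of "shift (shift X)" Y Z]
        hurwitz_right_commutative[of "shift (shift Y)" X Z]
        hurwitz_right_commutative[of "shift (shift Z)" X Y]
        hurwitz_right_commutative[of "shift X" "shift Y" Z]
        hurwitz_right_commutative[of "shift X" "shift Z" Y]
        hurwitz_right_commutative[of "shift Y" "shift Z" X]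
        hurwitz_right_commutative[of "shift Y" "shift X" Z]
        hurwitz_right_commutative[of "shift Z" "shift X" Y]
        hurwitz_right_commutative[of "shift Z" "shift Y" X])
      (simp add: algebra_simps)
qed

sublocale lie_ring nov_br
proof
  show "nov_br X (nov_br Y Z) = nov_br (nov_br X Y) Z + nov_br Y (nov_br X Z)" for X Y Z
    by (rule nov_br_jacobi)
qed (simp_all add: nov_br_def shift_add hurwitz_add_left hurwitz_add_right)

end


section \<open>Shuffles\<close>

text \<open>The sign (-1)^i in a group without scalars, since \<open>lie_ring\<close> provides
  none.\<close>

definition alt :: "nat \<Rightarrow> 'b::ab_group_add \<Rightarrow> 'b" where
  "alt i v = (if even i then v else - v)"

lemma alt_0 [simp]: "alt 0 v = v"
  by (simp add: alt_def)

lemma alt_Suc [simp]: "alt (Suc i) v = - alt i v"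
  by (simp add: alt_def)

lemma alt_minus: "alt i (- v) = - alt i v"
  by (simp add: alt_def)

definition remove_nth :: "nat \<Rightarrow> 'a list \<Rightarrow> 'a list" where
  "remove_nth i xs = take i xs @ drop (Suc i) xs"

lemma remove_nth_0 [simp]: "remove_nth 0 (x # xs) = xs"
  by (simp add: remove_nth_def)

lemma remove_nth_Suc [simp]: "remove_nth (Suc i) (x # xs) = x # remove_nth i xs"
  by (simp add: remove_nth_def)

lemma length_remove_nth: "i < length xs \<Longrightarrow> length (remove_nth i xs) = length xs - 1"
  by (simp add: remove_nth_def)

lemma nth_remove_nth:
  "k < length xs - 1 \<Longrightarrow> i < length xs \<Longrightarrow>
    remove_nth i xs ! k = (if k < i then xs ! k else xs ! Suc k)"
  by (auto simp: remove_nth_def nth_append)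

lemma skew_move_to_front:
  assumes "skew c"
  shows "c (us @ z # vs) = alt (length us) (c (z # us @ vs))"
  using assms
proof (induction us arbitrary: c)
  case (Cons u us)
  show ?case
    using Cons.IH[OF skew_Cons[OF Cons.prems], of u] skew_hd[OF Cons.prems, of u z "us @ vs"]
    by (simp add: alt_minus)
qed simp

lemma skew_list_update:
  assumes "skew c" "j < length xs"
  shows "c (xs[j := z]) = alt j (c (z # remove_nth j xs))"
  using skew_move_to_front[OF assms(1), of "take j xs" z "drop (Suc j) xs"] assms(2)
  by (simp add: remove_nth_def upd_conv_take_nth_drop)

text \<open>The explicit Chevalley-Eilenberg formula, needed because the operadic differential is a
  sum over shuffles. In the recursion the leading term of \<open>lie_der\<close> gives i = 0 in the
  first sum, and its \<open>slot_sum\<close> gives the pairs with i = 0 once the bracket has been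
  moved to the front. The other terms come from the contracted cochain, where the bracket still has
  to pass x.\<close>

lemma (in lie_ring) lie_d_expand:
  assumes "skew c"
  shows "lie_d c xs =
    (\<Sum>i<length xs. alt i (br (xs ! i) (c (remove_nth i xs)))) -
    (\<Sum>j<length xs. \<Sum>i<j. alt (Suc (i + j)) (c (br (xs ! i) (xs ! j) # remove_nth i (remove_nth j xs))))"
  using assms
proof (induction xs arbitrary: c)
  case Nil
  then show ?case by simp
next
  case (Cons x xs)
  have 1: "slot_sum (br x) c xs = (\<Sum>j<length xs. alt j (c (br x (xs ! j) # remove_nth j xs)))"
    unfolding slot_sum_def by (rule sum.cong) (simp_all add: skew_list_update[OF Cons.prems])
  have 2: "c (x # y # ys) = - c (y # x # ys)" for y ys
    by (rule skew_hd[OF Cons.prems])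
  show ?case
    using Cons.IH[OF skew_Cons[OF Cons.prems], of x]
    by (simp add: lie_der_def 1 2 sum.lessThan_Suc_shift sum.distrib sum_negf sum_subtractf alt_minus
      del: sum.lessThan_Suc)
qed

text \<open>Permuting a list by this cycle brings entry i to the front. It is the inverse of a
  shuffle: both \<open>Sh_inv\<close> and the action involve only \<open>inv \<sigma>\<close>, so
  the sums over shuffles are parametrised by these inverses.\<close>

definition front_cycle :: "nat \<Rightarrow> nat \<Rightarrow> nat" where
  "front_cycle i = (\<lambda>k. if k = 0 then i else if k \<le> i then k - 1 else k)"

lemma front_cycle_Suc: "front_cycle (Suc i) = transpose i (Suc i) \<circ> front_cycle i"
  by (auto simp: front_cycle_def fun_eq_iff transpose_def)

lemma front_cycle_0 [simp]: "front_cycle 0 = id"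
  by (auto simp: front_cycle_def fun_eq_iff)

lemma front_cycle_first: "front_cycle i 0 = i"
  by (simp add: front_cycle_def)

lemma front_cycle_permutes: "i < n \<Longrightarrow> front_cycle i permutes {..<n}"
  by (induction i) (auto simp: front_cycle_Suc permutes_id intro!: permutes_compose permutes_swap_id)

lemma sign_front_cycle: "sign (front_cycle i) = (-1) ^ i"
proof (induction i)
  case (Suc i)
  have "permutation (front_cycle i)"
    using front_cycle_permutes[of i "Suc i"] by (auto simp: permutation_permutes)
  with Suc show ?case
    by (simp only: front_cycle_Suc sign_compose permutation_swap_id sign_swap_id) simp
qed simp

lemma permute_list_front_cycle:
  assumes "i < length xs"
  shows "permute_list (front_cycle i) xs = xs ! i # remove_nth i xs"
proof (rule nth_equalityI)
  show "length (permute_list (front_cycle i) xs) = length (xs ! i # remove_nth i xs)"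
    using assms by (simp add: length_remove_nth)
next
  fix k assume "k < length (permute_list (front_cycle i) xs)"
  then show "permute_list (front_cycle i) xs ! k = (xs ! i # remove_nth i xs) ! k"
    using assms
    by (cases k) (auto simp: permute_list_nth[OF front_cycle_permutes] nth_remove_nth,
      auto simp: front_cycle_def)
qed

text \<open>Entry j goes to the front first; this pushes the earlier entry i to position i + 1,
  hence \<open>Suc i\<close> in the second cycle.\<close>

lemma permute_list_front_cycle2:
  assumes "i < j" "j < length xs"
  shows "permute_list (front_cycle j \<circ> front_cycle (Suc i)) xs =
    xs ! i # xs ! j # remove_nth i (remove_nth j xs)"
  using assms
  by (subst permute_list_compose)
    (simp_all add: front_cycle_permutes permute_list_front_cycle length_remove_nth nth_remove_nth)

text \<open>The values on the last n - r places form the complement of the first r values, and a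
  finite set has only one increasing enumeration.\<close>

lemma permutes_eqI_strict_mono:
  fixes \<tau> \<tau>' :: "nat \<Rightarrow> nat"
  assumes "\<tau> permutes {..<n}" "\<tau>' permutes {..<n}" "r \<le> n"
    "\<And>k. k < r \<Longrightarrow> \<tau> k = \<tau>' k" "strict_mono_on {r..<n} \<tau>" "strict_mono_on {r..<n} \<tau>'"
  shows "\<tau> = \<tau>'"
proof -
  have image: "\<tau> ` {r..<n} = {..<n} - \<tau> ` {..<r}" if "\<tau> permutes {..<n}" for \<tau>
  proof -
    have "{r..<n} = {..<n} - {..<r}" by auto
    then have "\<tau> ` {r..<n} = \<tau> ` {..<n} - \<tau> ` {..<r}"
      by (simp only: image_set_diff[OF permutes_inj[OF that]])
    then show ?thesis
      by (simp only: permutes_image[OF that])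
  qed
  have "\<tau> ` {..<r} = \<tau>' ` {..<r}"
    using assms(4) by (intro image_cong) auto
  then have "set (map \<tau> [r..<n]) = set (map \<tau>' [r..<n])"
    using image[OF assms(1)] image[OF assms(2)] by simp
  moreover have "sorted (map \<tau> [r..<n])" "distinct (map \<tau> [r..<n])" if "strict_mono_on {r..<n} \<tau>" for \<tau> :: "nat \<Rightarrow> nat"
  proof -
    have "\<tau> i \<le> \<tau> j" if "r \<le> i" "i < j" "j < n" for i j
      using \<open>strict_mono_on {r..<n} \<tau>\<close> that by (auto simp: strict_mono_on_def intro: less_imp_le)
    then show "sorted (map \<tau> [r..<n])"
      by (auto simp: sorted_wrt_iff_nth_less)
    show "distinct (map \<tau> [r..<n])"
      using strict_mono_on_imp_inj_on[OF that] by (simp add: distinct_map)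
  qed
  ultimately have "map \<tau> [r..<n] = map \<tau>' [r..<n]"
    using assms(5,6) by (intro sorted_distinct_set_unique) auto
  then have eq: "\<tau> k = \<tau>' k" if "r \<le> k" "k < n" for k
    using that by (auto simp: map_eq_conv)
  show ?thesis
  proof
    fix k show "\<tau> k = \<tau>' k"
      using eq[of k] assms(4)[of k] permutes_not_in[OF assms(1), of k] permutes_not_in[OF assms(2), of k]
      by (cases "k < r"; cases "k < n") auto
  qed
qed

lemma strict_mono_on_front_cycle: "strict_mono_on {1..<n} (front_cycle i)"
  by (auto simp: strict_mono_on_def front_cycle_def)

lemma Sh_inv_1: "Sh_inv 1 n = (\<lambda>i. inv (front_cycle i)) ` {..<Suc n}"
proof (intro equalityI subsetI)
  fix \<sigma> assume "\<sigma> \<in> Sh_inv 1 n"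
  then have \<sigma>: "\<sigma> permutes {..<Suc n}" "strict_mono_on {1..<Suc n} (inv \<sigma>)"
    by (auto simp: Sh_inv_def)
  have inv: "inv \<sigma> permutes {..<Suc n}" using \<sigma>(1) by (rule permutes_inv)
  have i: "inv \<sigma> 0 < Suc n" using permutes_in_image[OF inv, of 0] by simp
  have "inv \<sigma> = front_cycle (inv \<sigma> 0)"
    by (rule permutes_eqI_strict_mono[OF inv front_cycle_permutes[OF i], of 1])
      (use \<sigma>(2) in \<open>auto simp: front_cycle_first strict_mono_on_front_cycle[simplified]\<close>)
  then have "\<sigma> = inv (front_cycle (inv \<sigma> 0))"
    by (metis permutes_inv_inv \<sigma>(1))
  with i show "\<sigma> \<in> (\<lambda>i. inv (front_cycle i)) ` {..<Suc n}" by blast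
next
  fix \<sigma> assume "\<sigma> \<in> (\<lambda>i. inv (front_cycle i)) ` {..<Suc n}"
  then obtain i where "i < Suc n" "\<sigma> = inv (front_cycle i)" by blast
  then show "\<sigma> \<in> Sh_inv 1 n"
    using front_cycle_permutes[of i "Suc n"] strict_mono_on_front_cycle[of "Suc n" i]
    by (auto simp: Sh_inv_def permutes_inv permutes_inv_inv strict_mono_on_def)
qed

text \<open>Stated for an arbitrary function G of the sign and the inverse, because a summand of
  \<open>d_CE\<close> depends on the shuffle only through these two after evaluation.\<close>

lemma sum_Sh_inv_1:
  "(\<Sum>\<sigma>\<in>Sh_inv 1 n. G (sign \<sigma>) (inv \<sigma>)) = (\<Sum>i<Suc n. G ((-1) ^ i) (front_cycle i))"
proof -
  have perm: "front_cycle i permutes {..<Suc i}" for i by (rule front_cycle_permutes) simp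
  have inv_inv: "inv (inv (front_cycle i)) = front_cycle i" for i
    by (rule permutes_inv_inv[OF perm])
  have sign: "sign (inv (front_cycle i)) = (-1) ^ i" for i
    using perm[of i] by (subst sign_inverse) (auto simp: sign_front_cycle permutation_permutes)
  have "inj_on (\<lambda>i. inv (front_cycle i)) {..<Suc n}"
    by (intro inj_onI) (metis inv_inv front_cycle_first)
  then show ?thesis
    by (simp only: Sh_inv_1 sum.reindex comp_def inv_inv sign)
qed

definition front_cycle2 :: "nat \<times> nat \<Rightarrow> nat \<Rightarrow> nat" where
  "front_cycle2 = (\<lambda>(j, i). front_cycle j \<circ> front_cycle (Suc i))"

lemma front_cycle2_permutes: "i < j \<Longrightarrow> j < n \<Longrightarrow> front_cycle2 (j, i) permutes {..<n}"
  by (simp add: front_cycle2_def front_cycle_permutes permutes_compose)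

lemma front_cycle2_0: "i < j \<Longrightarrow> front_cycle2 (j, i) 0 = i"
  and front_cycle2_1: "front_cycle2 (j, i) (Suc 0) = j"
  by (auto simp: front_cycle2_def front_cycle_def)

lemma strict_mono_on_front_cycle2: "strict_mono_on {2..<n} (front_cycle2 (j, i))"
  by (auto simp: strict_mono_on_def front_cycle_def front_cycle2_def)

lemma Sh_inv_2: "Sh_inv 2 m = (\<lambda>p. inv (front_cycle2 p)) ` (SIGMA j:{..<m + 2}. {..<j})"
proof (intro equalityI subsetI)
  fix \<sigma> assume "\<sigma> \<in> Sh_inv 2 m"
  then have \<sigma>: "\<sigma> permutes {..<m + 2}" "strict_mono_on {2..<m + 2} (inv \<sigma>)"
      "strict_mono_on {..<2} (inv \<sigma>)"
    by (auto simp: Sh_inv_def add.commute)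
  have inv: "inv \<sigma> permutes {..<m + 2}" using \<sigma>(1) by (rule permutes_inv)
  have ij: "inv \<sigma> 0 < inv \<sigma> 1" using \<sigma>(3) by (auto simp: strict_mono_on_def)
  have j: "inv \<sigma> 1 < m + 2" using permutes_in_image[OF inv, of 1] by simp
  have "inv \<sigma> = front_cycle2 (inv \<sigma> 1, inv \<sigma> 0)"
    by (rule permutes_eqI_strict_mono[OF inv front_cycle2_permutes[OF ij j], of 2])
      (use \<sigma>(2) ij in \<open>auto simp: front_cycle2_0 front_cycle2_1 strict_mono_on_front_cycle2 less_2_cases_iff\<close>)
  then have "\<sigma> = inv (front_cycle2 (inv \<sigma> 1, inv \<sigma> 0))"
    by (metis permutes_inv_inv \<sigma>(1))
  with ij j show "\<sigma> \<in> (\<lambda>p. inv (front_cycle2 p)) ` (SIGMA j:{..<m + 2}. {..<j})" by blast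
next
  fix \<sigma> assume "\<sigma> \<in> (\<lambda>p. inv (front_cycle2 p)) ` (SIGMA j:{..<m + 2}. {..<j})"
  then obtain i j where ij: "i < j" "j < m + 2" "\<sigma> = inv (front_cycle2 (j, i))" by auto
  moreover have "strict_mono_on {..<2} (front_cycle2 (j, i))"
    using ij by (auto simp: strict_mono_on_def less_2_cases_iff front_cycle2_0 front_cycle2_1)
  ultimately show "\<sigma> \<in> Sh_inv 2 m"
    using front_cycle2_permutes[of i j "m + 2"] strict_mono_on_front_cycle2[of "m + 2" j i]
    by (simp add: Sh_inv_def permutes_inv permutes_inv_inv add.commute)
qed

text \<open>An inverse shuffle is fixed by its first two values i < j. Its sign combines a cycle
  with j inversions and one with i + 1 inversions.\<close>

lemma sum_Sh_inv_2:
  "(\<Sum>\<sigma>\<in>Sh_inv 2 m. G (sign \<sigma>) (inv \<sigma>)) =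
   (\<Sum>j<m + 2. \<Sum>i<j. G ((-1) ^ Suc (i + j)) (front_cycle j \<circ> front_cycle (Suc i)))"
proof -
  let ?A = "SIGMA j:{..<m + 2}. {..<j}"
  have perm: "front_cycle2 p permutes {..<m + 2}" if "p \<in> ?A" for p
    using that by (auto simp: front_cycle2_permutes)
  have inv_inv: "inv (inv (front_cycle2 p)) = front_cycle2 p" if "p \<in> ?A" for p
    by (rule permutes_inv_inv[OF perm[OF that]])
  have sign: "sign (inv (front_cycle2 (j, i))) = (-1) ^ Suc (i + j)" if "(j, i) \<in> ?A" for i j
  proof -
    have "permutation (front_cycle k)" for k
      using front_cycle_permutes[of k "Suc k"] by (auto simp: permutation_permutes)
    moreover have "permutation (front_cycle2 (j, i))"
      using perm[OF that] by (auto simp: permutation_permutes)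
    ultimately show ?thesis
      by (simp add: sign_inverse) (simp add: front_cycle2_def sign_compose sign_front_cycle power_add)
  qed
  have "inj_on (\<lambda>p. inv (front_cycle2 p)) ?A"
  proof (rule inj_onI)
    fix p q assume pq: "p \<in> ?A" "q \<in> ?A" "inv (front_cycle2 p) = inv (front_cycle2 q)"
    then have "front_cycle2 p = front_cycle2 q" by (metis inv_inv)
    with pq show "p = q"
      by (cases p; cases q) (metis front_cycle2_0 front_cycle2_1 SigmaD2 lessThan_iff)
  qed
  then have "(\<Sum>\<sigma>\<in>Sh_inv 2 m. G (sign \<sigma>) (inv \<sigma>)) =
      (\<Sum>p\<in>?A. G (sign (inv (front_cycle2 p))) (inv (inv (front_cycle2 p))))"
    by (simp only: Sh_inv_2 sum.reindex comp_def)
  also have "\<dots> = (\<Sum>(j, i)\<in>?A. G ((-1) ^ Suc (i + j)) (front_cycle2 (j, i)))"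
    by (rule sum.cong) (auto simp: sign inv_inv simp del: power_Suc)
  also have "\<dots> = (\<Sum>j<m + 2. \<Sum>i<j. G ((-1) ^ Suc (i + j)) (front_cycle2 (j, i)))"
    by (rule sum.Sigma[symmetric]) auto
  finally show ?thesis by (simp add: front_cycle2_def)
qed


section \<open>Linear extension and multilinear maps\<close>

lemma sum_apply: "sum f A x = (\<Sum>a\<in>A. f a x)"
  by (induction A rule: infinite_finite_induct) simp_all

text \<open>Arity n and total order of differentiation d. For n = d + 1 the support lies in
  \<open>P_set n\<close>, so counting (n, d) through \<open>cd_der\<close> and \<open>cd_mul\<close>
  shows that composites stay in rNov.\<close>

definition cd_homogeneous :: "nat \<Rightarrow> nat \<Rightarrow> (nat list \<Rightarrow> 'k::field) \<Rightarrow> bool" where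
  "cd_homogeneous n d r \<longleftrightarrow>
     finite (supp r) \<and> (\<forall>p \<in> supp r. length p = n \<and> sum_list p = d)"

lemma cd_homogeneous_single: "cd_homogeneous (length p) (sum_list p) (single p)"
  by (simp add: cd_homogeneous_def)

lemma cd_homogeneous_cd_der:
  assumes "cd_homogeneous n d r"
  shows "cd_homogeneous n (Suc d) (cd_der r)"
proof -
  have "length q = n \<and> sum_list q = Suc d" if "q \<in> supp (cd_der r)" for q
  proof -
    have "(\<Sum>p \<in> supp r. \<Sum>i < length p. r p * single (p[i := Suc (p ! i)]) q) \<noteq> 0"
      using that by (simp add: supp_def cd_der_def)
    then obtain p i where "p \<in> supp r" "i < length p" "single (p[i := Suc (p ! i)]) q \<noteq> (0 :: 'a)"
      by (metis (no_types, lifting) lessThan_iff mult_zero_right sum.neutral)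
    moreover from this(2) have "sum_list (p[i := Suc (p ! i)]) = Suc (sum_list p)"
      by (simp add: sum_list_update member_le_sum_list Suc_diff_le)
    ultimately show ?thesis
      using assms by (auto simp: cd_homogeneous_def single_def split: if_splits)
  qed
  with assms show ?thesis
    by (simp add: cd_homogeneous_def finite_supp_cd_der)
qed

lemma supp_cd_mul:
  "supp (cd_mul r s) \<subseteq> (\<lambda>(p, p'). p @ p') ` (supp r \<times> supp s)"
proof
  fix q assume "q \<in> supp (cd_mul r s)"
  then have "(\<Sum>p \<in> supp r. \<Sum>p' \<in> supp s. r p * s p' * single (p @ p') q) \<noteq> 0"
    by (simp add: supp_def cd_mul_def)
  then obtain p p' where "p \<in> supp r" "p' \<in> supp s" "single (p @ p') q \<noteq> (0 :: 'a)"
    by (metis (no_types, lifting) mult_zero_right sum.neutral)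
  then show "q \<in> (\<lambda>(p, p'). p @ p') ` (supp r \<times> supp s)"
    by (auto simp: single_def split: if_splits)
qed

lemma cd_homogeneous_cd_mul:
  assumes "cd_homogeneous n d r" "cd_homogeneous n' d' s"
  shows "cd_homogeneous (n + n') (d + d') (cd_mul r s)"
proof -
  have "finite (supp (cd_mul r s))"
    using assms by (intro finite_subset[OF supp_cd_mul]) (auto simp: cd_homogeneous_def)
  with assms supp_cd_mul[of r s] show ?thesis
    by (force simp: cd_homogeneous_def)
qed

lemma cd_homogeneous_funpow_cd_der:
  "cd_homogeneous n d r \<Longrightarrow> cd_homogeneous n (d + a) ((cd_der ^^ a) r)"
  by (induction a) (simp_all add: cd_homogeneous_cd_der)

context novikov_algebra
begin

text \<open>The linear extension of h from basis elements to r. Operations on r can then be moved to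
  h: \<open>cd_der\<close> becomes a sum over raised exponents, \<open>cd_mul\<close> a nested
  extension.\<close>

definition lin_ext :: "('x \<Rightarrow> 'k) \<Rightarrow> ('x \<Rightarrow> 'g) \<Rightarrow> 'g" where
  "lin_ext r h = (\<Sum>p\<in>supp r. scale (r p) (h p))"

lemma lin_ext_superset:
  assumes "finite A" "supp r \<subseteq> A"
  shows "lin_ext r h = (\<Sum>p\<in>A. scale (r p) (h p))"
  unfolding lin_ext_def using assms
  by (intro sum.mono_neutral_left) (auto simp: supp_def)

lemma lin_ext_single [simp]: "lin_ext (single p) h = h p"
  by (simp add: lin_ext_def)

lemma lin_ext_cong: "(\<And>p. p \<in> supp r \<Longrightarrow> h p = h' p) \<Longrightarrow> lin_ext r h = lin_ext r h'"
  unfolding lin_ext_def by (rule sum.cong) auto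

lemma lin_ext_sum: "lin_ext r (\<lambda>p. \<Sum>i\<in>I. h i p) = (\<Sum>i\<in>I. lin_ext r (h i))"
  unfolding lin_ext_def by (simp add: scale_sum_right sum.swap[of _ I])

text \<open>Different indices i may yield the same basis element \<open>g i\<close>, so coefficients
  are collected over the image of g before the two sums are exchanged.\<close>

lemma lin_ext_lincomb:
  assumes "finite I"
  shows "lin_ext (\<lambda>q. \<Sum>i\<in>I. a i * single (g i) q) h = (\<Sum>i\<in>I. scale (a i) (h (g i)))"
proof -
  have "supp (\<lambda>q. \<Sum>i\<in>I. a i * single (g i) q) \<subseteq> g ` I"
  proof
    fix q assume "q \<in> supp (\<lambda>q. \<Sum>i\<in>I. a i * single (g i) q)"
    then have "(\<Sum>i\<in>I. a i * single (g i) q) \<noteq> 0" by (simp add: supp_def)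
    then obtain i where "i \<in> I" "a i * single (g i) q \<noteq> 0" by (rule sum.not_neutral_contains_not_neutral)
    then show "q \<in> g ` I" by (auto simp: single_def split: if_splits)
  qed
  then have "lin_ext (\<lambda>q. \<Sum>i\<in>I. a i * single (g i) q) h =
      (\<Sum>q\<in>g ` I. \<Sum>i\<in>I. scale (a i * single (g i) q) (h q))"
    using assms by (simp add: lin_ext_superset[of "g ` I"] scale_sum_left)
  also have "\<dots> = (\<Sum>i\<in>I. \<Sum>q\<in>g ` I. scale (a i * single (g i) q) (h q))"
    by (rule sum.swap)
  also have "\<dots> = (\<Sum>i\<in>I. \<Sum>q\<in>g ` I. if q = g i then scale (a i) (h q) else 0)"
    by (intro sum.cong) (auto simp: single_def)
  also have "\<dots> = (\<Sum>i\<in>I. scale (a i) (h (g i)))"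
    using assms by (intro sum.cong) (simp_all add: sum.delta)
  finally show ?thesis .
qed

lemma lin_ext_cd_der:
  assumes "finite (supp r)"
  shows "lin_ext (cd_der r) h = lin_ext r (\<lambda>p. \<Sum>i<length p. h (p[i := Suc (p ! i)]))"
proof -
  let ?I = "SIGMA p:supp r. {..<length p}"
  have "cd_der r = (\<lambda>q. \<Sum>x\<in>?I. r (fst x) * single ((fst x)[snd x := Suc (fst x ! snd x)]) q)"
    using assms by (simp add: cd_der_def sum.Sigma split_def)
  then have "lin_ext (cd_der r) h = (\<Sum>x\<in>?I. scale (r (fst x)) (h ((fst x)[snd x := Suc (fst x ! snd x)])))"
    using assms by (simp only: lin_ext_lincomb finite_SigmaI finite_lessThan)
  also have "\<dots> = lin_ext r (\<lambda>p. \<Sum>i<length p. h (p[i := Suc (p ! i)]))"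
    using assms by (simp add: lin_ext_def scale_sum_right sum.Sigma split_def)
  finally show ?thesis .
qed

lemma lin_ext_cd_mul:
  assumes "finite (supp r)" "finite (supp s)"
  shows "lin_ext (cd_mul r s) h = lin_ext r (\<lambda>p. lin_ext s (\<lambda>p'. h (p @ p')))"
proof -
  let ?I = "supp r \<times> supp s"
  have "cd_mul r s = (\<lambda>q. \<Sum>x\<in>?I. (r (fst x) * s (snd x)) * single (fst x @ snd x) q)"
    by (simp add: cd_mul_def sum.cartesian_product split_def)
  then have "lin_ext (cd_mul r s) h = (\<Sum>x\<in>?I. scale (r (fst x) * s (snd x)) (h (fst x @ snd x)))"
    using assms by (simp only: lin_ext_lincomb finite_cartesian_product)
  also have "\<dots> = lin_ext r (\<lambda>p. lin_ext s (\<lambda>p'. h (p @ p')))"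
    by (simp add: lin_ext_def scale_sum_right sum.cartesian_product split_def)
  finally show ?thesis .
qed

text \<open>Splitting the list at a slot replaces index updates. The length condition can stay
  implicit: at all other lengths the map is 0, and 0 is linear.\<close>

lemma multilinear_maps_iff: "f \<in> multilinear_maps scale n \<longleftrightarrow>
    (\<forall>xs. length xs \<noteq> n \<longrightarrow> f xs = 0) \<and>
    (\<forall>us x y vs. f (us @ (x + y) # vs) = f (us @ x # vs) + f (us @ y # vs)) \<and>
    (\<forall>us c x vs. f (us @ scale c x # vs) = scale c (f (us @ x # vs)))" (is "?L \<longleftrightarrow> ?R")
proof
  assume L: ?L
  then have 0: "f xs = 0" if "length xs \<noteq> n" for xs
    using that by (simp add: multilinear_maps_def)
  have lin: "Vector_Spaces.linear scale scale (\<lambda>x. f (us @ x # vs))" for us vs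
  proof (cases "length us + length vs + 1 = n")
    case True
    have "\<forall>xs i. length xs = n \<longrightarrow> i < n \<longrightarrow> Vector_Spaces.linear scale scale (\<lambda>x. f (xs[i := x]))"
      using L by (simp add: multilinear_maps_def)
    from this[rule_format, of "us @ 0 # vs" "length us"] True show ?thesis by simp
  next
    case False
    then show ?thesis by (simp add: 0 linear_self_iff)
  qed
  with 0 show ?R unfolding linear_self_iff by blast
next
  assume R: ?R
  have "Vector_Spaces.linear scale scale (\<lambda>x. f (xs[i := x]))" if "i < length xs" for xs i
    using R that by (simp add: linear_self_iff upd_conv_take_nth_drop)
  with R show ?L by (simp add: multilinear_maps_def)
qed

lemma multilinear_maps_zero_arg:
  assumes "f \<in> multilinear_maps scale n" "0 \<in> set xs"
  shows "f xs = 0"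
proof -
  obtain us vs where "xs = us @ 0 # vs" using assms(2) by (meson split_list)
  moreover have "f (us @ scale 0 0 # vs) = scale 0 (f (us @ 0 # vs))"
    using assms(1) by (metis multilinear_maps_iff)
  ultimately show ?thesis by simp
qed

text \<open>Only the first slot is treated, since the differential inserts \<open>\<nu>\<close>
  there and reaches the other slots by permutations.\<close>

lemma multilinear_maps_hd_sum:
  assumes "f \<in> multilinear_maps scale n"
  shows "f ((\<Sum>i\<in>I. scale (a i) (g i)) # vs) = (\<Sum>i\<in>I. scale (a i) (f (g i # vs)))"
proof -
  have "Vector_Spaces.linear scale scale (\<lambda>x. f ([] @ x # vs))"
    unfolding linear_self_iff using assms by (metis multilinear_maps_iff)
  then interpret Vector_Spaces.linear scale scale "\<lambda>x. f (x # vs)" by simp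
  show ?thesis by (simp add: sum scale)
qed

lemma multilinear_maps_hd_lin_ext:
  "f \<in> multilinear_maps scale n \<Longrightarrow> f (lin_ext r h # vs) = lin_ext r (\<lambda>p. f (h p # vs))"
  by (simp add: lin_ext_def multilinear_maps_hd_sum)

lemma multilinear_maps_add:
  "f \<in> multilinear_maps scale n \<Longrightarrow> g \<in> multilinear_maps scale n \<Longrightarrow> f + g \<in> multilinear_maps scale n"
  by (simp add: multilinear_maps_iff scale_right_distrib add_ac)

lemma multilinear_maps_scale:
  "f \<in> multilinear_maps scale n \<Longrightarrow> (\<lambda>xs. scale c (f xs)) \<in> multilinear_maps scale n"
  by (simp add: multilinear_maps_iff scale_right_distrib scale_left_commute)

lemma multilinear_maps_zero: "0 \<in> multilinear_maps scale n"
  by (simp add: multilinear_maps_iff)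

lemma multilinear_maps_perm:
  assumes "f \<in> multilinear_maps scale n" "\<pi> permutes {..<n}"
  shows "(\<lambda>xs. f (permute_list \<pi> xs)) \<in> multilinear_maps scale n"
proof -
  have "permute_list \<pi> (xs[i := x]) = (permute_list \<pi> xs)[inv \<pi> i := x]"
    if "length xs = n" "i < n" for xs :: "'g list" and i x
  proof (rule nth_equalityI)
    fix k assume "k < length (permute_list \<pi> (xs[i := x]))"
    moreover have "\<pi> k = i \<longleftrightarrow> k = inv \<pi> i"
      using assms(2) by (metis permutes_inverses)
    ultimately show "permute_list \<pi> (xs[i := x]) ! k = (permute_list \<pi> xs)[inv \<pi> i := x] ! k"
      using assms(2) that permutes_in_image[OF assms(2), of k]
      by (auto simp: permute_list_nth nth_list_update)
  qed simp
  moreover have "inv \<pi> i < n" if "i < n" for i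
    using permutes_in_image[OF permutes_inv[OF assms(2)], of i] that by simp
  ultimately show ?thesis
    using assms(1) by (simp add: multilinear_maps_def)
qed

end


section \<open>Families of multilinear maps and their evaluation\<close>

text \<open>With the normalisation by factorials, X a is the constant term of the a-th derivative of
  X. These are therefore the arguments on which the coefficient at \<open>p\<close> is
  evaluated.\<close>

definition coeffs_at :: "nat list \<Rightarrow> (nat \<Rightarrow> 'g) list \<Rightarrow> 'g list" where
  "coeffs_at p Xs = map2 (\<lambda>a X. X a) p Xs"

lemma coeffs_at_Nil [simp]: "coeffs_at [] Xs = []"
  by (simp add: coeffs_at_def)

lemma coeffs_at_Cons [simp]: "coeffs_at (a # p) (X # Xs) = X a # coeffs_at p Xs"
  by (simp add: coeffs_at_def)

lemma length_coeffs_at [simp]: "length (coeffs_at p Xs) = min (length p) (length Xs)"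
  by (simp add: coeffs_at_def)

lemma nth_coeffs_at: "i < length p \<Longrightarrow> i < length Xs \<Longrightarrow> coeffs_at p Xs ! i = (Xs ! i) (p ! i)"
  by (simp add: coeffs_at_def)

text \<open>Raising one exponent amounts to differentiating one argument; this turns
  \<open>cd_der\<close> on the operadic side into \<open>slot_sum shift\<close> on the series
  side.\<close>

lemma coeffs_at_shift:
  "length p = length Xs \<Longrightarrow> coeffs_at (p[i := Suc (p ! i)]) Xs = coeffs_at p (Xs[i := shift (Xs ! i)])"
  by (cases "i < length Xs")
    (auto intro!: nth_equalityI simp: nth_coeffs_at nth_list_update list_update_beyond shift_apply)

lemma coeffs_at_permute:
  assumes "\<sigma> permutes {..<length p}" "length Xs = length p"
  shows "coeffs_at (permute_list \<sigma> p) (permute_list \<sigma> Xs) = permute_list \<sigma> (coeffs_at p Xs)"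
proof (rule nth_equalityI)
  fix i assume "i < length (coeffs_at (permute_list \<sigma> p) (permute_list \<sigma> Xs))"
  then show "coeffs_at (permute_list \<sigma> p) (permute_list \<sigma> Xs) ! i = permute_list \<sigma> (coeffs_at p Xs) ! i"
    using assms permutes_in_image[OF assms(1), of i]
    by (simp add: nth_coeffs_at permute_list_nth)
qed (use assms in simp)

lemma supp_subset_iff: "supp r \<subseteq> A \<longleftrightarrow> (\<forall>x. x \<notin> A \<longrightarrow> r x = 0)"
  by (auto simp: supp_def)

lemma finite_P_set: "finite (P_set n)"
proof (rule finite_subset)
  show "P_set n \<subseteq> {p. set p \<subseteq> {..n} \<and> length p = n}"
    by (auto simp: P_set_def dest: member_le_sum_list)
qed (rule finite_lists_length_eq, simp)

lemma permute_list_inv_cancel: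
  "\<sigma> permutes {..<length xs} \<Longrightarrow> permute_list \<sigma> (permute_list (inv \<sigma>) xs) = xs"
  "\<sigma> permutes {..<length xs} \<Longrightarrow> permute_list (inv \<sigma>) (permute_list \<sigma> xs) = xs"
  by (metis permute_list_compose permute_list_id permutes_inv_o(2))
    (metis permute_list_compose permute_list_id permutes_inv permutes_inv_o(1))

lemma permute_list_P_set:
  "\<sigma> permutes {..<n} \<Longrightarrow> p \<in> P_set n \<Longrightarrow> permute_list \<sigma> p \<in> P_set n"
  by (auto simp: P_set_def simp flip: sum_mset_sum_list)

context novikov_algebra
begin

abbreviation "NovOp \<equiv> novOp scale"

text \<open>Coordinates of the Hadamard product in the monomial basis of rNov;
  \<open>arity_space_NovOp\<close> identifies the two.\<close>

definition families :: "nat \<Rightarrow> (nat list \<Rightarrow> 'g list \<Rightarrow> 'g) set" where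
  "families n = {F. (\<forall>p. p \<notin> P_set n \<longrightarrow> F p = 0) \<and> (\<forall>p. F p \<in> multilinear_maps scale n)}"

lemma families_add: "F \<in> families n \<Longrightarrow> G \<in> families n \<Longrightarrow> F + G \<in> families n"
  by (simp add: families_def multilinear_maps_add)

lemma families_zero: "0 \<in> families n"
  by (simp add: families_def multilinear_maps_zero)

lemma families_scale: "F \<in> families n \<Longrightarrow> fam_scale scale c F \<in> families n"
  by (auto simp: families_def multilinear_maps_scale fam_scale_def fun_eq_iff)

lemma families_uminus: "F \<in> families n \<Longrightarrow> - F \<in> families n"
proof -
  have "- F = fam_scale scale (- 1) F" by (simp add: fam_scale_def fun_eq_iff)
  then show "F \<in> families n \<Longrightarrow> - F \<in> families n" by (simp only: families_scale)
qed

lemma families_diff: "F \<in> families n \<Longrightarrow> G \<in> families n \<Longrightarrow> F - G \<in> families n"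
  using families_add[of F n "- G"] families_uminus[of G n] by simp

lemma families_sum: "(\<And>i. i \<in> I \<Longrightarrow> F i \<in> families n) \<Longrightarrow> sum F I \<in> families n"
  by (induction I rule: infinite_finite_induct) (auto simp: families_zero families_add)

lemma families_supp: "F \<in> families n \<Longrightarrow> supp F \<subseteq> P_set n"
  by (auto simp: families_def supp_def)

lemma finite_supp_families: "F \<in> families n \<Longrightarrow> finite (supp F)"
  using families_supp finite_P_set by (rule finite_subset)

lemma families_tensor:
  assumes "supp r \<subseteq> P_set n" "f \<in> multilinear_maps scale n"
  shows "tensor (smult (EndOp scale)) r f \<in> families n"
proof -
  have "r p = 0" if "p \<notin> P_set n" for p using assms(1) that by (auto simp: supp_def)
  with assms(2) show ?thesis
    by (auto simp: families_def tensor_def EndOp_def fun_eq_iff multilinear_maps_scale)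
qed

lemma smult_NovOp: "smult NovOp = fam_scale scale"
  by (simp add: novOp_def Hadamard_def EndOp_def fam_scale_def fun_eq_iff)

lemma module_fam_scale: "module (fam_scale scale)"
  by standard (simp_all add: fam_scale_def fun_eq_iff scale_right_distrib scale_left_distrib)

lemma module_ComDer: "module (smult (ComDer :: ('k, nat list \<Rightarrow> 'k) operad))"
  by standard (simp_all add: ComDer_def fun_eq_iff algebra_simps)

lemma families_subspace: "module.subspace (fam_scale scale) (families n)"
  by (simp add: module.subspace_def[OF module_fam_scale] families_add families_zero families_scale)

lemma supp_rNov:
  assumes "r \<in> arity_space (rNov :: ('k, nat list \<Rightarrow> 'k) operad) n"
  shows "supp r \<subseteq> P_set n"
proof -
  interpret cd: module "smult (ComDer :: ('k, nat list \<Rightarrow> 'k) operad)" by (rule module_ComDer)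
  have "cd.span (cd_monomial ` P_set n) \<subseteq> {r. supp r \<subseteq> P_set n}"
  proof (rule cd.span_minimal)
    show "cd_monomial ` P_set n \<subseteq> {r :: nat list \<Rightarrow> 'k. supp r \<subseteq> P_set n}"
    proof
      fix r :: "nat list \<Rightarrow> 'k" assume "r \<in> cd_monomial ` P_set n"
      then obtain p where "p \<in> P_set n" "r = cd_monomial p" by blast
      moreover from this(1) have "p \<noteq> []" by (auto simp: P_set_def)
      ultimately show "r \<in> {r. supp r \<subseteq> P_set n}" by (simp add: cd_monomial_eq)
    qed
    show "cd.subspace {r. supp r \<subseteq> P_set n}"
      by (simp add: cd.subspace_def supp_subset_iff) (simp add: ComDer_def)
  qed
  with assms show ?thesis by (auto simp: rNov_def)
qed

lemma single_rNov:
  assumes "p \<in> P_set n"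
  shows "single p \<in> arity_space (rNov :: ('k, nat list \<Rightarrow> 'k) operad) n"
proof -
  interpret cd: module "smult (ComDer :: ('k, nat list \<Rightarrow> 'k) operad)" by (rule module_ComDer)
  have "p \<noteq> []" using assms by (auto simp: P_set_def)
  then have "(single p :: nat list \<Rightarrow> 'k) \<in> cd_monomial ` P_set n"
    using assms by (intro image_eqI[of _ _ p]) (simp_all add: cd_monomial_eq)
  then show ?thesis
    unfolding rNov_def by (simp add: cd.span_base)
qed

lemma families_expand:
  assumes "\<And>p. p \<notin> P_set n \<Longrightarrow> F p = 0"
  shows "(\<Sum>p\<in>P_set n. tensor (smult (EndOp scale)) (single p) (F p)) = F"
proof (intro ext)
  fix p xs
  have "(\<Sum>q\<in>P_set n. tensor (smult (EndOp scale)) (single q) (F q)) p xs =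
      (\<Sum>q\<in>P_set n. if q = p then F q xs else 0)"
    by (auto simp: sum_apply tensor_def EndOp_def single_def intro!: sum.cong)
  with assms[of p] show "(\<Sum>p\<in>P_set n. tensor (smult (EndOp scale)) (single p) (F p)) p xs = F p xs"
    by (auto simp: finite_P_set)
qed

text \<open>Pure tensors are families because rNov is supported on \<open>P_set n\<close>;
  conversely F is the sum of the pure tensors \<open>single p\<close> with
  \<open>F p\<close>.\<close>

lemma arity_space_NovOp: "arity_space NovOp n = families n"
proof -
  interpret fam: module "fam_scale scale :: 'k \<Rightarrow> (nat list \<Rightarrow> 'g list \<Rightarrow> 'g) \<Rightarrow> _" by (rule module_fam_scale)
  let ?T = "{tensor (smult (EndOp scale)) r f | r f.
    r \<in> arity_space (rNov :: ('k, nat list \<Rightarrow> 'k) operad) n \<and> f \<in> arity_space (EndOp scale) n}"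
  have eq: "arity_space NovOp n = fam.span ?T"
    by (simp add: novOp_def Hadamard_def EndOp_def fam_scale_def[abs_def])
  have "fam.span ?T \<subseteq> families n"
  proof (rule fam.span_minimal)
    show "?T \<subseteq> families n"
    proof
      fix F assume "F \<in> ?T"
      then obtain r f where F: "F = tensor (smult (EndOp scale)) r f"
        and r: "r \<in> arity_space (rNov :: ('k, nat list \<Rightarrow> 'k) operad) n"
        and f: "f \<in> arity_space (EndOp scale) n" by blast
      from f have "f \<in> multilinear_maps scale n" by (simp add: EndOp_def)
      then show "F \<in> families n" unfolding F by (rule families_tensor[OF supp_rNov[OF r]])
    qed
  qed (rule families_subspace)
  moreover have "F \<in> fam.span ?T" if "F \<in> families n" for F
  proof -
    have "(\<Sum>p\<in>P_set n. tensor (smult (EndOp scale)) (single p) (F p)) \<in> fam.span ?T"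
    proof (rule fam.span_sum, rule fam.span_base)
      fix p assume "p \<in> P_set n"
      with that show "tensor (smult (EndOp scale)) (single p) (F p) \<in> ?T"
        by (force simp: single_rNov families_def EndOp_def)
    qed
    with that show ?thesis by (simp add: families_expand families_def)
  qed
  ultimately show ?thesis unfolding eq by blast
qed

lemma act_NovOp:
  assumes "finite (supp F)"
  shows "act NovOp \<sigma> F q xs = F (permute_list (inv \<sigma>) q) (permute_list (inv \<sigma>) xs)"
proof -
  have "act NovOp \<sigma> F q xs = (\<Sum>x\<in>supp F. if x = permute_list (inv \<sigma>) q
      then F x (permute_list (inv \<sigma>) xs) else 0)"
    by (auto simp: novOp_def Hadamard_def sum_apply tensor_def EndOp_def rNov_def ComDer_def
        perm_act_def single_def intro!: sum.cong)
  also have "\<dots> = F (permute_list (inv \<sigma>) q) (permute_list (inv \<sigma>) xs)"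
    using assms by (auto simp: supp_def)
  finally show ?thesis .
qed

lemma act_families:
  assumes "F \<in> families n" "\<sigma> permutes {..<n}"
  shows "act NovOp \<sigma> F \<in> families n"
proof -
  have act: "act NovOp \<sigma> F q xs = F (permute_list (inv \<sigma>) q) (permute_list (inv \<sigma>) xs)" for q xs
    by (rule act_NovOp[OF finite_supp_families[OF assms(1)]])
  have inv: "inv \<sigma> permutes {..<n}" using assms(2) by (rule permutes_inv)
  have "act NovOp \<sigma> F q = 0" if "q \<notin> P_set n" for q
  proof -
    have "permute_list (inv \<sigma>) q \<notin> P_set n"
    proof
      assume *: "permute_list (inv \<sigma>) q \<in> P_set n"
      then have "length q = n" by (auto simp: P_set_def)
      with permute_list_P_set[OF assms(2) *] assms(2) have "q \<in> P_set n"
        by (simp add: permute_list_inv_cancel)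
      with that show False by blast
    qed
    with assms(1) show ?thesis by (auto simp: act fun_eq_iff families_def)
  qed
  moreover have "act NovOp \<sigma> F q \<in> multilinear_maps scale n" for q
  proof -
    have "act NovOp \<sigma> F q = (\<lambda>xs. F (permute_list (inv \<sigma>) q) (permute_list (inv \<sigma>) xs))"
      by (simp add: act fun_eq_iff)
    with assms(1) inv show ?thesis by (simp add: families_def multilinear_maps_perm)
  qed
  ultimately show ?thesis by (simp add: families_def)
qed

text \<open>
  The constant term of the multilinear map \<open>(X\<^sub>1, \<dots>, X\<^sub>n) \<mapsto> \<Sum>\<^sub>p F\<^sub>p (X\<^sub>1\<^sup>(\<^sup>p\<^sup>1\<^sup>), \<dots>, X\<^sub>n\<^sup>(\<^sup>p\<^sup>n\<^sup>))\<close>.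
\<close>

definition eval :: "nat \<Rightarrow> (nat list \<Rightarrow> 'g list \<Rightarrow> 'g) \<Rightarrow> (nat \<Rightarrow> 'g) list \<Rightarrow> 'g" where
  "eval n F Xs = (if length Xs = n then \<Sum>p\<in>P_set n. F p (coeffs_at p Xs) else 0)"

lemma eval_length: "length Xs \<noteq> n \<Longrightarrow> eval n F Xs = 0"
  by (simp add: eval_def)

lemma eval_supp:
  assumes "F \<in> families n" "length Xs = n"
  shows "eval n F Xs = (\<Sum>p\<in>supp F. F p (coeffs_at p Xs))"
  unfolding eval_def using assms families_supp[OF assms(1)]
  by (auto simp: supp_def finite_P_set intro!: sum.mono_neutral_right)

lemma eval_add: "eval n (F + G) Xs = eval n F Xs + eval n G Xs"
  by (simp add: eval_def sum.distrib)

lemma eval_diff: "eval n (F - G) Xs = eval n F Xs - eval n G Xs"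
  by (simp add: eval_def sum_subtractf)

lemma eval_sum: "eval n (sum F I) Xs = (\<Sum>i\<in>I. eval n (F i) Xs)"
  by (simp add: eval_def sum_apply sum.swap[of _ I])

lemma eval_scale: "eval n (fam_scale scale c F) Xs = scale c (eval n F Xs)"
  by (simp add: eval_def fam_scale_def scale_sum_right)

lemma eval_tensor:
  assumes "supp r \<subseteq> P_set n" "length Xs = n"
  shows "eval n (tensor (smult (EndOp scale)) r f) Xs = lin_ext r (\<lambda>p. f (coeffs_at p Xs))"
  using assms by (simp add: eval_def lin_ext_superset[OF finite_P_set assms(1)] tensor_def EndOp_def)

lemma coeffs_at_append:
  "length p = length us + length vs \<Longrightarrow> coeffs_at p (us @ vs) =
    coeffs_at (take (length us) p) us @ coeffs_at (drop (length us) p) vs"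
  by (rule nth_equalityI) (auto simp: nth_coeffs_at nth_append)

lemma coeffs_at_split:
  assumes "length p = length (us @ X # vs)"
  shows "coeffs_at p (us @ X # vs) = coeffs_at (take (length us) p) us @ X (p ! length us) #
    coeffs_at (drop (Suc (length us)) p) vs"
  using assms by (simp add: coeffs_at_append flip: Cons_nth_drop_Suc)

lemma multi_additive_eval:
  assumes "F \<in> families n"
  shows "multi_additive (eval n F)"
proof -
  have "F p (us @ (x + y) # vs) = F p (us @ x # vs) + F p (us @ y # vs)" for p us x y vs
    using assms by (auto simp: families_def multilinear_maps_iff)
  then have eq: "F p (coeffs_at p (us @ (X + Y) # vs)) =
      F p (coeffs_at p (us @ X # vs)) + F p (coeffs_at p (us @ Y # vs))"
    if "p \<in> P_set (Suc (length us + length vs))" for p us X Y vs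
    using that by (simp add: P_set_def coeffs_at_split)
  show ?thesis
    unfolding multi_additive_def
  proof (intro allI)
    fix us vs and X Y :: "nat \<Rightarrow> 'g"
    show "eval n F (us @ (X + Y) # vs) = eval n F (us @ X # vs) + eval n F (us @ Y # vs)"
      by (cases "n = Suc (length us + length vs)") (simp add: eval_def eq sum.distrib del: append_Cons, simp add: eval_length)
  qed
qed

text \<open>The value of F p at xs is recovered from the series x t^a / a!, one for each entry x of
  xs and a of p. In this normalisation they have the single coefficient x at place a, so no
  factorial appears.\<close>

lemma eval_inject:
  assumes "F \<in> families n" "G \<in> families n" "\<And>Xs. length Xs = n \<Longrightarrow> eval n F Xs = eval n G Xs"
  shows "F = G"
proof -
  have eval: "eval n F (map2 (\<lambda>a x m. if m = a then x else 0) p xs) = F p xs"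
    if "F \<in> families n" "p \<in> P_set n" "length xs = n" for F p and xs :: "'g list"
  proof -
    let ?Xs = "map2 (\<lambda>a x m. if m = a then x else 0) p xs"
    have p: "length p = n" using that by (simp add: P_set_def)
    have "coeffs_at p ?Xs = xs"
      using p that(3) by (intro nth_equalityI) (auto simp: nth_coeffs_at)
    \<comment> \<open>An index q different from p reads in some slot a coefficient of the monomial
      that is 0, and a multilinear map vanishes there.\<close>
    moreover have "F q (coeffs_at q ?Xs) = 0" if q: "q \<in> P_set n" "q \<noteq> p" for q
    proof -
      obtain i where i: "i < n" "q ! i \<noteq> p ! i"
        using q p nth_equalityI[of q p] by (auto simp: P_set_def)
      then have "coeffs_at q ?Xs ! i = 0"
        using q(1) p \<open>length xs = n\<close> by (simp add: nth_coeffs_at P_set_def)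
      moreover have "i < length (coeffs_at q ?Xs)"
        using q(1) p \<open>length xs = n\<close> i(1) by (simp add: P_set_def)
      ultimately have "0 \<in> set (coeffs_at q ?Xs)"
        by (metis nth_mem)
      with \<open>F \<in> families n\<close> show ?thesis
        by (intro multilinear_maps_zero_arg[of _ n]) (auto simp: families_def)
    qed
    ultimately have "(\<Sum>q\<in>P_set n. F q (coeffs_at q ?Xs)) = (\<Sum>q\<in>P_set n. if q = p then F p xs else 0)"
      by (intro sum.cong) auto
    then show ?thesis
      using that p by (simp add: eval_def finite_P_set)
  qed
  show ?thesis
  proof (intro ext)
    fix p xs
    show "F p xs = G p xs"
    proof (cases "p \<in> P_set n \<and> length xs = n")
      case True
      then have "length (map2 (\<lambda>a x m. if m = a then x else 0) p xs) = n" by (simp add: P_set_def)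
      from assms(3)[OF this] True show ?thesis by (simp add: eval assms(1,2))
    next
      case False
      then show ?thesis using assms(1,2) by (auto simp: families_def multilinear_maps_iff)
    qed
  qed
qed

text \<open>The diagonal action permutes exponents and arguments simultaneously; after reindexing
  the sum over p this is a permutation of the series.\<close>

lemma eval_act:
  assumes "F \<in> families n" "\<sigma> permutes {..<n}"
  shows "eval n (act NovOp \<sigma> F) Xs = eval n F (permute_list (inv \<sigma>) Xs)"
proof (cases "length Xs = n")
  case True
  have inv: "inv \<sigma> permutes {..<n}" using assms(2) by (rule permutes_inv)
  have "(\<Sum>p\<in>P_set n. F (permute_list (inv \<sigma>) p) (permute_list (inv \<sigma>) (coeffs_at p Xs))) =
      (\<Sum>p\<in>P_set n. F p (coeffs_at p (permute_list (inv \<sigma>) Xs)))"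
  proof (rule sum.reindex_bij_witness[of _ "permute_list \<sigma>" "permute_list (inv \<sigma>)"])
    fix p assume p: "p \<in> P_set n"
    then have l: "length p = n" by (simp add: P_set_def)
    show "permute_list \<sigma> (permute_list (inv \<sigma>) p) = p" "permute_list (inv \<sigma>) (permute_list \<sigma> p) = p"
      using assms(2) l by (simp_all add: permute_list_inv_cancel)
    show "permute_list (inv \<sigma>) p \<in> P_set n" "permute_list \<sigma> p \<in> P_set n"
      using p assms(2) inv by (simp_all add: permute_list_P_set)
    show "F (permute_list (inv \<sigma>) p) (coeffs_at (permute_list (inv \<sigma>) p) (permute_list (inv \<sigma>) Xs)) =
      F (permute_list (inv \<sigma>) p) (permute_list (inv \<sigma>) (coeffs_at p Xs))"
      using inv l True by (simp add: coeffs_at_permute)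
  qed
  with True show ?thesis
    by (simp add: eval_def act_NovOp[OF finite_supp_families[OF assms(1)]])
qed (simp add: eval_length)

end


section \<open>The composites in the differential\<close>

lemma sum_listset_Cons:
  assumes "finite A" "finite (listset Bs)"
  shows "(\<Sum>ys\<in>listset (A # Bs). f ys) = (\<Sum>y\<in>A. \<Sum>ys\<in>listset Bs. f (y # ys))"
proof -
  have "listset (A # Bs) = (\<lambda>(y, ys). y # ys) ` (A \<times> listset Bs)"
    by (auto simp: set_Cons_def)
  moreover have "inj_on (\<lambda>(y, ys). y # ys) (A \<times> listset Bs)"
    by (auto simp: inj_on_def)
  ultimately show ?thesis
    by (simp add: sum.reindex sum.cartesian_product split_def del: listset.simps)
qed

lemma finite_listset: "(\<And>A. A \<in> set As \<Longrightarrow> finite A) \<Longrightarrow> finite (listset As)"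
proof (induction As)
  case (Cons A As)
  have "set_Cons A (listset As) = (\<lambda>(y, ys). y # ys) ` (A \<times> listset As)"
    by (auto simp: set_Cons_def)
  with Cons show ?case by simp
qed simp

lemma map2_replicate: "map2 f (replicate k a) (replicate k b) = replicate k (f a b)"
  by (induction k) simp_all

lemma listset_replicate_singleton: "listset (replicate k {y}) = {replicate k y}"
  by (induction k) (auto simp: set_Cons_def)

lemma cd_der_funpow_single: "(cd_der ^^ a) (single [b]) = single [a + b]"
  by (induction a) (simp_all add: cd_der_single1)

lemma foldr_cd_mul_unit:
  "length p = k \<Longrightarrow>
    foldr cd_mul (map2 (\<lambda>a s. (cd_der ^^ a) s) p (replicate k (single [0]))) (single []) = single p"
  by (induction p arbitrary: k) (auto simp: cd_der_funpow_single cd_mul_single)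

context novikov_algebra
begin

abbreviation "NovEnd \<equiv> EndOp scale"
abbreviation "\<nu> \<equiv> alpha_nu scale nov"

lemma alpha_nu_apply:
  "\<nu> p xs = (if p = [1, 0] \<and> length xs = 2 then xs ! 0 \<diamondop> xs ! 1
     else if p = [0, 1] \<and> length xs = 2 then - (xs ! 1 \<diamondop> xs ! 0) else 0)"
proof -
  have "permute_list (transpose 0 1) xs = [xs ! 1, xs ! 0]" if "length xs = 2" for xs :: "'g list"
    using that by (auto simp: permute_list_def numeral_2_eq_2)
  moreover have "\<nu> p xs = scale (single [1, 0] p) (omega nov xs) -
      scale (single [0, 1] p) (omega nov (permute_list (transpose 0 1) xs))"
    by (simp add: alpha_nu_def tensor_def EndOp_def cd_mu_def cd_D_def compose_single ident_ComDer
      cd_mul_single perm_act_def)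
  ultimately show ?thesis
    by (auto simp: single_def omega_def)
qed

lemma nov_sum_left: "sum f I \<diamondop> y = (\<Sum>i\<in>I. f i \<diamondop> y)"
  using linear_left[of y] by (rule module_hom.sum[OF Vector_Spaces.linear.axioms(3)])

lemma nov_sum_right: "y \<diamondop> sum f I = (\<Sum>i\<in>I. y \<diamondop> f i)"
  using linear_right[of y] by (rule module_hom.sum[OF Vector_Spaces.linear.axioms(3)])

lemma supp_alpha_nu: "supp \<nu> \<subseteq> {[1, 0], [0, 1]}"
  by (auto simp: supp_def alpha_nu_apply fun_eq_iff)

lemma finite_supp_alpha_nu: "finite (supp \<nu>)"
  using supp_alpha_nu by (rule finite_subset) simp

lemma alpha_nu_multilinear: "\<nu> p \<in> multilinear_maps scale 2"
proof -
  have "length xs = 2 \<longleftrightarrow> (\<exists>x y. xs = [x, y])" for xs :: "'g list"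
    by (auto simp: numeral_2_eq_2 length_Suc_conv)
  then show ?thesis
    by (auto simp: multilinear_maps_iff alpha_nu_apply append_eq_Cons_conv nov_add_left nov_add_right
      nov_scale_left nov_scale_right nth_append nth_Cons')
qed

lemma ident_NovOp_apply: "ident NovOp p = (if p = [0] then ident NovEnd else 0)"
  by (auto simp: novOp_def Hadamard_def rNov_def ident_ComDer tensor_def EndOp_def single_def fun_eq_iff)

text \<open>Composition sums over supports, so the support of the identity must be known exactly. It
  is \<open>{[0]}\<close> as soon as some vector v is nonzero, and this witness is carried along
  from here on.\<close>

lemma supp_ident_NovOp:
  assumes "v \<noteq> (0 :: 'g)"
  shows "supp (ident NovOp) = {[0]}"
proof -
  have "ident NovEnd [v] \<noteq> 0" using assms by (simp add: EndOp_def)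
  then have "ident NovEnd \<noteq> 0" by auto
  then show ?thesis by (auto simp: supp_def ident_NovOp_apply)
qed

definition outer :: "nat \<Rightarrow> (nat list \<Rightarrow> 'g list \<Rightarrow> 'g) \<Rightarrow> nat list \<Rightarrow> 'g list \<Rightarrow> 'g" where
  "outer n F = compose NovOp \<nu> [(1, ident NovOp), (n, F)]"

definition inner :: "nat \<Rightarrow> (nat list \<Rightarrow> 'g list \<Rightarrow> 'g) \<Rightarrow> nat list \<Rightarrow> 'g list \<Rightarrow> 'g" where
  "inner n F = compose NovOp F ((2, \<nu>) # replicate (n - 1) (1, ident NovOp))"

lemma compose_NovEnd_outer:
  "compose NovEnd f [(1, ident NovEnd), (n, g)] =
    (\<lambda>xs. if length xs = Suc n then f [hd xs, g (tl xs)] else 0)"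
  by (auto simp: EndOp_def fun_eq_iff length_Suc_conv)

lemma apply_blocks_ident: "length xs = k \<Longrightarrow> apply_blocks (replicate k (Suc 0, ident NovEnd)) xs = xs"
  by (induction xs arbitrary: k) (auto simp: EndOp_def)

lemma compose_NovEnd_inner:
  "compose NovEnd f ((2, g) # replicate k (1, ident NovEnd)) =
    (\<lambda>xs. if length xs = k + 2 then f (g (take 2 xs) # drop 2 xs) else 0)"
proof -
  have "apply_blocks (replicate k (Suc 0, ident NovEnd)) (drop 2 xs) = drop 2 xs"
    if "length xs = k + 2" for xs
    using that by (intro apply_blocks_ident) simp
  then show ?thesis
    by (auto simp: EndOp_def fun_eq_iff sum_list_replicate)
qed

lemma compose_ComDer_outer:
  "compose ComDer (single x) [(1, single [0]), (n, single y)] =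
    foldr cd_mul (map2 (\<lambda>a s. (cd_der ^^ a) s) x [single [0], single y]) (single [])"
  by (simp add: compose_single)

lemma compose_ComDer_inner:
  assumes "length x = k"
  shows "compose ComDer (single (a # x)) ((2, single y) # replicate k (1, single [0])) =
    cd_mul ((cd_der ^^ a) (single y)) (single x)"
  by (simp add: compose_single foldr_cd_mul_unit[OF assms])

lemma compose_NovOp: "compose NovOp F Gs =
    (\<Sum>x\<in>supp F. \<Sum>ys\<in>listset (map (supp \<circ> snd) Gs). tensor (smult NovEnd)
      (compose ComDer (single x) (map2 (\<lambda>(m, G) y. (m, single y)) Gs ys))
      (compose NovEnd (F x) (map2 (\<lambda>(m, G) y. (m, G y)) Gs ys)))"
  by (simp add: novOp_def Hadamard_def rNov_def)

text \<open>The two exponent lists of \<open>\<nu>\<close> behave differently: \<open>[1, 0]\<close>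
  puts \<open>D\<close> on the new input and leaves y unchanged, while \<open>[0, 1]\<close> applies
  \<open>D\<close> to F and spreads over y by the Leibniz rule.\<close>

lemma outer_eq:
  assumes "F \<in> families n" "v \<noteq> (0 :: 'g)"
  shows "outer n F = (\<Sum>y\<in>supp F.
    tensor (smult NovEnd) (single (1 # y)) (\<lambda>xs. if length xs = Suc n then hd xs \<diamondop> F y (tl xs) else 0) +
    tensor (smult NovEnd) (cd_mul (single [0]) (cd_der (single y)))
      (\<lambda>xs. if length xs = Suc n then - (F y (tl xs) \<diamondop> hd xs) else 0))"
proof -
  let ?t = "\<lambda>x y. tensor (smult NovEnd) (compose ComDer (single x) [(1, single [0]), (n, single y)])
      (compose NovEnd (\<nu> x) [(1, ident NovEnd), (n, F y)])"
  have zero: "?t x y = 0" if "x \<notin> supp \<nu>" for x y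
  proof -
    have "\<nu> x = 0" using that by (simp add: supp_def)
    then show ?thesis by (auto simp: compose_NovEnd_outer tensor_def EndOp_def fun_eq_iff)
  qed
  have fin: "finite (supp F)" using assms(1) by (rule finite_supp_families)
  then have fin': "finite (listset [supp F])" by (intro finite_listset) auto
  have "outer n F = (\<Sum>x\<in>supp \<nu>. \<Sum>y\<in>supp F. ?t x y)"
    by (simp add: outer_def compose_NovOp supp_ident_NovOp[OF assms(2)] sum_listset_Cons fin
        fin' ident_NovOp_apply del: listset.simps(2))
  \<comment> \<open>The support of \<open>\<nu>\<close> can be smaller than these two lists, for
    instance when the product is zero; the added terms vanish by \<open>zero\<close>.\<close>
  also have "\<dots> = (\<Sum>x\<in>{[1, 0], [0, 1]}. \<Sum>y\<in>supp F. ?t x y)"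
    using supp_alpha_nu by (intro sum.mono_neutral_left ballI sum.neutral) (simp_all add: zero del: One_nat_def)
  also have "\<dots> = (\<Sum>y\<in>supp F. ?t [1, 0] y + ?t [0, 1] y)"
    by (simp add: sum.distrib)
  also have "\<dots> = (\<Sum>y\<in>supp F.
    tensor (smult NovEnd) (single (1 # y)) (\<lambda>xs. if length xs = Suc n then hd xs \<diamondop> F y (tl xs) else 0) +
    tensor (smult NovEnd) (cd_mul (single [0]) (cd_der (single y)))
      (\<lambda>xs. if length xs = Suc n then - (F y (tl xs) \<diamondop> hd xs) else 0))"
    unfolding compose_ComDer_outer compose_NovEnd_outer
    by (intro sum.cong refl arg_cong2[where f = "(+)"])
     (simp_all add: alpha_nu_apply cd_der_single1 cd_mul_single cd_mul_single_Nil finite_supp_cd_der cong: if_cong)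
  finally show ?thesis .
qed

text \<open>The exponent \<open>hd x\<close> of the first input differentiates the inserted
  \<open>\<nu>\<close>, whereas identities in the other inputs keep their exponents
  \<open>tl x\<close>.\<close>

lemma inner_eq:
  assumes "F \<in> families (Suc k)" "v \<noteq> (0 :: 'g)"
  shows "inner (Suc k) F = (\<Sum>x\<in>supp F. \<Sum>y\<in>supp \<nu>.
    tensor (smult NovEnd) (cd_mul ((cd_der ^^ hd x) (single y)) (single (tl x)))
      (\<lambda>xs. if length xs = k + 2 then F x (\<nu> y (take 2 xs) # drop 2 xs) else 0))"
proof -
  have "inner (Suc k) F = (\<Sum>x\<in>supp F. \<Sum>y\<in>supp \<nu>. tensor (smult NovEnd)
      (compose ComDer (single x) ((2, single y) # replicate k (1, single [0])))
      (compose NovEnd (F x) ((2, \<nu> y) # replicate k (1, ident NovEnd))))"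
    by (simp add: inner_def compose_NovOp supp_ident_NovOp[OF assms(2)] sum_listset_Cons
        finite_supp_alpha_nu ident_NovOp_apply listset_replicate_singleton
        map2_replicate finite_listset del: listset.simps(2))
  also have "\<dots> = (\<Sum>x\<in>supp F. \<Sum>y\<in>supp \<nu>.
    tensor (smult NovEnd) (cd_mul ((cd_der ^^ hd x) (single y)) (single (tl x)))
      (\<lambda>xs. if length xs = k + 2 then F x (\<nu> y (take 2 xs) # drop 2 xs) else 0))"
  proof (intro sum.cong refl)
    fix x y assume "x \<in> supp F"
    then have "length x = Suc k"
      using families_supp[OF assms(1)] by (auto simp: P_set_def)
    then obtain a x' where x: "x = a # x'" "length x' = k" by (auto simp: length_Suc_conv)
    then show "tensor (smult NovEnd)
        (compose ComDer (single x) ((2, single y) # replicate k (1, single [0])))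
        (compose NovEnd (F x) ((2, \<nu> y) # replicate k (1, ident NovEnd))) =
      tensor (smult NovEnd) (cd_mul ((cd_der ^^ hd x) (single y)) (single (tl x)))
        (\<lambda>xs. if length xs = k + 2 then F x (\<nu> y (take 2 xs) # drop 2 xs) else 0)"
      unfolding compose_NovEnd_inner x(1) compose_ComDer_inner[OF x(2)] by simp
  qed
  finally show ?thesis .
qed

text \<open>Both composites add one input and one derivative, so the total order remains one less
  than the arity.\<close>

lemma supp_outer:
  assumes "y \<in> P_set n"
  shows "supp (single (1 # y) :: _ \<Rightarrow> 'k) \<subseteq> P_set (Suc n)"
    "supp (cd_mul (single [0]) (cd_der (single y)) :: _ \<Rightarrow> 'k) \<subseteq> P_set (Suc n)"
proof -
  show "supp (single (1 # y) :: _ \<Rightarrow> 'k) \<subseteq> P_set (Suc n)"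
    using assms by (simp add: P_set_def)
  have "cd_homogeneous (length [0 :: nat] + length y) (sum_list [0] + Suc (sum_list y))
      (cd_mul (single [0]) (cd_der (single y)) :: _ \<Rightarrow> 'k)"
    by (intro cd_homogeneous_cd_mul cd_homogeneous_cd_der cd_homogeneous_single)
  with assms show "supp (cd_mul (single [0]) (cd_der (single y)) :: _ \<Rightarrow> 'k) \<subseteq> P_set (Suc n)"
    by (auto simp: cd_homogeneous_def P_set_def)
qed

lemma supp_inner:
  assumes "a # x \<in> P_set (Suc k)" "y \<in> supp \<nu>"
  shows "supp (cd_mul ((cd_der ^^ a) (single y)) (single x) :: _ \<Rightarrow> 'k) \<subseteq> P_set (k + 2)"
proof -
  have "cd_homogeneous (length y + length x) ((sum_list y + a) + sum_list x)
      (cd_mul ((cd_der ^^ a) (single y)) (single x) :: _ \<Rightarrow> 'k)"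
    by (intro cd_homogeneous_cd_mul cd_homogeneous_funpow_cd_der cd_homogeneous_single)
  moreover have "length y = 2" "sum_list y = 1"
    using assms(2) supp_alpha_nu by auto
  ultimately show ?thesis
    using assms(1) by (auto simp: cd_homogeneous_def P_set_def)
qed

lemma outer_multilinear:
  assumes "f \<in> multilinear_maps scale n"
  shows "(\<lambda>xs. if length xs = Suc n then hd xs \<diamondop> f (tl xs) else 0) \<in> multilinear_maps scale (Suc n)"
    "(\<lambda>xs. if length xs = Suc n then - (f (tl xs) \<diamondop> hd xs) else 0) \<in> multilinear_maps scale (Suc n)"
proof -
  have f: "f (us @ (x + y) # vs) = f (us @ x # vs) + f (us @ y # vs)"
    "f (us @ scale c x # vs) = scale c (f (us @ x # vs))" for us x y c vs
    using assms by (auto simp: multilinear_maps_iff)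
  show "(\<lambda>xs. if length xs = Suc n then hd xs \<diamondop> f (tl xs) else 0) \<in> multilinear_maps scale (Suc n)"
    unfolding multilinear_maps_iff
    apply (intro conjI allI)
      apply simp
    subgoal for us x y vs
      by (cases us) (simp_all add: nov_add_left nov_add_right f)
    subgoal for us c x vs
      by (cases us) (simp_all add: nov_scale_left nov_scale_right f)
    done
  show "(\<lambda>xs. if length xs = Suc n then - (f (tl xs) \<diamondop> hd xs) else 0) \<in> multilinear_maps scale (Suc n)"
    unfolding multilinear_maps_iff
    apply (intro conjI allI)
      apply simp
    subgoal for us x y vs
      by (cases us) (simp_all add: nov_add_left nov_add_right f)
    subgoal for us c x vs
      by (cases us) (simp_all add: nov_scale_left nov_scale_right f)
    done
qed

lemma inner_multilinear:
  assumes f: "f \<in> multilinear_maps scale (Suc k)" and g: "g \<in> multilinear_maps scale 2"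
  shows "(\<lambda>xs. if length xs = k + 2 then f (g (take 2 xs) # drop 2 xs) else 0)
    \<in> multilinear_maps scale (k + 2)"
proof -
  have lin: "h (us @ (x + y) # vs) = h (us @ x # vs) + h (us @ y # vs)"
    "h (us @ scale c x # vs) = scale c (h (us @ x # vs))"
    if "h \<in> multilinear_maps scale n" for h n us x y c vs
    using that by (auto simp: multilinear_maps_iff)
  note f' = lin[OF f, of "[]", simplified] lin[OF f, of "u # us" for u us, simplified]
  note g' = lin[OF g, of "[]", simplified] lin[OF g, of "[u]" for u, simplified]
  show ?thesis
    unfolding multilinear_maps_iff
    apply (intro conjI allI)
      apply simp
    \<comment> \<open>\<open>remdups_adj.cases\<close> distinguishes prefixes of length 0, 1 and at
      least 2: the varied slot is the first or second input of g, or a later input of f.\<close>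
    subgoal for us x y vs
      by (cases us rule: remdups_adj.cases) (simp_all add: f' g' numeral_2_eq_2)
    subgoal for us c x vs
      by (cases us rule: remdups_adj.cases) (simp_all add: f' g' numeral_2_eq_2)
    done
qed

lemma outer_families:
  assumes "F \<in> families n" "v \<noteq> (0 :: 'g)"
  shows "outer n F \<in> families (Suc n)"
  unfolding outer_eq[OF assms]
proof (intro families_sum families_add families_tensor)
  fix y assume "y \<in> supp F"
  then have y: "y \<in> P_set n" using families_supp[OF assms(1)] by blast
  show "supp (single (1 # y) :: _ \<Rightarrow> 'k) \<subseteq> P_set (Suc n)"
    "supp (cd_mul (single [0]) (cd_der (single y)) :: _ \<Rightarrow> 'k) \<subseteq> P_set (Suc n)"
    by (rule supp_outer[OF y])+
  have "F y \<in> multilinear_maps scale n" using assms(1) by (simp add: families_def)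
  from outer_multilinear[OF this]
  show "(\<lambda>xs. if length xs = Suc n then hd xs \<diamondop> F y (tl xs) else 0) \<in> multilinear_maps scale (Suc n)"
    "(\<lambda>xs. if length xs = Suc n then - (F y (tl xs) \<diamondop> hd xs) else 0) \<in> multilinear_maps scale (Suc n)" .
qed

lemma inner_families:
  assumes "F \<in> families (Suc k)" "v \<noteq> (0 :: 'g)"
  shows "inner (Suc k) F \<in> families (k + 2)"
  unfolding inner_eq[OF assms]
proof (intro families_sum families_tensor)
  fix x y assume x: "x \<in> supp F" and y: "y \<in> supp \<nu>"
  have "x \<in> P_set (Suc k)" using x families_supp[OF assms(1)] by blast
  then have "hd x # tl x \<in> P_set (Suc k)" by (cases x) (auto simp: P_set_def)
  then show "supp (cd_mul ((cd_der ^^ hd x) (single y)) (single (tl x)) :: _ \<Rightarrow> 'k) \<subseteq> P_set (k + 2)"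
    using y by (rule supp_inner)
  show "(\<lambda>xs. if length xs = k + 2 then F x (\<nu> y (take 2 xs) # drop 2 xs) else 0)
    \<in> multilinear_maps scale (k + 2)"
    using assms(1) by (intro inner_multilinear alpha_nu_multilinear) (simp add: families_def)
qed

text \<open>The right-hand side is the constant term of the bracket of X with the series-valued
  extension of F, whose coefficient at t is \<open>slot_sum shift (eval n F)\<close>.\<close>

lemma eval_outer:
  assumes "F \<in> families n" "v \<noteq> (0 :: 'g)" "length Xs = n"
  shows "eval (Suc n) (outer n F) (X # Xs) =
    X 1 \<diamondop> eval n F Xs - slot_sum shift (eval n F) Xs \<diamondop> X 0"
proof -
  have "eval (Suc n) (outer n F) (X # Xs) = (\<Sum>y\<in>supp F. X 1 \<diamondop> F y (coeffs_at y Xs) -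
      (\<Sum>i<n. F y (coeffs_at (y[i := Suc (y ! i)]) Xs) \<diamondop> X 0))"
    unfolding outer_eq[OF assms(1,2)] eval_sum
  proof (rule sum.cong[OF refl])
    fix y assume "y \<in> supp F"
    then have y: "y \<in> P_set n" using families_supp[OF assms(1)] by blast
    then have [simp]: "length y = n" by (simp add: P_set_def)
    show "eval (Suc n) (tensor (smult NovEnd) (single (1 # y))
          (\<lambda>xs. if length xs = Suc n then hd xs \<diamondop> F y (tl xs) else 0) +
        tensor (smult NovEnd) (cd_mul (single [0]) (cd_der (single y)))
          (\<lambda>xs. if length xs = Suc n then - (F y (tl xs) \<diamondop> hd xs) else 0)) (X # Xs) =
      X 1 \<diamondop> F y (coeffs_at y Xs) - (\<Sum>i<n. F y (coeffs_at (y[i := Suc (y ! i)]) Xs) \<diamondop> X 0)"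
      using assms(3)
      by (simp add: eval_add eval_tensor[OF supp_outer(1)[OF y, unfolded One_nat_def]]
        eval_tensor[OF supp_outer(2)[OF y]]
        lin_ext_cd_mul finite_supp_cd_der lin_ext_cd_der sum_negf)
  qed
  also have "\<dots> = X 1 \<diamondop> (\<Sum>y\<in>supp F. F y (coeffs_at y Xs)) -
      (\<Sum>y\<in>supp F. \<Sum>i<n. F y (coeffs_at (y[i := Suc (y ! i)]) Xs)) \<diamondop> X 0"
    by (simp add: sum_subtractf nov_sum_left nov_sum_right)
  also have "(\<Sum>y\<in>supp F. F y (coeffs_at y Xs)) = eval n F Xs"
    by (simp add: eval_supp assms)
  also have "(\<Sum>y\<in>supp F. \<Sum>i<n. F y (coeffs_at (y[i := Suc (y ! i)]) Xs)) =
      slot_sum shift (eval n F) Xs"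
  proof -
    have "F y (coeffs_at (y[i := Suc (y ! i)]) Xs) = F y (coeffs_at y (Xs[i := shift (Xs ! i)]))"
      if "y \<in> supp F" for y i
      using that families_supp[OF assms(1)] assms(3) by (subst coeffs_at_shift) (auto simp: P_set_def)
    then show ?thesis
      by (simp add: slot_sum_def eval_supp assms sum.swap[of _ "supp F"])
  qed
  finally show ?thesis .
qed

text \<open>By the Leibniz rule on both sides: one more \<open>cd_der\<close> shifts X or Y, and so
  does the next coefficient of the bracket. At a = 0 the two exponent lists of \<open>\<nu>\<close>
  give the two terms of the bracket.\<close>

lemma sum_alpha_nu_coeffs_at:
  "(\<Sum>y\<in>supp \<nu>. lin_ext ((cd_der ^^ a) (single y)) (\<lambda>p. \<nu> y (coeffs_at p [X, Y]))) = nov_br X Y a"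
proof -
  have hom: "cd_homogeneous (length y) (sum_list y + a) ((cd_der ^^ a) (single y) :: _ \<Rightarrow> 'k)" for a y
    by (intro cd_homogeneous_funpow_cd_der cd_homogeneous_single)
  have step: "lin_ext ((cd_der ^^ Suc a) (single y)) (\<lambda>p. \<nu> y (coeffs_at p [X, Y])) =
      lin_ext ((cd_der ^^ a) (single y)) (\<lambda>p. \<nu> y (coeffs_at p [shift X, Y])) +
      lin_ext ((cd_der ^^ a) (single y)) (\<lambda>p. \<nu> y (coeffs_at p [X, shift Y]))"
    if "length y = 2" for y a X Y
  proof -
    have "lin_ext ((cd_der ^^ Suc a) (single y)) (\<lambda>p. \<nu> y (coeffs_at p [X, Y])) =
        lin_ext ((cd_der ^^ a) (single y)) (\<lambda>p. \<Sum>i<length p. \<nu> y (coeffs_at (p[i := Suc (p ! i)]) [X, Y]))"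
      using hom[of y a] by (simp add: lin_ext_cd_der cd_homogeneous_def)
    also have "\<dots> = lin_ext ((cd_der ^^ a) (single y))
        (\<lambda>p. \<Sum>i<2. \<nu> y (coeffs_at p ([X, Y][i := shift ([X, Y] ! i)])))"
      using hom[of y a] that by (intro lin_ext_cong) (simp add: cd_homogeneous_def coeffs_at_shift)
    finally show ?thesis
      by (simp add: lin_ext_sum numeral_2_eq_2)
        (simp add: lin_ext_def sum.distrib scale_right_distrib)
  qed
  show ?thesis
  proof (induction a arbitrary: X Y)
    case 0
    have "(\<Sum>y\<in>supp \<nu>. \<nu> y (coeffs_at y [X, Y])) = (\<Sum>y\<in>{[1, 0], [0, 1]}. \<nu> y (coeffs_at y [X, Y]))"
      using supp_alpha_nu by (intro sum.mono_neutral_left) (auto simp: supp_def)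
    also have "\<dots> = X 1 \<diamondop> Y 0 - Y 1 \<diamondop> X 0"
      by (simp add: alpha_nu_apply)
    finally show ?case by (simp add: nov_br_def shift_apply)
  next
    case (Suc a)
    have "length y = 2" if "y \<in> supp \<nu>" for y
      using that supp_alpha_nu by auto
    then have "(\<Sum>y\<in>supp \<nu>. lin_ext ((cd_der ^^ Suc a) (single y)) (\<lambda>p. \<nu> y (coeffs_at p [X, Y]))) =
        nov_br (shift X) Y a + nov_br X (shift Y) a"
      unfolding Suc[symmetric] sum.distrib[symmetric] by (intro sum.cong refl step)
    also have "\<dots> = nov_br X Y (Suc a)"
      using shift_nov_br[of X Y] by (metis plus_fun_apply shift_apply)
    finally show ?case .
  qed
qed

text \<open>For an exponent list with first entry a, F reads coefficient a of its first argument. By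
  \<open>sum_alpha_nu_coeffs_at\<close> the a-fold derivative of \<open>\<nu>\<close> delivers
  exactly that coefficient of the bracket.\<close>

lemma eval_inner:
  assumes "F \<in> families (Suc k)" "v \<noteq> (0 :: 'g)" "length Xs = k"
  shows "eval (k + 2) (inner (Suc k) F) (X # Y # Xs) = eval (Suc k) F (nov_br X Y # Xs)"
proof -
  have "eval (k + 2) (inner (Suc k) F) (X # Y # Xs) =
      (\<Sum>x\<in>supp F. F x (coeffs_at x (nov_br X Y # Xs)))"
    unfolding inner_eq[OF assms(1,2)] eval_sum
  proof (rule sum.cong[OF refl])
    fix x assume "x \<in> supp F"
    then have "x \<in> P_set (Suc k)" using families_supp[OF assms(1)] by blast
    moreover from this obtain a x' where x: "x = a # x'" by (cases x) (auto simp: P_set_def)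
    ultimately have ax: "a # x' \<in> P_set (Suc k)" "length x' = k" by (auto simp: P_set_def)
    have F: "F x \<in> multilinear_maps scale (Suc k)" using assms(1) by (simp add: families_def)
    have "eval (k + 2) (tensor (smult NovEnd) (cd_mul ((cd_der ^^ a) (single y)) (single x'))
        (\<lambda>xs. if length xs = k + 2 then F x (\<nu> y (take 2 xs) # drop 2 xs) else 0)) (X # Y # Xs) =
      lin_ext ((cd_der ^^ a) (single y)) (\<lambda>p. F x (\<nu> y (coeffs_at p [X, Y]) # coeffs_at x' Xs))"
      if y: "y \<in> supp \<nu>" for y
    proof -
      have hom: "cd_homogeneous (length y) (sum_list y + a) ((cd_der ^^ a) (single y) :: _ \<Rightarrow> 'k)"
        by (intro cd_homogeneous_funpow_cd_der cd_homogeneous_single)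
      moreover have "length y = 2" using y supp_alpha_nu by auto
      moreover have "coeffs_at (p @ x') (X # Y # Xs) = coeffs_at p [X, Y] @ coeffs_at x' Xs"
        if "length p = 2" for p
        using that ax(2) assms(3) by (auto simp: numeral_2_eq_2 length_Suc_conv)
      ultimately show ?thesis
        using ax(2) assms(3)
        by (simp add: eval_tensor[OF supp_inner[OF ax(1) y, unfolded add_2_eq_Suc'], unfolded add_2_eq_Suc']
            lin_ext_cd_mul cd_homogeneous_def cong: lin_ext_cong)
    qed
    \<comment> \<open>The factor \<open>scale 1\<close> puts the inner sum into the shape required
      by \<open>multilinear_maps_hd_sum\<close>.\<close>
    then have "(\<Sum>y\<in>supp \<nu>. eval (k + 2) (tensor (smult NovEnd)
          (cd_mul ((cd_der ^^ hd x) (single y)) (single (tl x)))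
          (\<lambda>xs. if length xs = k + 2 then F x (\<nu> y (take 2 xs) # drop 2 xs) else 0)) (X # Y # Xs)) =
        F x ((\<Sum>y\<in>supp \<nu>. scale 1 (lin_ext ((cd_der ^^ a) (single y)) (\<lambda>p. \<nu> y (coeffs_at p [X, Y])))) # coeffs_at x' Xs)"
      unfolding multilinear_maps_hd_sum[OF F] by (simp add: x multilinear_maps_hd_lin_ext[OF F, unfolded x])
    also have "\<dots> = F x (coeffs_at x (nov_br X Y # Xs))"
      by (simp add: sum_alpha_nu_coeffs_at) (simp add: x)
    finally show "(\<Sum>y\<in>supp \<nu>. eval (k + 2) (tensor (smult NovEnd)
          (cd_mul ((cd_der ^^ hd x) (single y)) (single (tl x)))
          (\<lambda>xs. if length xs = k + 2 then F x (\<nu> y (take 2 xs) # drop 2 xs) else 0)) (X # Y # Xs)) =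
        F x (coeffs_at x (nov_br X Y # Xs))" .
  qed
  then show ?thesis by (simp add: eval_supp assms)
qed

end


section \<open>The differential on the operadic complex\<close>

lemma slot_sum_apply: "slot_sum \<theta> c xs m = slot_sum \<theta> (\<lambda>ys. c ys m) xs"
  by (simp add: slot_sum_def sum_apply)

lemma alt_zero [simp]: "alt i 0 = 0"
  by (simp add: alt_def)

lemma alt_apply: "alt i v m = alt i (v m)"
  by (simp add: alt_def)

lemma (in lie_ring) lie_d_add: "lie_d (\<lambda>ys. c ys + c' ys) xs = lie_d c xs + lie_d c' xs"
  using lie_d_diff[of c "\<lambda>ys. - c' ys" xs] by (simp add: lie_d_uminus)

lemma permute_list_adjacent:
  "permute_list (transpose (length us) (Suc (length us))) (us @ x # y # vs) = us @ y # x # vs"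
proof (rule nth_equalityI)
  fix i assume "i < length (permute_list (transpose (length us) (Suc (length us))) (us @ x # y # vs))"
  then have i: "i < length us + Suc (Suc (length vs))" by simp
  consider "i < length us" | "i = length us" | "i = Suc (length us)" |
    k where "i = length us + Suc (Suc k)"
    by (metis less_imp_Suc_add linorder_neqE_nat add_Suc_right not_less_eq Suc_lessI)
  moreover have "transpose (length us) (Suc (length us)) permutes {..<length (us @ x # y # vs)}"
    by (intro permutes_swap_id) auto
  ultimately show "permute_list (transpose (length us) (Suc (length us))) (us @ x # y # vs) ! i =
      (us @ y # x # vs) ! i"
    using i by cases (simp_all add: permute_list_nth nth_append transpose_def)
qed simp

context novikov_algebra
begin

lemma alt_scale: "scale ((- 1) ^ i) v = alt i v"
  by (simp add: alt_def)

text \<open>The permutations obeying the sign rule (\<open>Q\<close>) are closed under composition.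
  They contain adjacent swaps, hence all transpositions, hence everything.\<close>

lemma skew_permute:
  fixes e :: "'x list \<Rightarrow> 'g"
  assumes "skew e" "\<pi> permutes {..<n}" "length xs = n"
  shows "e (permute_list \<pi> xs) = scale (of_int (sign \<pi>)) (e xs)"
proof -
  define Q where "Q \<pi> \<longleftrightarrow> \<pi> permutes {..<n} \<and>
    (\<forall>xs. length xs = n \<longrightarrow> e (permute_list \<pi> xs) = scale (of_int (sign \<pi>)) (e xs))" for \<pi>
  have comp: "Q (p \<circ> q)" if p: "Q p" and q: "Q q" for p q
  proof -
    have "permutation p" "permutation q"
      using p q by (auto simp: Q_def permutation_permutes)
    then show ?thesis
      using p q by (auto simp: Q_def permutes_compose permute_list_compose sign_compose mult.commute)
  qed
  have adjacent: "Q (transpose i (Suc i))" if "Suc i < n" for i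
    unfolding Q_def
  proof (intro conjI allI impI)
    show "transpose i (Suc i) permutes {..<n}"
      using that by (intro permutes_swap_id) auto
    fix xs :: "'x list" assume l: "length xs = n"
    define us x y vs where "us = take i xs" and "x = xs ! i" and "y = xs ! Suc i"
      and "vs = drop (Suc (Suc i)) xs"
    have "xs = us @ x # y # vs" "length us = i"
      using that l by (simp_all add: us_def x_def y_def vs_def Cons_nth_drop_Suc)
    then show "e (permute_list (transpose i (Suc i)) xs) =
        scale (of_int (sign (transpose i (Suc i)))) (e xs)"
      using skewD[OF assms(1), of us y x vs] permute_list_adjacent[of us x y vs]
      by (simp add: sign_swap_id)
  qed
  have less: "Q (transpose a (Suc (a + d)))" if "Suc (a + d) < n" for a d
    using that
  proof (induction d)
    case 0
    then show ?case using adjacent[of a] by simp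
  next
    case (Suc d)
    let ?b = "Suc (a + d)"
    \<comment> \<open>Conjugation by an adjacent swap moves the upper index of a transposition one
      step further.\<close>
    have "transpose a (Suc (a + Suc d)) =
        transpose ?b (Suc ?b) \<circ> (transpose a ?b \<circ> transpose ?b (Suc ?b))"
      by (auto simp: fun_eq_iff transpose_def)
    moreover have "Q (transpose ?b (Suc ?b))" "Q (transpose a ?b)"
      using Suc adjacent[of ?b] by auto
    ultimately show ?case by (simp only: comp)
  qed
  have swap: "Q (transpose a b)" if "a < n" "b < n" "a \<noteq> b" for a b
  proof (cases "a < b")
    case True
    then show ?thesis using less[of a "b - Suc a"] that by simp
  next
    case False
    then show ?thesis using less[of b "a - Suc b"] that by (simp add: transpose_commute)
  qed
  have "Q \<pi>"
    using assms(2) finite_lessThan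
  proof (induction rule: permutes_induct)
    case (swap a b p)
    then show ?case using \<open>\<And>a b. _ \<Longrightarrow> _ \<Longrightarrow> _ \<Longrightarrow> Q (transpose a b)\<close> by (intro comp) auto
  qed (simp_all add: Q_def permutes_id[unfolded id_def])
  with assms(3) show ?thesis by (simp add: Q_def)
qed

text \<open>The extension of \<open>eval n F\<close> to the unique \<open>\<gg>[[t]]\<close>-valued map commuting with \<open>d/dt\<close>.\<close>

definition hat :: "nat \<Rightarrow> (nat list \<Rightarrow> 'g list \<Rightarrow> 'g) \<Rightarrow> (nat \<Rightarrow> 'g) list \<Rightarrow> nat \<Rightarrow> 'g" where
  "hat n F Xs m = (slot_sum shift ^^ m) (eval n F) Xs"

lemma hat_0: "hat n F Xs 0 = eval n F Xs"
  by (simp add: hat_def)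

lemma hat_Suc: "hat n F Xs (Suc m) = slot_sum shift (\<lambda>Ys. hat n F Ys m) Xs"
  by (simp add: hat_def)

lemma lie_der_hat: "lie_der shift (hat n F) = (\<lambda>_. 0)"
  by (auto simp: fun_eq_iff lie_der_def hat_Suc slot_sum_apply shift_apply)

text \<open>A vanishing Lie derivative along \<open>shift\<close> expresses coefficient m + 1
  through coefficients m at differentiated arguments, so the constant term determines
  everything.\<close>

lemma hat_unique:
  assumes "\<And>Xs. lie_der shift C Xs = 0" "\<And>Xs. C Xs 0 = eval n F Xs"
  shows "C = hat n F"
proof (intro ext)
  fix Xs m
  have Suc: "C Xs (Suc m) = slot_sum shift (\<lambda>Ys. C Ys m) Xs" for Xs m
    using fun_cong[OF assms(1)[of Xs], of m] by (simp add: lie_der_def slot_sum_apply shift_apply)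
  show "C Xs m = hat n F Xs m"
    by (induction m arbitrary: Xs) (simp_all add: assms(2) hat_0 Suc hat_Suc)
qed

lemma hat_length: "length Xs \<noteq> n \<Longrightarrow> hat n F Xs = 0"
proof
  fix m show "length Xs \<noteq> n \<Longrightarrow> hat n F Xs m = 0 m"
    by (induction m arbitrary: Xs) (simp_all add: hat_0 hat_Suc eval_length slot_sum_def)
qed

lemma multi_additive_hat:
  assumes "F \<in> families n"
  shows "multi_additive (hat n F)"
proof -
  have "multi_additive ((slot_sum shift ^^ m) (eval n F))" for m
    by (induction m) (simp_all add: multi_additive_eval assms multi_additive_slot_sum additive_shift)
  then show ?thesis by (simp add: multi_additive_def hat_def fun_eq_iff)
qed

lemma skew_hat:
  assumes "skew (eval n F)"
  shows "skew (hat n F)"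
proof (intro skewI ext)
  fix us x y vs m
  have "skew ((slot_sum shift ^^ m) (eval n F))"
    by (induction m) (simp_all add: assms skew_slot_sum)
  then show "hat n F (us @ x # y # vs) m = (- hat n F (us @ y # x # vs)) m"
    unfolding hat_def fun_Compl_def by (rule skewD)
qed

lemma mem_CE_iff: "F \<in> CE NovOp n \<longleftrightarrow> F \<in> families n \<and>
    (\<forall>\<sigma>. \<sigma> permutes {..<n} \<longrightarrow> act NovOp \<sigma> F = fam_scale scale (of_int (sign \<sigma>)) F)"
  by (simp add: CE_def arity_space_NovOp smult_NovOp)

lemma skew_eval:
  assumes "F \<in> CE NovOp n"
  shows "skew (eval n F)"
proof (rule skewI)
  fix us vs and x y :: "nat \<Rightarrow> 'g"
  show "eval n F (us @ x # y # vs) = - eval n F (us @ y # x # vs)"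
  proof (cases "n = Suc (Suc (length us + length vs))")
    case True
    let ?\<sigma> = "transpose (length us) (Suc (length us))"
    have perm: "?\<sigma> permutes {..<n}"
      using True by (intro permutes_swap_id) auto
    have "eval n (act NovOp ?\<sigma> F) (us @ y # x # vs) = - eval n F (us @ y # x # vs)"
      using assms perm by (simp add: mem_CE_iff eval_scale sign_swap_id)
    then show ?thesis
      using assms eval_act[OF _ perm, of F "us @ y # x # vs"] permute_list_adjacent[of us y x vs]
      by (simp add: mem_CE_iff)
  qed (simp add: eval_length)
qed

text \<open>Converse of \<open>skew_eval\<close>: by \<open>eval_inject\<close> the sign rule needs
  checking only after evaluation, where \<open>skew_permute\<close> supplies it.\<close>

lemma CE_I:
  assumes "F \<in> families n" "skew (eval n F)"
  shows "F \<in> CE NovOp n"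
proof -
  have "act NovOp \<sigma> F = fam_scale scale (of_int (sign \<sigma>)) F" if \<sigma>: "\<sigma> permutes {..<n}" for \<sigma>
  proof (rule eval_inject)
    show "act NovOp \<sigma> F \<in> families n" "fam_scale scale (of_int (sign \<sigma>)) F \<in> families n"
      using assms(1) \<sigma> by (simp_all add: act_families families_scale)
    fix Xs :: "(nat \<Rightarrow> 'g) list" assume "length Xs = n"
    moreover have "sign (inv \<sigma>) = sign \<sigma>"
      using \<sigma> by (intro sign_inverse) (auto simp: permutation_permutes)
    ultimately show "eval n (act NovOp \<sigma> F) Xs = eval n (fam_scale scale (of_int (sign \<sigma>)) F) Xs"
      using skew_permute[OF assms(2) permutes_inv[OF \<sigma>], of Xs]
      by (simp add: eval_act[OF assms(1) \<sigma>] eval_scale)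
  qed
  with assms(1) show ?thesis by (simp add: mem_CE_iff)
qed

lemma d_CE_eq: "d_CE NovOp \<nu> n F =
    (\<Sum>\<sigma>\<in>Sh_inv 1 n. fam_scale scale (of_int (sign \<sigma>)) (act NovOp \<sigma> (outer n F))) -
    (\<Sum>\<sigma>\<in>Sh_inv 2 (n - 1). fam_scale scale (of_int (sign \<sigma>)) (act NovOp \<sigma> (inner n F)))"
  by (simp add: d_CE_def smult_NovOp outer_def inner_def)

context
  fixes v :: 'g and n :: nat
  assumes nontrivial: "v \<noteq> 0" and n: "n \<ge> 1"
begin

lemma inner_families': "F \<in> families n \<Longrightarrow> inner n F \<in> families (Suc n)"
  using inner_families[OF _ nontrivial, of F "n - 1"] n by simp

lemma Sh_inv_permutes:
  "\<sigma> \<in> Sh_inv 1 n \<Longrightarrow> \<sigma> permutes {..<Suc n}" "\<sigma> \<in> Sh_inv 2 (n - 1) \<Longrightarrow> \<sigma> permutes {..<Suc n}"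
  using n by (auto simp: Sh_inv_def)

lemma d_CE_families:
  assumes "F \<in> families n"
  shows "d_CE NovOp \<nu> n F \<in> families (Suc n)"
  unfolding d_CE_eq
  by (intro families_diff families_sum families_scale act_families)
    (simp_all only: outer_families[OF assms nontrivial] inner_families'[OF assms] Sh_inv_permutes)

text \<open>The two shuffle sums match the two sums of \<open>lie_d_expand\<close> term by term,
  through \<open>eval_outer\<close> and \<open>eval_inner\<close>. The right-hand side needs
  \<open>hat\<close>, because the bracket differentiates the value of the cochain.\<close>

lemma eval_d_CE:
  assumes F: "F \<in> CE NovOp n"
  shows "eval (Suc n) (d_CE NovOp \<nu> n F) Xs = lie_d (hat n F) Xs 0"
proof -
  have fam: "F \<in> families n" using F by (simp add: mem_CE_iff)
  have skew: "skew (hat n F)" using F by (intro skew_hat skew_eval)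
  have br_0: "nov_br X 0 = 0" for X
    using additive.zero[OF additive_br] .
  show ?thesis
  proof (cases "length Xs = Suc n")
    case False
    \<comment> \<open>On lists of the wrong length each term contains \<open>hat\<close> at a wrong
      length and is 0, in agreement with \<open>eval\<close>.\<close>
    have "nov_br (Xs ! i) (hat n F (remove_nth i Xs)) = 0" if "i < length Xs" for i
      using False that by (subst hat_length) (auto simp: length_remove_nth br_0)
    moreover have "hat n F (X # remove_nth i (remove_nth j Xs)) = 0" if "i < j" "j < length Xs" for i j X
      using False that by (subst hat_length) (auto simp: length_remove_nth)
    ultimately have "lie_d (hat n F) Xs = 0"
      unfolding lie_d_expand[OF skew] by (simp del: alt_Suc)
    with False show ?thesis by (simp add: eval_length)
  next
    case True
    have outer: "eval (Suc n) (outer n F) (Xs ! i # remove_nth i Xs) =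
        nov_br (Xs ! i) (hat n F (remove_nth i Xs)) 0" if "i < Suc n" for i
      using that True
      by (simp add: eval_outer[OF fam nontrivial] length_remove_nth nov_br_def hat_0 hat_Suc shift_apply)
    have inner: "eval (Suc n) (inner n F) (Xs ! i # Xs ! j # remove_nth i (remove_nth j Xs)) =
        hat n F (nov_br (Xs ! i) (Xs ! j) # remove_nth i (remove_nth j Xs)) 0" if "i < j" "j < Suc n" for i j
      using that True n eval_inner[OF _ nontrivial, of F "n - 1" "remove_nth i (remove_nth j Xs)"] fam
      by (simp add: length_remove_nth hat_0)
    have "eval (Suc n) (d_CE NovOp \<nu> n F) Xs =
        (\<Sum>\<sigma>\<in>Sh_inv 1 n. scale (of_int (sign \<sigma>)) (eval (Suc n) (outer n F) (permute_list (inv \<sigma>) Xs))) -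
        (\<Sum>\<sigma>\<in>Sh_inv 2 (n - 1). scale (of_int (sign \<sigma>)) (eval (Suc n) (inner n F) (permute_list (inv \<sigma>) Xs)))"
      by (simp add: d_CE_eq eval_diff eval_sum eval_scale Sh_inv_permutes
          eval_act[OF outer_families[OF fam nontrivial]] eval_act[OF inner_families'[OF fam]])
    also have "(\<Sum>\<sigma>\<in>Sh_inv 1 n. scale (of_int (sign \<sigma>)) (eval (Suc n) (outer n F) (permute_list (inv \<sigma>) Xs))) =
        (\<Sum>i<Suc n. alt i (nov_br (Xs ! i) (hat n F (remove_nth i Xs)) 0))"
      unfolding sum_Sh_inv_1[where G = "\<lambda>s \<tau>. scale (of_int s) (eval (Suc n) (outer n F) (permute_list \<tau> Xs))"]
      using True by (intro sum.cong) (simp_all add: permute_list_front_cycle outer alt_scale)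
    also have "(\<Sum>\<sigma>\<in>Sh_inv 2 (n - 1). scale (of_int (sign \<sigma>)) (eval (Suc n) (inner n F) (permute_list (inv \<sigma>) Xs))) =
        (\<Sum>j<n - 1 + 2. \<Sum>i<j. alt (Suc (i + j))
          (hat n F (nov_br (Xs ! i) (Xs ! j) # remove_nth i (remove_nth j Xs)) 0))"
      unfolding sum_Sh_inv_2[where G = "\<lambda>s \<tau>. scale (of_int s) (eval (Suc n) (inner n F) (permute_list \<tau> Xs))"]
    proof (intro sum.cong refl)
      fix i j assume "j \<in> {..<n - 1 + 2}" "i \<in> {..<j}"
      then have ij: "i < j" "j < Suc n" using n by auto
      then show "scale (of_int ((- 1) ^ Suc (i + j)))
          (eval (Suc n) (inner n F) (permute_list (front_cycle j \<circ> front_cycle (Suc i)) Xs)) =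
        alt (Suc (i + j)) (hat n F (nov_br (Xs ! i) (Xs ! j) # remove_nth i (remove_nth j Xs)) 0)"
        using True alt_scale[of "Suc (i + j)"]
        by (simp add: permute_list_front_cycle2 inner del: alt_Suc)
    qed
    also have "n - 1 + 2 = Suc n" using n by simp
    finally show ?thesis
      by (simp add: lie_d_expand[OF skew] True sum_apply alt_apply del: alt_Suc sum.lessThan_Suc)
  qed
qed

text \<open>The differential of a map commuting with \<open>shift\<close> again commutes with
  \<open>shift\<close>, so by \<open>hat_unique\<close> it is the extension of its own constant
  term.\<close>

lemma hat_d_CE:
  assumes "F \<in> CE NovOp n"
  shows "hat (Suc n) (d_CE NovOp \<nu> n F) = lie_d (hat n F)"
proof (rule hat_unique[symmetric])
  have "multi_additive (hat n F)"
    using assms by (intro multi_additive_hat) (simp add: mem_CE_iff)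
  then show "lie_der shift (lie_d (hat n F)) Xs = 0" for Xs
    by (simp add: lie_der_lie_d additive_shift shift_nov_br lie_der_hat lie_d_zero)
qed (simp add: eval_d_CE[OF assms])

lemma d_CE_in_CE:
  assumes F: "F \<in> CE NovOp n"
  shows "d_CE NovOp \<nu> n F \<in> CE NovOp (Suc n)"
proof (rule CE_I)
  have fam: "F \<in> families n" using F by (simp add: mem_CE_iff)
  then show "d_CE NovOp \<nu> n F \<in> families (Suc n)" by (rule d_CE_families)
  have "skew (lie_d (hat n F))"
    by (intro skew_lie_d skew_hat skew_eval multi_additive_hat F fam)
  then show "skew (eval (Suc n) (d_CE NovOp \<nu> n F))"
    unfolding skew_def eval_d_CE[OF F] by (metis fun_Compl_def)
qed

end

text \<open>By \<open>hat_d_CE\<close> the comparison applies a second time, and the evaluation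
  becomes the constant term of a squared \<open>lie_d\<close>.\<close>

lemma d_CE_d_CE:
  assumes "v \<noteq> (0 :: 'g)" "n \<ge> 1" "F \<in> CE NovOp n"
  shows "d_CE NovOp \<nu> (Suc n) (d_CE NovOp \<nu> n F) = 0"
proof (rule eval_inject)
  have dF: "d_CE NovOp \<nu> n F \<in> CE NovOp (Suc n)"
    using assms by (rule d_CE_in_CE)
  then show "d_CE NovOp \<nu> (Suc n) (d_CE NovOp \<nu> n F) \<in> families (Suc (Suc n))"
    using d_CE_families[OF assms(1)] by (simp add: mem_CE_iff)
  have "multi_additive (hat n F)"
    using assms(3) by (intro multi_additive_hat) (simp add: mem_CE_iff)
  then show "eval (Suc (Suc n)) (d_CE NovOp \<nu> (Suc n) (d_CE NovOp \<nu> n F)) Xs = eval (Suc (Suc n)) 0 Xs" for Xs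
    using eval_d_CE[OF assms(1) _ dF] by (simp add: hat_d_CE[OF assms] lie_d_lie_d eval_def)
qed (rule families_zero)

section \<open>Linearity of the operadic differential\<close>

lemma CE_add: "F \<in> CE NovOp n \<Longrightarrow> G \<in> CE NovOp n \<Longrightarrow> F + G \<in> CE NovOp n"
proof (rule CE_I)
  assume *: "F \<in> CE NovOp n" "G \<in> CE NovOp n"
  then show "F + G \<in> families n" by (simp add: mem_CE_iff families_add)
  show "skew (eval n (F + G))"
  proof (rule skewI)
    fix us x y vs
    show "eval n (F + G) (us @ x # y # vs) = - eval n (F + G) (us @ y # x # vs)"
      by (simp add: eval_add skewD[OF skew_eval[OF *(1)], of us x y vs]
        skewD[OF skew_eval[OF *(2)], of us x y vs])
  qed
qed

lemma CE_scale: "F \<in> CE NovOp n \<Longrightarrow> fam_scale scale c F \<in> CE NovOp n"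
proof (rule CE_I)
  assume *: "F \<in> CE NovOp n"
  then show "fam_scale scale c F \<in> families n" by (simp add: mem_CE_iff families_scale)
  show "skew (eval n (fam_scale scale c F))"
  proof (rule skewI)
    fix us x y vs
    show "eval n (fam_scale scale c F) (us @ x # y # vs) = - eval n (fam_scale scale c F) (us @ y # x # vs)"
      by (simp add: eval_scale skewD[OF skew_eval[OF *], of us x y vs])
  qed
qed

text \<open>The supports of F, G and F + G differ, so the sums defining the composites cannot be
  compared directly. Under \<open>eval\<close> only additivity of F \<mapsto> \<open>hat n F\<close>
  and of \<open>lie_d\<close> is needed.\<close>

lemma d_CE_add:
  assumes "v \<noteq> (0 :: 'g)" "n \<ge> 1" "F \<in> CE NovOp n" "G \<in> CE NovOp n"
  shows "d_CE NovOp \<nu> n (F + G) = d_CE NovOp \<nu> n F + d_CE NovOp \<nu> n G"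
proof (rule eval_inject)
  have FG: "F + G \<in> CE NovOp n" using assms(3,4) by (rule CE_add)
  with assms show "d_CE NovOp \<nu> n (F + G) \<in> families (Suc n)"
    "d_CE NovOp \<nu> n F + d_CE NovOp \<nu> n G \<in> families (Suc n)"
    by (auto simp: mem_CE_iff intro!: d_CE_families families_add)
  have "hat n F Xs + hat n G Xs = hat n (F + G) Xs" for Xs
  proof
    fix m show "(hat n F Xs + hat n G Xs) m = hat n (F + G) Xs m"
      by (induction m arbitrary: Xs) (simp_all add: hat_0 eval_add hat_Suc slot_sum_add[symmetric])
  qed
  then have "hat n (F + G) = (\<lambda>Xs. hat n F Xs + hat n G Xs)" by auto
  then show "eval (Suc n) (d_CE NovOp \<nu> n (F + G)) Xs =
      eval (Suc n) (d_CE NovOp \<nu> n F + d_CE NovOp \<nu> n G) Xs" for Xs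
    by (simp add: eval_d_CE[OF assms(1,2)] FG assms(3,4) eval_add lie_d_add)
qed

lemma lie_d_ser_scale: "lie_d (\<lambda>Xs. ser_scale a (C Xs)) Xs = ser_scale a (lie_d C Xs)"
proof (induction Xs arbitrary: C)
  case Nil
  then show ?case by (simp add: ser_scale_def fun_eq_iff)
next
  case (Cons X Xs)
  have "nov_br X (ser_scale a Y) = ser_scale a (nov_br X Y)" for Y
    by (simp add: nov_br_def shift_ser_scale hurwitz_scale_left hurwitz_scale_right)
      (simp add: ser_scale_def fun_eq_iff scale_right_diff_distrib)
  moreover have "slot_sum \<theta> (\<lambda>Xs. ser_scale a (C Xs)) Xs = ser_scale a (slot_sum \<theta> C Xs)" for \<theta> C
    by (simp add: slot_sum_def ser_scale_def fun_eq_iff sum_apply scale_sum_right)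
  ultimately show ?case
    using Cons.IH by (simp add: lie_der_def) (simp add: ser_scale_def fun_eq_iff
      scale_right_diff_distrib scale_right_distrib)
qed

lemma d_CE_scale:
  assumes "v \<noteq> (0 :: 'g)" "n \<ge> 1" "F \<in> CE NovOp n"
  shows "d_CE NovOp \<nu> n (fam_scale scale c F) = fam_scale scale c (d_CE NovOp \<nu> n F)"
proof (rule eval_inject)
  have cF: "fam_scale scale c F \<in> CE NovOp n" using assms(3) by (rule CE_scale)
  with assms show "d_CE NovOp \<nu> n (fam_scale scale c F) \<in> families (Suc n)"
    "fam_scale scale c (d_CE NovOp \<nu> n F) \<in> families (Suc n)"
    by (auto simp: mem_CE_iff intro!: d_CE_families families_scale)
  have "ser_scale c (hat n F Xs) = hat n (fam_scale scale c F) Xs" for Xs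
  proof
    fix m show "ser_scale c (hat n F Xs) m = hat n (fam_scale scale c F) Xs m"
      by (induction m arbitrary: Xs)
        (simp_all add: ser_scale_def hat_0 eval_scale hat_Suc slot_sum_def scale_sum_right)
  qed
  then have "hat n (fam_scale scale c F) = (\<lambda>Xs. ser_scale c (hat n F Xs))" by auto
  then show "eval (Suc n) (d_CE NovOp \<nu> n (fam_scale scale c F)) Xs =
      eval (Suc n) (fam_scale scale c (d_CE NovOp \<nu> n F)) Xs" for Xs
    by (simp add: eval_d_CE[OF assms(1,2)] cF assms(3) eval_scale lie_d_ser_scale) (simp add: ser_scale_def)
qed

end


section \<open>The reduced index sets\<close>

text \<open>Every permutation preserving g is a product of transpositions preserving g. If a is
  moved, then g agrees at a and \<pi> a; composing with their transposition fixes a and moves no new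
  point, so the number of moved points drops.\<close>

lemma permutes_stabiliser_induct [consumes 3, case_names id swap]:
  assumes "\<pi> permutes S" "finite S" "\<And>i. g (\<pi> i) = g i"
    and "P id"
    and "\<And>a b p. a \<in> S \<Longrightarrow> b \<in> S \<Longrightarrow> a \<noteq> b \<Longrightarrow> g a = g b \<Longrightarrow> p permutes S \<Longrightarrow> P p \<Longrightarrow>
      P (transpose a b \<circ> p)"
  shows "P \<pi>"
  using assms(1,3)
proof (induction "card {i. \<pi> i \<noteq> i}" arbitrary: \<pi> rule: less_induct)
  case less
  show ?case
  proof (cases "\<pi> = id")
    case True
    with assms(4) show ?thesis by simp
  next
    case False
    then obtain a where a: "\<pi> a \<noteq> a" by (auto simp: fun_eq_iff)
    let ?b = "\<pi> a"
    let ?p = "transpose a ?b \<circ> \<pi>"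
    have ab: "a \<in> S" "?b \<in> S"
      using a less.prems(1) by (metis permutes_not_in, metis permutes_in_image permutes_not_in)
    then have p: "?p permutes S"
      using less.prems(1) by (intro permutes_compose permutes_swap_id) auto
    have "\<pi> i \<noteq> i" if "?p i \<noteq> i" for i
    proof
      assume "\<pi> i = i"
      with that have "i = a \<or> i = ?b" by (auto simp: transpose_def split: if_splits)
      with a \<open>\<pi> i = i\<close> permutes_inj[OF less.prems(1)] show False by (auto dest: injD)
    qed
    moreover have "?p a = a" by simp
    ultimately have "{i. ?p i \<noteq> i} \<subset> {i. \<pi> i \<noteq> i}" using a by blast
    moreover have "finite {i. \<pi> i \<noteq> i}"
      using assms(2) by (rule finite_subset[rotated]) (use less.prems(1) in \<open>auto simp: permutes_def\<close>)
    ultimately have "card {i. ?p i \<noteq> i} < card {i. \<pi> i \<noteq> i}" by (rule psubset_card_mono[rotated])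
    moreover have "g (transpose a ?b i) = g i" for i
      using less.prems(2)[of a] by (auto simp: transpose_def)
    then have "g (?p i) = g i" for i
      by (simp add: less.prems(2))
    ultimately have "P ?p" using p less.hyps by blast
    then have "P (transpose a ?b \<circ> ?p)"
      by (intro assms(5)[OF ab _ _ p]) (use a less.prems(2)[of a] in auto)
    moreover have "transpose a ?b \<circ> ?p = \<pi>"
      by (simp add: fun_eq_iff)
    ultimately show ?thesis by simp
  qed
qed

text \<open>The list with c j copies of each j < n, largest first. With multiplicities taken from
  \<open>K_set\<close> this is the inverse of \<open>phi\<close>.\<close>

definition descending :: "nat \<Rightarrow> (nat \<Rightarrow> nat) \<Rightarrow> nat list" where
  "descending n c = concat (map2 replicate (map c (rev [0..<n])) (rev [0..<n]))"

lemma descending_Suc: "descending (Suc n) c = replicate (c n) n @ descending n c"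
  by (simp add: descending_def)

lemma count_list_replicate: "count_list (replicate m x) y = (if x = y then m else 0)"
  by (induction m) auto

lemma descending_props:
  "count_list (descending n c) j = (if j < n then c j else 0)"
  "length (descending n c) = (\<Sum>j<n. c j)"
  "sum_list (descending n c) = (\<Sum>j<n. j * c j)"
  "set (descending n c) \<subseteq> {..<n}"
  "sorted_wrt (\<ge>) (descending n c)"
proof (induction n)
  case 0
  { case 1 show ?case by (simp add: descending_def) }
  { case 2 show ?case by (simp add: descending_def) }
  { case 3 show ?case by (simp add: descending_def) }
  { case 4 show ?case by (simp add: descending_def) }
  { case 5 show ?case by (simp add: descending_def) }
next
  case (Suc n)
  { case 1 show ?case using Suc by (auto simp: descending_Suc count_list_replicate less_Suc_eq) }
  { case 2 show ?case using Suc by (simp add: descending_Suc) }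
  { case 3 show ?case using Suc by (simp add: descending_Suc sum_list_replicate) }
  { case 4 show ?case using Suc by (auto simp: descending_Suc) }
  { case 5
    have "sorted_wrt (\<ge>) (replicate (c n) n)" by (simp add: sorted_wrt_iff_nth_less)
    then show ?case using Suc by (auto simp: descending_Suc sorted_wrt_append) }
qed

lemma sorted_desc_unique:
  fixes p q :: "nat list"
  assumes "sorted_wrt (\<ge>) p" "sorted_wrt (\<ge>) q" "mset p = mset q"
  shows "p = q"
proof -
  have "sorted (rev p)" "sorted (rev q)"
    using assms(1,2) by (simp_all add: sorted_wrt_rev)
  then have "rev p = rev q"
    using assms(3) by (metis mset_rev properties_for_sort)
  then show ?thesis by simp
qed

lemma P_set_less: "p \<in> P_set n \<Longrightarrow> x \<in> set p \<Longrightarrow> x < n"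
  using member_le_sum_list[of x p] by (auto simp: P_set_def)

lemma descending_count_list:
  assumes "p \<in> P_ord n"
  shows "descending n (count_list p) = p"
proof (rule sorted_desc_unique)
  show "mset (descending n (count_list p)) = mset p"
  proof (rule multiset_eqI)
    fix j show "count (mset (descending n (count_list p))) j = count (mset p) j"
      using assms P_set_less[of p n j]
      by (auto simp: P_ord_def descending_props count_list_0_iff count_mset)
  qed
qed (use assms in \<open>auto simp: P_ord_def descending_props\<close>)

lemma phi_eq:
  assumes "length p = n"
  shows "phi n p = map (count_list p) (rev [0..<n])"
proof -
  have "card {i. i < n \<and> p ! i = j} = count_list p j" for j
    using assms by (simp add: count_list_eq_length_filter length_filter_conv_card eq_commute[of j])
  then show ?thesis by (simp add: phi_def)
qed

lemma bij_betw_phi: "bij_betw (phi n) (P_ord n) (K_set n)"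
proof (rule bij_betwI[where g = "\<lambda>k. descending n (\<lambda>j. k ! (n - 1 - j))"])
  have len: "length p = n" if "p \<in> P_ord n" for p
    using that by (simp add: P_ord_def P_set_def)
  show "phi n \<in> P_ord n \<rightarrow> K_set n"
  proof
    fix p assume p: "p \<in> P_ord n"
    have "(\<Sum>i<n. count_list p i) = n" "(\<Sum>i<n. i * count_list p i) + 1 = n"
      using descending_props(2,3)[of n "count_list p"] p
      by (simp_all add: descending_count_list P_ord_def P_set_def)
    then show "phi n p \<in> K_set n"
      by (simp add: phi_eq len p K_set_def rev_nth cong: sum.cong_simp)
  qed
  show "(\<lambda>k. descending n (\<lambda>j. k ! (n - 1 - j))) \<in> K_set n \<rightarrow> P_ord n"
    by (auto simp: K_set_def P_ord_def P_set_def descending_props)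
  show "descending n (\<lambda>j. phi n p ! (n - 1 - j)) = p" if "p \<in> P_ord n" for p
  proof -
    have "descending n (\<lambda>j. phi n p ! (n - 1 - j)) = descending n (count_list p)"
      unfolding descending_def phi_eq[OF len[OF that]]
      by (intro arg_cong[where f = concat] arg_cong2[where f = "map2 replicate"] map_cong refl)
        (auto simp: rev_nth)
    with that show ?thesis by (simp add: descending_count_list)
  qed
  show "phi n (descending n (\<lambda>j. k ! (n - 1 - j))) = k" if "k \<in> K_set n" for k
    using that
    by (subst phi_eq) (auto simp: K_set_def descending_props intro!: nth_equalityI simp: rev_nth)
qed

lemma nth_concat_replicate:
  assumes "length ms = length as" "b < length ms"
    "sum_list (take b ms) \<le> i" "i < sum_list (take (Suc b) ms)"
  shows "concat (map2 replicate ms as) ! i = as ! b"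
  using assms
proof (induction ms as arbitrary: b i rule: list_induct2)
  case (Cons m ms a as)
  then show ?case
    by (cases b) (auto simp: nth_append)
qed simp

lemma sum_list_take_block:
  fixes ms :: "nat list"
  assumes "i < sum_list ms"
  obtains b where "b < length ms" "sum_list (take b ms) \<le> i" "i < sum_list (take (Suc b) ms)"
  using assms
proof (induction ms arbitrary: i thesis)
  case (Cons m ms)
  show ?case
  proof (cases "i < m")
    case True
    then show ?thesis using Cons.prems(1)[of 0] by simp
  next
    case False
    with Cons.prems(2) have "i - m < sum_list ms" by simp
    then obtain b where "b < length ms" "sum_list (take b ms) \<le> i - m" "i - m < sum_list (take (Suc b) ms)"
      using Cons.IH by blast
    with False show ?thesis using Cons.prems(1)[of "Suc b"] by simp
  qed
qed simp

lemma sum_list_phi: "p \<in> P_ord n \<Longrightarrow> sum_list (phi n p) = n"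
  using descending_props(2)[of n "count_list p"]
  by (simp add: phi_eq P_ord_def P_set_def descending_count_list rev_map[symmetric]
      interv_sum_list_conv_sum_set_nat atLeast0LessThan)

text \<open>Block b of \<open>phi n p\<close> is the run of places where p has the value n - 1 - b.
  This turns alternation inside exterior powers into alternation in slots of equal exponent.\<close>

lemma same_block_iff:
  assumes "p \<in> P_ord n" "i < j" "j < n"
  shows "p ! i = p ! j \<longleftrightarrow> (\<exists>b < length (phi n p).
    sum_list (take b (phi n p)) \<le> i \<and> j < sum_list (take (Suc b) (phi n p)))" (is "_ \<longleftrightarrow> ?R")
proof -
  have len: "length p = n" using assms(1) by (simp add: P_ord_def P_set_def)
  let ?k = "phi n p"
  have "p = concat (map2 replicate ?k (rev [0..<n]))"
    using descending_count_list[OF assms(1)] by (simp add: descending_def phi_eq[OF len])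
  moreover have "length ?k = length (rev [0..<n])" by (simp add: phi_def)
  ultimately have nth: "p ! i = rev [0..<n] ! b"
    if "b < length ?k" "sum_list (take b ?k) \<le> i" "i < sum_list (take (Suc b) ?k)" for i b
    using that nth_concat_replicate[of ?k "rev [0..<n]" b i] by simp
  have mono: "sum_list (take b ?k) \<le> sum_list (take (Suc b) ?k)" for b
    by (cases "b < length ?k") (simp_all add: take_Suc_conv_app_nth)
  show ?thesis
  proof
    assume eq: "p ! i = p ! j"
    obtain b where b: "b < length ?k" "sum_list (take b ?k) \<le> i" "i < sum_list (take (Suc b) ?k)"
      using sum_list_take_block[of i ?k] assms by (auto simp: sum_list_phi)
    obtain b' where b': "b' < length ?k" "sum_list (take b' ?k) \<le> j" "j < sum_list (take (Suc b') ?k)"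
      using sum_list_take_block[of j ?k] assms by (auto simp: sum_list_phi)
    have "b < n" "b' < n" using b(1) b'(1) by (simp_all add: phi_def)
    moreover have "rev [0..<n] ! b = rev [0..<n] ! b'"
      using eq nth[OF b] nth[OF b'] by simp
    ultimately have "b = b'" by (simp add: rev_nth)
    with b b' show ?R by blast
  next
    assume ?R
    then obtain b where b: "b < length ?k" "sum_list (take b ?k) \<le> i" "j < sum_list (take (Suc b) ?k)"
      by blast
    with assms(2) show "p ! i = p ! j"
      using nth[OF b(1), of i] nth[OF b(1), of j] by simp
  qed
qed

section \<open>Families, \<open>Psi\<close> and alternating maps\<close>

context novikov_algebra
begin

text \<open>The sign rule is read at the index \<open>permute_list \<sigma> p\<close>, where the
  action undoes the permutation of exponents; off \<open>P_set n\<close> both sides are 0.\<close>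

lemma mem_CE_iff_pointwise: "F \<in> CE NovOp n \<longleftrightarrow> F \<in> families n \<and>
    (\<forall>\<sigma> p xs. \<sigma> permutes {..<n} \<longrightarrow> p \<in> P_set n \<longrightarrow>
      F p (permute_list (inv \<sigma>) xs) = scale (of_int (sign \<sigma>)) (F (permute_list \<sigma> p) xs))"
  (is "_ \<longleftrightarrow> _ \<and> ?R")
proof (cases "F \<in> families n")
  case True
  have act: "act NovOp \<sigma> F q xs = F (permute_list (inv \<sigma>) q) (permute_list (inv \<sigma>) xs)" for \<sigma> q xs
    by (rule act_NovOp[OF finite_supp_families[OF True]])
  have "(\<forall>\<sigma>. \<sigma> permutes {..<n} \<longrightarrow> act NovOp \<sigma> F = fam_scale scale (of_int (sign \<sigma>)) F) \<longleftrightarrow> ?R"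
  proof (intro iffI allI impI ext)
    fix \<sigma> p xs
    assume "\<forall>\<sigma>. \<sigma> permutes {..<n} \<longrightarrow> act NovOp \<sigma> F = fam_scale scale (of_int (sign \<sigma>)) F"
      and \<sigma>: "\<sigma> permutes {..<n}" and p: "p \<in> P_set n"
    then have "act NovOp \<sigma> F (permute_list \<sigma> p) xs = scale (of_int (sign \<sigma>)) (F (permute_list \<sigma> p) xs)"
      by (simp add: fam_scale_def)
    then show "F p (permute_list (inv \<sigma>) xs) = scale (of_int (sign \<sigma>)) (F (permute_list \<sigma> p) xs)"
      using \<sigma> p by (simp add: act permute_list_inv_cancel P_set_def)
  next
    fix \<sigma> q xs assume R: ?R and \<sigma>: "\<sigma> permutes {..<n}"
    show "act NovOp \<sigma> F q xs = fam_scale scale (of_int (sign \<sigma>)) F q xs"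
    proof (cases "q \<in> P_set n")
      case q: True
      with \<sigma> R permute_list_P_set[OF permutes_inv[OF \<sigma>] q] show ?thesis
        by (simp add: act fam_scale_def permute_list_inv_cancel P_set_def)
    next
      case False
      with act_families[OF True \<sigma>] True show ?thesis
        by (simp add: families_def fam_scale_def)
    qed
  qed
  with True show ?thesis by (simp add: mem_CE_iff)
qed (simp add: mem_CE_iff)

lemma C_fam_eq_CE: "C_fam scale n = CE NovOp n"
proof -
  have "F \<in> C_fam scale n \<longleftrightarrow> F \<in> families n \<and>
    (\<forall>\<sigma> p xs. \<sigma> permutes {..<n} \<longrightarrow> p \<in> P_set n \<longrightarrow>
      F p (permute_list (inv \<sigma>) xs) = scale (of_int (sign \<sigma>)) (F (permute_list \<sigma> p) xs))" for F
  proof -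
    have "F \<in> families n \<longleftrightarrow> (\<forall>p. p \<notin> P_set n \<longrightarrow> F p = 0) \<and> (\<forall>p\<in>P_set n. F p \<in> multilinear_maps scale n)"
      by (auto simp: families_def) (metis multilinear_maps_zero)
    then show ?thesis
      by (auto simp: C_fam_def EndOp_def perm_act_def fun_eq_iff)
  qed
  then show ?thesis by (auto simp: mem_CE_iff_pointwise)
qed

text \<open>As tensors are stored as functions of the exponent list, the sum of
  \<open>single p\<close> tensored with \<open>G p\<close> is G itself; the map inverted by
  \<open>Psi\<close> is the identity on \<open>C_fam\<close>.\<close>

lemma Psi_eq:
  assumes "F \<in> C_fam scale n"
  shows "Psi scale n F = F"
proof -
  have id: "(\<Sum>p\<in>P_set n. tensor (smult NovEnd) (cd_monomial p) (G p)) = G" if "G \<in> C_fam scale n" for G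
  proof -
    have "(\<Sum>p\<in>P_set n. tensor (smult NovEnd) (cd_monomial p) (G p)) =
        (\<Sum>p\<in>P_set n. tensor (smult NovEnd) (single p) (G p))"
      by (intro sum.cong refl) (metis (mono_tags) P_set_def cd_monomial_eq add_is_0 list.size(3) mem_Collect_eq one_neq_zero)
    also have "\<dots> = G" using that by (intro families_expand) (simp add: C_fam_def)
    finally show ?thesis .
  qed
  then have "inj_on (\<lambda>G. \<Sum>p\<in>P_set n. tensor (smult NovEnd) (cd_monomial p) (G p)) (C_fam scale n)"
    by (auto simp: inj_on_def)
  then show ?thesis
    unfolding Psi_def using id[OF assms] assms by (rule the_inv_into_f_eq)
qed

lemma delta_eq:
  assumes "v \<noteq> (0 :: 'g)" "n \<ge> 1" "F \<in> CE NovOp n"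
  shows "delta scale nov n F = d_CE NovOp \<nu> n F"
proof -
  have "inj_on (Psi scale n) (CE NovOp n)"
    by (auto simp: inj_on_def Psi_eq C_fam_eq_CE)
  then have "the_inv_into (CE NovOp n) (Psi scale n) F = F"
    using Psi_eq[of F n] assms(3) by (intro the_inv_into_f_eq) (auto simp: C_fam_eq_CE)
  then show ?thesis
    using d_CE_in_CE[OF assms] by (simp add: delta_def Psi_eq C_fam_eq_CE)
qed

lemma Hom_wedge_iff:
  assumes "p \<in> P_ord n"
  shows "f \<in> Hom_wedge scale (phi n p) \<longleftrightarrow> f \<in> multilinear_maps scale n \<and>
    (\<forall>xs i j. length xs = n \<longrightarrow> i < j \<longrightarrow> j < n \<longrightarrow> p ! i = p ! j \<longrightarrow> xs ! i = xs ! j \<longrightarrow> f xs = 0)"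
proof -
  have less: "j < n" if "j < sum_list (take (Suc b) (phi n p))" for b j
  proof -
    have "sum_list (take (Suc b) (phi n p)) \<le> sum_list (phi n p)"
      by (metis append_take_drop_id le_add1 sum_list_append)
    with that sum_list_phi[OF assms] show ?thesis by simp
  qed
  show ?thesis
    unfolding Hom_wedge_def using same_block_iff[OF assms] less
    by (auto simp: sum_list_phi[OF assms]) blast+
qed

text \<open>Polarisation: expand g (x + y) (x + y) = 0, where g is f as a function of slots i and
  j.\<close>

lemma alternating_transpose:
  assumes f: "f \<in> multilinear_maps scale n" and ij: "i < j" "j < n" and xs: "length xs = n"
    and alt: "\<And>xs. length xs = n \<Longrightarrow> xs ! i = xs ! j \<Longrightarrow> f xs = 0"
  shows "f (permute_list (transpose i j) xs) = - f xs"
proof -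
  define g where "g x y = f (xs[i := x, j := y])" for x y
  have lin: "f (ys[k := x + y]) = f (ys[k := x]) + f (ys[k := y])" if "length ys = n" "k < n" for ys k x y
    using f that unfolding multilinear_maps_def linear_self_iff by blast
  have right: "g x (y + z) = g x y + g x z" for x y z
    using lin[of "xs[i := x]" j y z] xs ij by (simp add: g_def)
  have left: "g (y + z) x = g y x + g z x" for x y z
    using lin[of "xs[j := x]" i y z] xs ij by (simp add: g_def list_update_swap[of i j])
  have same: "g x x = 0" for x
    using xs ij by (simp add: g_def alt)
  have "g x y = - g y x" for x y
  proof -
    have "g (x + y) (x + y) = g x x + g y x + (g x y + g y y)" by (simp only: left right)
    then show ?thesis by (simp only: same add_0_left add_0_right eq_neg_iff_add_eq_0 add.commute)
  qed
  moreover have "permute_list (transpose i j) xs = xs[i := xs ! j, j := xs ! i]"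
  proof (rule nth_equalityI)
    have "transpose i j permutes {..<length xs}"
      using ij xs by (intro permutes_swap_id) auto
    then show "permute_list (transpose i j) xs ! k = xs[i := xs ! j, j := xs ! i] ! k"
      if "k < length (permute_list (transpose i j) xs)" for k
      using that ij xs by (auto simp: permute_list_nth nth_list_update transpose_def)
  qed simp
  moreover have "xs = xs[i := xs ! i, j := xs ! j]" by simp
  ultimately show ?thesis by (metis g_def)
qed

text \<open>Alternation is available only between slots of equal exponent. A permutation fixing p is
  a product of transpositions of such slots, and each contributes one sign.\<close>

lemma alternating_stabiliser:
  assumes f: "f \<in> multilinear_maps scale n"
    and alt: "\<And>xs i j. length xs = n \<Longrightarrow> i < j \<Longrightarrow> j < n \<Longrightarrow> p ! i = p ! j \<Longrightarrow> xs ! i = xs ! j \<Longrightarrow> f xs = 0"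
    and \<pi>: "\<pi> permutes {..<n}" "permute_list \<pi> p = p" "length p = n" and xs: "length xs = n"
  shows "f (permute_list \<pi> xs) = scale (of_int (sign \<pi>)) (f xs)"
proof -
  have "p ! \<pi> i = p ! i" for i
    using \<pi> permute_list_nth[of \<pi> p i] permutes_not_in[OF \<pi>(1), of i] by (cases "i < n") auto
  from \<pi>(1) finite_lessThan this
  have "\<forall>xs. length xs = n \<longrightarrow> f (permute_list \<pi> xs) = scale (of_int (sign \<pi>)) (f xs)"
  proof (induction rule: permutes_stabiliser_induct)
    case id
    then show ?case by (simp add: id_def)
  next
    case (swap a b q)
    show ?case
    proof (intro allI impI)
      fix xs :: "'g list" assume l: "length xs = n"
      have tr: "f (permute_list (transpose a b) xs) = - f xs"
      proof (cases "a < b")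
        case True
        then show ?thesis
          using swap l by (intro alternating_transpose[OF f]) (auto intro: alt)
      next
        case False
        have "f ys = 0" if "length ys = n" "ys ! b = ys ! a" for ys
          using alt[of ys b a] that swap False by auto
        then have "f (permute_list (transpose b a) xs) = - f xs"
          using swap l False by (intro alternating_transpose[OF f]) auto
        then show ?thesis by (simp add: transpose_commute)
      qed
      have "permutation q" using swap by (auto simp: permutation_permutes)
      then have "sign (transpose a b \<circ> q) = - sign q"
        using swap by (simp add: sign_compose permutation_swap_id sign_swap_id del: comp_apply)
      moreover have "permute_list (transpose a b \<circ> q) xs = permute_list q (permute_list (transpose a b) xs)"
        using swap l by (intro permute_list_compose) auto
      ultimately show "f (permute_list (transpose a b \<circ> q) xs) =
          scale (of_int (sign (transpose a b \<circ> q))) (f xs)"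
        using swap(6) l tr by (simp del: comp_apply)
    qed
  qed
  with xs show ?thesis by blast
qed

section \<open>Restriction to descending exponent lists is bijective\<close>

lemma Phi_phi: "p \<in> P_ord n \<Longrightarrow> Phi n F (phi n p) = F p"
  using bij_betw_phi[of n] by (auto simp: Phi_def bij_betw_def the_inv_into_f_f)

lemma K_set_cases:
  assumes "k \<in> K_set n"
  obtains p where "p \<in> P_ord n" "k = phi n p"
  using assms bij_betw_phi[of n] by (auto simp: bij_betw_def)

lemma sorting_permutation:
  assumes "p \<in> P_set n"
  obtains \<sigma> where "\<sigma> permutes {..<n}" "permute_list \<sigma> p \<in> P_ord n"
proof -
  have "mset (rev (sort p)) = mset p" by simp
  then obtain \<sigma> where \<sigma>: "\<sigma> permutes {..<length p}" "permute_list \<sigma> p = rev (sort p)"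
    by (rule mset_eq_permutation)
  moreover have "sorted_wrt (\<ge>) (rev (sort p))" by (simp add: sorted_wrt_rev)
  ultimately show thesis
    using that[of \<sigma>] assms permute_list_P_set[of \<sigma> n p] by (simp add: P_ord_def P_set_def)
qed

lemma CE_permute:
  assumes "F \<in> CE NovOp n" "\<sigma> permutes {..<n}" "p \<in> P_set n" "length xs = n"
  shows "F p xs = scale (of_int (sign \<sigma>)) (F (permute_list \<sigma> p) (permute_list \<sigma> xs))"
  using assms by (metis mem_CE_iff_pointwise permute_list_inv_cancel(2))

lemma Phi_in_C_Nov:
  assumes "F \<in> CE NovOp n"
  shows "Phi n F \<in> C_Nov scale n"
proof -
  have F: "F \<in> families n" using assms by (simp add: mem_CE_iff)
  have "F p \<in> Hom_wedge scale (phi n p)" if p: "p \<in> P_ord n" for p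
    unfolding Hom_wedge_iff[OF p]
  proof (intro conjI allI impI)
    show "F p \<in> multilinear_maps scale n" using F by (simp add: families_def)
    have p': "p \<in> P_set n" "length p = n" using p by (auto simp: P_ord_def P_set_def)
    fix xs :: "'g list" and i j assume xs: "length xs = n" and ij: "i < j" "j < n" "p ! i = p ! j" "xs ! i = xs ! j"
    let ?\<tau> = "transpose i j"
    have \<tau>: "?\<tau> permutes {..<n}" using ij by (intro permutes_swap_id) auto
    have "permute_list ?\<tau> p = p" "permute_list ?\<tau> xs = xs"
      using \<tau> xs p'(2) ij by (auto intro!: nth_equalityI simp: permute_list_nth transpose_def)
    then have "F p xs = - F p xs"
      using CE_permute[OF assms \<tau> p'(1) xs] ij by (simp add: sign_swap_id)
    \<comment> \<open>The transposition fixes both p and xs, so the value equals its own negative;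
      characteristic 0 makes it vanish.\<close>
    then have "scale 2 (F p xs) = 0"
      using scale_left_distrib[of 1 1 "F p xs"] by (simp add: eq_neg_iff_add_eq_0)
    then show "F p xs = 0" by simp
  qed
  then show ?thesis
    by (auto simp: C_Nov_def Phi_phi elim!: K_set_cases) (simp add: Phi_def)
qed

lemma inj_on_Phi: "inj_on (Phi n) (CE NovOp n)"
proof (rule inj_onI, intro ext)
  fix F G p xs assume F: "F \<in> CE NovOp n" and G: "G \<in> CE NovOp n" and eq: "Phi n F = Phi n G"
  show "F p xs = G p xs"
  proof (cases "p \<in> P_set n \<and> length xs = n")
    case True
    then obtain \<sigma> where \<sigma>: "\<sigma> permutes {..<n}" "permute_list \<sigma> p \<in> P_ord n"
      by (auto elim: sorting_permutation)
    have "F (permute_list \<sigma> p) = G (permute_list \<sigma> p)"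
      using eq Phi_phi[OF \<sigma>(2)] by metis
    with True \<sigma>(1) show ?thesis
      using CE_permute[OF F \<sigma>(1)] CE_permute[OF G \<sigma>(1)] by simp
  next
    case False
    then show ?thesis using F G by (auto simp: mem_CE_iff families_def multilinear_maps_iff)
  qed
qed

text \<open>The family is forced: its member at p is the given component at the sorted list, with
  arguments permuted and the sign inserted. It is well defined because two sorting permutations of p
  differ by a stabiliser of the sorted list.\<close>

lemma C_Nov_subset_Phi:
  assumes c: "c \<in> C_Nov scale n"
  obtains F where "F \<in> CE NovOp n" "Phi n F = c"
proof -
  define \<sigma> where "\<sigma> p = (SOME \<sigma>. \<sigma> permutes {..<n} \<and> permute_list \<sigma> p \<in> P_ord n)" for p
  have \<sigma>: "\<sigma> p permutes {..<n}" "permute_list (\<sigma> p) p \<in> P_ord n" if "p \<in> P_set n" for p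
    using that someI_ex[of "\<lambda>\<sigma>. \<sigma> permutes {..<n} \<and> permute_list \<sigma> p \<in> P_ord n"]
    unfolding \<sigma>_def by (auto elim: sorting_permutation)
  define F where "F p = (\<lambda>xs. if p \<in> P_set n then
    scale (of_int (sign (\<sigma> p))) (c (phi n (permute_list (\<sigma> p) p)) (permute_list (\<sigma> p) xs)) else 0)" for p
  have wedge: "c (phi n s) \<in> multilinear_maps scale n"
    "\<And>xs i j. length xs = n \<Longrightarrow> i < j \<Longrightarrow> j < n \<Longrightarrow> s ! i = s ! j \<Longrightarrow> xs ! i = xs ! j \<Longrightarrow> c (phi n s) xs = 0"
    if "s \<in> P_ord n" for s
  proof -
    have "phi n s \<in> K_set n" using that bij_betw_phi[of n] by (auto simp: bij_betw_def)
    then have "c (phi n s) \<in> Hom_wedge scale (phi n s)" using c by (simp add: C_Nov_def)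
    then show "c (phi n s) \<in> multilinear_maps scale n"
      "\<And>xs i j. length xs = n \<Longrightarrow> i < j \<Longrightarrow> j < n \<Longrightarrow> s ! i = s ! j \<Longrightarrow> xs ! i = xs ! j \<Longrightarrow> c (phi n s) xs = 0"
      unfolding Hom_wedge_iff[OF that] by blast+
  qed
  \<comment> \<open>The arbitrary choice made in \<sigma> is replaced by any sorting permutation
    \<tau>.\<close>
  have F_eq: "F p xs = scale (of_int (sign \<tau>)) (c (phi n (permute_list \<tau> p)) (permute_list \<tau> xs))"
    if p: "p \<in> P_set n" and \<tau>: "\<tau> permutes {..<n}" "permute_list \<tau> p \<in> P_ord n" and xs: "length xs = n" for p \<tau> xs
  proof -
    let ?\<sigma> = "\<sigma> p"
    let ?s = "permute_list \<tau> p"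
    have len: "length p = n" using p by (simp add: P_set_def)
    have s: "permute_list ?\<sigma> p = ?s"
      using \<sigma>[OF p] \<tau> len by (intro sorted_desc_unique) (auto simp: P_ord_def)
    \<comment> \<open>With this \<pi> the composite of \<tau> and \<pi> is the chosen permutation.
      Both sort p to the same list, so \<pi> fixes that list.\<close>
    define \<pi> where "\<pi> = inv \<tau> \<circ> ?\<sigma>"
    have \<pi>: "\<pi> permutes {..<n}"
      unfolding \<pi>_def using \<sigma>(1)[OF p] \<tau>(1) by (intro permutes_compose permutes_inv)
    have perm_xs: "permute_list \<pi> (permute_list \<tau> xs) = permute_list ?\<sigma> xs"
      using permute_list_compose[of \<pi> xs \<tau>] \<pi> xs permutes_inv_o(1)[OF \<tau>(1)]
      by (simp add: \<pi>_def o_assoc)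
    have perm_p: "permute_list \<pi> ?s = ?s"
      using permute_list_compose[of \<pi> p \<tau>] \<pi> len permutes_inv_o(1)[OF \<tau>(1)] s
      by (simp add: \<pi>_def o_assoc)
    have "c (phi n ?s) (permute_list \<pi> (permute_list \<tau> xs)) =
        scale (of_int (sign \<pi>)) (c (phi n ?s) (permute_list \<tau> xs))"
      using wedge[OF \<tau>(2)] \<pi> perm_p len xs by (intro alternating_stabiliser[where p = ?s]) auto
    moreover have "sign ?\<sigma> * sign \<pi> = sign \<tau>"
    proof -
      have "permutation ?\<sigma>" "permutation \<tau>" "permutation (inv \<tau>)"
        using \<sigma>(1)[OF p] \<tau>(1) permutes_inv[OF \<tau>(1)] by (auto simp: permutation_permutes)
      then have "sign \<pi> = sign \<tau> * sign ?\<sigma>"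
        by (simp only: \<pi>_def sign_compose sign_inverse)
      then show ?thesis by (simp add: mult.left_commute)
    qed
    ultimately show ?thesis
      using p s by (simp add: F_def perm_xs flip: of_int_mult)
  qed
  have "F \<in> families n"
  proof -
    have "F p \<in> multilinear_maps scale n" if "p \<in> P_set n" for p
      unfolding F_def using that \<sigma>[OF that] wedge(1)
      by (simp add: multilinear_maps_scale multilinear_maps_perm)
    moreover have "F p = 0" if "p \<notin> P_set n" for p
      using that by (simp add: F_def fun_eq_iff)
    ultimately show ?thesis
      by (auto simp: families_def) (metis multilinear_maps_zero)
  qed
  moreover have "F p (permute_list (inv \<rho>) xs) = scale (of_int (sign \<rho>)) (F (permute_list \<rho> p) xs)"
    if \<rho>: "\<rho> permutes {..<n}" and p: "p \<in> P_set n" for \<rho> p xs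
  proof (cases "length xs = n")
    case True
    let ?q = "permute_list \<rho> p"
    have q: "?q \<in> P_set n" using p \<rho> by (simp add: permute_list_P_set)
    have len: "length p = n" using p by (simp add: P_set_def)
    obtain \<tau> where \<tau>: "\<tau> permutes {..<n}" "permute_list \<tau> ?q \<in> P_ord n"
      using q by (rule sorting_permutation)
    \<comment> \<open>If \<tau> sorts the permuted list, then the composite of \<rho> and \<tau>
      sorts p. Comparing \<open>F_eq\<close> for these two leaves precisely the sign of
      \<rho>.\<close>
    have "permute_list (\<rho> \<circ> \<tau>) p = permute_list \<tau> ?q"
      using \<tau>(1) len by (intro permute_list_compose) simp
    moreover have "permute_list (\<rho> \<circ> \<tau>) (permute_list (inv \<rho>) xs) = permute_list \<tau> xs"
      using \<tau>(1) True \<rho> by (subst permute_list_compose) (simp_all add: permute_list_inv_cancel)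
    moreover have "sign (\<rho> \<circ> \<tau>) = sign \<rho> * sign \<tau>"
      using \<rho> \<tau>(1) by (intro sign_compose) (auto simp: permutation_permutes)
    ultimately show ?thesis
      using F_eq[OF p permutes_compose[OF \<tau>(1) \<rho>], of "permute_list (inv \<rho>) xs"]
        F_eq[OF q \<tau>, of xs] \<tau>(2) True by simp
  next
    case False
    with \<open>F \<in> families n\<close> show ?thesis by (auto simp: families_def multilinear_maps_iff)
  qed
  ultimately have F: "F \<in> CE NovOp n" by (simp add: mem_CE_iff_pointwise)
  have "Phi n F k = c k" for k
  proof (cases "k \<in> K_set n")
    case True
    then obtain s where s: "s \<in> P_ord n" "k = phi n s" by (rule K_set_cases)
    then have "s \<in> P_set n" by (simp add: P_ord_def)
    have "F s xs = c (phi n s) xs" for xs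
    proof (cases "length xs = n")
      case True
      then show ?thesis
        using F_eq[OF \<open>s \<in> P_set n\<close> permutes_id, of xs] s(1) by simp
    next
      case False
      then show ?thesis
        using \<open>F \<in> families n\<close> wedge(1)[OF s(1)] by (auto simp: families_def multilinear_maps_iff)
    qed
    with s show ?thesis by (auto simp: Phi_phi)
  next
    case False
    with c show ?thesis by (simp add: Phi_def C_Nov_def)
  qed
  then have "Phi n F = c" by blast
  with F show thesis by (rule that)
qed

section \<open>Transport of the complex along \<open>Phi\<close>\<close>

lemma Phi_add:
  fixes F G :: "nat list \<Rightarrow> 'g list \<Rightarrow> 'g"
  shows "Phi n (F + G) = Phi n F + Phi n G"
  by (simp add: Phi_def fun_eq_iff)

lemma Phi_scale: "Phi n (fam_scale scale a F) = fam_scale scale a (Phi n F)"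
  by (simp add: Phi_def fam_scale_def fun_eq_iff)

text \<open>With \<open>Psi\<close> the identity, \<open>d_Nov\<close> is \<open>d_CE\<close>
  conjugated by \<open>Phi\<close>, and injectivity of \<open>Phi\<close> removes the inverse. Every
  element of \<open>C_Nov\<close> has the form \<open>Phi n F\<close>, so this determines
  \<open>d_Nov\<close> there.\<close>

lemma d_Nov_Phi:
  assumes "v \<noteq> (0 :: 'g)" "n \<ge> 1" "F \<in> CE NovOp n"
  shows "d_Nov scale nov n (Phi n F) = Phi (Suc n) (d_CE NovOp \<nu> n F)"
  using assms by (simp add: d_Nov_def C_fam_eq_CE the_inv_into_f_f[OF inj_on_Phi] delta_eq)

lemma zero_in_CE: "0 \<in> CE NovOp n"
  by (intro CE_I families_zero) (simp add: skew_def eval_def)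

lemma subspace_C_Nov: "module.subspace (fam_scale scale) (C_Nov scale n)"
  unfolding module.subspace_def[OF module_fam_scale]
proof (intro conjI ballI allI)
  have "Phi n 0 = 0" by (simp add: Phi_def fun_eq_iff)
  then show "0 \<in> C_Nov scale n" using Phi_in_C_Nov[OF zero_in_CE] by metis
  fix c c' assume "c \<in> C_Nov scale n" "c' \<in> C_Nov scale n"
  then show "c + c' \<in> C_Nov scale n"
    by (metis C_Nov_subset_Phi Phi_in_C_Nov CE_add Phi_add)
next
  fix a c assume "c \<in> C_Nov scale n"
  then show "fam_scale scale a c \<in> C_Nov scale n"
    by (metis C_Nov_subset_Phi Phi_in_C_Nov CE_scale Phi_scale)
qed

lemma cochain_complex_Nov: "cochain_complex (fam_scale scale) (C_Nov scale) (d_Nov scale nov)"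
proof (cases "\<exists>v :: 'g. v \<noteq> 0")
  case True
  then obtain v :: 'g where v: "v \<noteq> 0" by blast
  have "linear_between (fam_scale scale) (C_Nov scale n) (C_Nov scale (n + 1)) (d_Nov scale nov n)"
    if n: "n \<ge> 1" for n
    unfolding linear_between_def
  proof (intro conjI ballI allI image_subsetI)
    fix c assume "c \<in> C_Nov scale n"
    then obtain F where F: "F \<in> CE NovOp n" "Phi n F = c" by (rule C_Nov_subset_Phi)
    then show "d_Nov scale nov n c \<in> C_Nov scale (n + 1)"
      using d_Nov_Phi[OF v n F(1)] Phi_in_C_Nov[OF d_CE_in_CE[OF v n F(1)]] by simp
    show "d_Nov scale nov n (fam_scale scale a c) = fam_scale scale a (d_Nov scale nov n c)" for a
      using d_Nov_Phi[OF v n F(1)] d_Nov_Phi[OF v n CE_scale[OF F(1)]] F(2)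
      by (simp add: Phi_scale d_CE_scale[OF v n F(1)])
    fix c' assume "c' \<in> C_Nov scale n"
    then obtain G where G: "G \<in> CE NovOp n" "Phi n G = c'" by (rule C_Nov_subset_Phi)
    show "d_Nov scale nov n (c + c') = d_Nov scale nov n c + d_Nov scale nov n c'"
      using d_Nov_Phi[OF v n F(1)] d_Nov_Phi[OF v n G(1)] d_Nov_Phi[OF v n CE_add[OF F(1) G(1)]] F(2) G(2)
      by (simp add: Phi_add d_CE_add[OF v n F(1) G(1)])
  qed
  moreover have "d_Nov scale nov (n + 1) (d_Nov scale nov n c) = 0" if n: "n \<ge> 1" and c: "c \<in> C_Nov scale n" for n c
  proof -
    obtain F where F: "F \<in> CE NovOp n" "Phi n F = c" using c by (rule C_Nov_subset_Phi)
    have "d_Nov scale nov (n + 1) (d_Nov scale nov n c) = Phi (Suc (Suc n)) 0"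
      using d_Nov_Phi[OF v n F(1)] d_Nov_Phi[OF v _ d_CE_in_CE[OF v n F(1)]] F(2)
      by (simp add: d_CE_d_CE[OF v n F(1)])
    then show ?thesis by (simp add: Phi_def fun_eq_iff)
  qed
  ultimately show ?thesis
    by (simp add: cochain_complex_def subspace_C_Nov)
next
  \<comment> \<open>For \<open>\<gg> = 0\<close> the operadic identity has empty support, and \<open>supp_ident_NovOp\<close> fails.\<close>
  case False
  then have eq: "x = y" for x y :: "nat list \<Rightarrow> 'g list \<Rightarrow> 'g"
    by (intro ext) metis
  have "0 \<in> C_Nov scale n" for n
    using subspace_C_Nov by (rule module.subspace_0[OF module_fam_scale])
  then have "x \<in> C_Nov scale n" for x n
    using eq[of x 0] by simp
  then show ?thesis
    unfolding cochain_complex_def linear_between_def using subspace_C_Nov by (auto intro: eq)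
qed

end

theorem theorem3p12:
  fixes scale :: "'k::field_char_0 \<Rightarrow> 'g::ab_group_add \<Rightarrow> 'g"
    and nov :: "'g \<Rightarrow> 'g \<Rightarrow> 'g"
  assumes "novikov_algebra scale nov"
  shows "cochain_complex (fam_scale scale) (C_Nov scale) (d_Nov scale nov)"
  using assms by (rule novikov_algebra.cochain_complex_Nov)

end
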